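(* Let $\mathcal F\in\{\mathcal T,\mathcal H\}$ be the Tucker or the hierarchical Tucker format, let $\kappa_{\rm P}=\sqrt m$ if $\mathcal F=\mathcal T$ and $\kappa_{\rm P}=\sqrt{2m-3}$ if $\mathcal F=\mathcal H$, let $\gamma$ be a growth sequence, and let $\alpha>0$, $\eta>0$. Assume that $\mathbf u\in\mathcal A_{\mathcal F}(\gamma)$ and that $\mathbf v\in\ell_2(\nabla^d)$ satisfies $\|\mathbf u-\mathbf v\|\le\eta$. Then, defining $\mathbf w_\eta:=\hat P_{\kappa_{\rm P}(1+\alpha)\eta}\mathbf v$, one has $$|\mathrm{rank}(\mathbf w_\eta)|_\infty\le\gamma^{-1}\bigl(\rho_\gamma\|\mathbf u\|_{\mathcal A_{\mathcal F}(\gamma)}/(\alpha\eta)\bigr),\qquad\|\mathbf u-\mathbf w_\eta\|\le(1+\kappa_{\rm P}(1+\alpha))\eta,$$ and $$\|\mathbf w_\eta\|_{\mathcal A_{\mathcal F}(\gamma)}\le C\|\mathbf u\|_{\mathcal A_{\mathcal F}(\gamma)},\qquad C=\alpha^{-1}(1+\kappa_{\rm P}(1+\alpha))+1 .$$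
   Context: **Basic notation.** $m\ge2$, $d=d_1+\dots+d_m$, $d_i\in\mathbb N$; $\nabla$ is a countable index set; $\nu\in\nabla^d$ is written $(\nu_1,\dots,\nu_m)$, $\nu_i\in\nabla^{d_i}$; $\check\nu_i$ is $\nu$ with $\nu_i$ deleted. $\|\cdot\|$ is the $\ell_2$-norm. $|\mathsf r|_\infty$ is the maximal entry of a rank vector. **Tucker format $\mathcal T$.** For $\mathbf u\in\ell_2(\nabla^d)$ let $T^{(i)}_{\mathbf u}:\ell_2(\nabla^{d-d_i})\to\ell_2(\nabla^{d_i})$, $\mathbf c\mapsto(\sum_{\check\nu_i}u_\nu c_{\check\nu_i})_{\nu_i}$ (Hilbert--Schmidt), $\mathrm{rank}_i(\mathbf u)=\dim\mathrm{range}\,T^{(i)}_{\mathbf u}\in\mathbb N_0\cup\{\infty\}$, with nonincreasing singular values $\sigma^{(i)}_k$ and orthonormal left singular vectors $\mathbf U^{(i)}_k$ (both zero for $k>\mathrm{rank}_i(\mathbf u)$). $\mathrm{rank}(\mathbf u)=(\mathrm{rank}_i(\mathbf u))_{i=1}^m$, $\mathcal R_{\mathcal T}=(\mathbb N_0\cup\{\infty\})^m$, $\mathcal T(\mathsf r)=\{\mathbf v:\mathrm{rank}_i(\mathbf v)\le r_i,\ i=1,\dots,m\}$, $P_{\mathbb U(\mathbf u),\mathsf r}\mathbf v=\sum_{k_1\le r_1,\dots,k_m\le r_m}\langle\mathbf v,\bigotimes_i\mathbf U^{(i)}_{k_i}\rangle\bigotimes_i\mathbf U^{(i)}_{k_i}$,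 $\lambda_{\mathsf r}(\mathbf u)=\bigl(\sum_{i=1}^m\sum_{k>r_i}|\sigma^{(i)}_k|^2\bigr)^{1/2}$. **Hierarchical Tucker format $\mathcal H$.** A fixed (binary) dimension tree $\mathcal D_m\subset2^{\{1,\dots,m\}}$ contains the root $0_m=\{1,\dots,m\}$ and all singletons (leaves), and each $\alpha\in\mathcal D_m$ is a singleton or the disjoint union of two unique elements (children) $c_1(\alpha),c_2(\alpha)\in\mathcal D_m$, with $\min c_1(\alpha)<\min c_2(\alpha)$. For $\alpha\in\mathcal D_m\setminus\{0_m\}$ let $T^{(\alpha)}_{\mathbf u}:\mathbf c\mapsto\bigl(\sum_{(\nu_j)_{j\notin\alpha}}u_\nu c_{(\nu_j)_{j\notin\alpha}}\bigr)_{(\nu_j)_{j\in\alpha}}$, $\mathrm{rank}_\alpha(\mathbf u)=\dim\mathrm{range}\,T^{(\alpha)}_{\mathbf u}$, with nonincreasing singular values $\sigma^{(\alpha)}_k$ and orthonormal left singular vectors $\mathbf U^{(\alpha)}_k$ (zero for $k>\mathrm{rank}_\alpha(\mathbf u)$). $\mathrm{rank}(\mathbf u)=(\mathrm{rank}_\alpha(\mathbf u))_{\alpha\ne0_m}$. Hierarchical mode frames are families of vectors $\mathbf V^{(\alpha)}_k\in\ell_2(\nabla^{\sum_{j\in\alpha}d_j})$, $k=1,\dots,k_\alpha\le\infty$, $\alpha\ne0_m$; orthonormal if orthonormal for each $\alpha$; nested if $\overline{\mathrm{span}}\{\mathbf V^{(\alpha)}_k\}\subseteq\overline{\mathrm{span}}\{\mathbf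 V^{(c_1(\alpha))}_k\}\otimes\overline{\mathrm{span}}\{\mathbf V^{(c_2(\alpha))}_k\}$ for every $\alpha$ that is neither root nor leaf. $\mathcal R_{\mathcal H}$ is the set of $\mathsf r\in(\mathbb N_0\cup\{\infty\})^{\mathcal D_m\setminus\{0_m\}}$ satisfying the compatibility conditions for nestedness, i.e. for which nested orthonormal hierarchical mode frames with $k_\alpha=r_\alpha$ exist. $\mathcal H(\mathsf r)=\{\mathbf v:\mathrm{rank}_\alpha(\mathbf v)\le r_\alpha\ \forall\alpha\ne0_m\}$. With $\mathcal D^\ell_m$ the nodes at distance $\ell$ from the root and $L$ the largest such distance, $P_{\mathbb U(\mathbf u),\mathsf r}=P_L\cdots P_2P_1$, where $P_\ell$ applies $\sum_{k=1}^{r_\alpha}\langle\mathbf U^{(\alpha)}_k,\cdot\rangle\mathbf U^{(\alpha)}_k$ to the modes in $\alpha$ for each $\alpha\in\mathcal D^\ell_m$ and the identity to the modes contained in no $\alpha\in\mathcal D^\ell_m$. $\lambda_{\mathsf r}(\mathbf u)=\bigl(\sum_\alpha\sum_{k>r_\alpha}|\sigma^{(\alpha)}_k|^2\bigr)^{1/2}$, with $\alpha$ ranging over $\mathcal D_m\setminus\{0_m,c_2(0_m)\}$ if $r_{c_1(0_m)}\le r_{c_2(0_m)}$, and over $\mathcal D_m\setminus\{0_m,c_1(0_m)\}$ otherwise. **Recompression.** $\hat P_\eta\mathbf v:=P_{\mathbb U(\mathbf v),\mathsf r(\mathbf v,\eta)}\mathbf v$, where $\mathsf r(\mathbf v,\eta)\in\operatorname{arg\,min}\{|\mathsf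 r|_\infty:\mathsf r\in\mathcal R_{\mathcal F},\ \lambda_{\mathsf r}(\mathbf v)\le\eta\}$. **Rank approximation classes.** A growth sequence is a positive, strictly increasing $\gamma=(\gamma(n))_{n\in\mathbb N_0}$ with $\gamma(0)=1$, $\gamma(n)\to\infty$; $\rho_\gamma:=\sup_{n\in\mathbb N}\gamma(n)/\gamma(n-1)$ (if $\rho_\gamma=\infty$, the bound involving it is void). $\gamma^{-1}(x)=\max\{n\in\mathbb N_0:\gamma(n)\le x\}$ for $x\ge1$, and $0$ for $x<1$. $\sigma_{r,\mathcal F}(\mathbf v)=\inf\{\|\mathbf v-\mathbf w\|:\mathbf w\in\mathcal F(\mathsf r),\ \mathsf r\in\mathcal R_{\mathcal F},\ |\mathsf r|_\infty\le r\}$, $|\mathbf v|_{\mathcal A_{\mathcal F}(\gamma)}=\sup_{r\in\mathbb N_0}\gamma(r)\sigma_{r,\mathcal F}(\mathbf v)$, $\mathcal A_{\mathcal F}(\gamma)$ is the set where this is finite, $\|\mathbf v\|_{\mathcal A_{\mathcal F}(\gamma)}=\|\mathbf v\|+|\mathbf v|_{\mathcal A_{\mathcal F}(\gamma)}$.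
   Formalization: In the hierarchical format, the singular vectors at the two children of the root are required to be the left and right singular vectors of one common SVD; for independent choices with multiple singular values the error bound can fail. *)

theory Defs
  imports "HOL-Analysis.Analysis" "HOL-Library.Extended_Nat"
begin

section \<open>The real Hilbert space of square-summable families\<close>

typedef 'i ell2 = "{f :: 'i \<Rightarrow> real. (\<lambda>x. (f x)\<^sup>2) summable_on UNIV}"
  morphisms entry Abs_ell2
  by (rule exI[of _ "\<lambda>_. 0"]) simp

lemma entry_summable: "(\<lambda>x. (entry u x)\<^sup>2) summable_on UNIV"
  using entry[of u] by simp

lemma entry_Abs_ell2: "(\<lambda>x. (f x)\<^sup>2) summable_on UNIV \<Longrightarrow> entry (Abs_ell2 f) = f"
  by (simp add: Abs_ell2_inverse)

lemma ell2_eqI: "(\<And>x. entry u x = entry v x) \<Longrightarrow> u = v"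
  by (simp add: entry_inject[symmetric] fun_eq_iff)

lemma square_summable_mult:
  fixes f g :: "'i \<Rightarrow> real"
  assumes "(\<lambda>x. (f x)\<^sup>2) summable_on UNIV" "(\<lambda>x. (g x)\<^sup>2) summable_on UNIV"
  shows "(\<lambda>x. f x * g x) summable_on UNIV"
proof -
  have sq: "(\<lambda>x. (f x)\<^sup>2 + (g x)\<^sup>2) summable_on UNIV"
    by (rule summable_on_add[OF assms])
  have le: "norm (f x * g x) \<le> (f x)\<^sup>2 + (g x)\<^sup>2" for x
  proof -
    have "2 * (\<bar>f x\<bar> * \<bar>g x\<bar>) \<le> \<bar>f x\<bar>\<^sup>2 + \<bar>g x\<bar>\<^sup>2"
      using sum_squares_bound[of "\<bar>f x\<bar>" "\<bar>g x\<bar>"] by simp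
    moreover have "0 \<le> \<bar>f x\<bar> * \<bar>g x\<bar>" by simp
    ultimately have "\<bar>f x\<bar> * \<bar>g x\<bar> \<le> \<bar>f x\<bar>\<^sup>2 + \<bar>g x\<bar>\<^sup>2" by linarith
    then show ?thesis by (simp add: abs_mult)
  qed
  have "(\<lambda>x. norm (f x * g x)) summable_on UNIV"
    by (rule Infinite_Sum.abs_summable_on_comparison_test'[OF sq le])
  then show ?thesis by (subst summable_on_iff_abs_summable_on_real)
qed

lemma square_summable_add:
  fixes f g :: "'i \<Rightarrow> real"
  assumes f: "(\<lambda>x. (f x)\<^sup>2) summable_on UNIV" and g: "(\<lambda>x. (g x)\<^sup>2) summable_on UNIV"
  shows "(\<lambda>x. (f x + g x)\<^sup>2) summable_on UNIV"
proof -
  have "(\<lambda>x. ((f x)\<^sup>2 + (g x)\<^sup>2) + 2 * (f x * g x)) summable_on UNIV"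
    by (intro summable_on_add f g summable_on_cmult_right square_summable_mult)
  then show ?thesis by (simp add: power2_sum mult.assoc)
qed

lemma square_summable_scale:
  fixes f :: "'i \<Rightarrow> real"
  assumes "(\<lambda>x. (f x)\<^sup>2) summable_on UNIV"
  shows "(\<lambda>x. (c * f x)\<^sup>2) summable_on UNIV"
  using summable_on_cmult_right[OF assms, of "c\<^sup>2"] by (simp add: power_mult_distrib)

instantiation ell2 :: (type) real_vector
begin

definition "0 = Abs_ell2 (\<lambda>_. 0)"
definition "u + v = Abs_ell2 (\<lambda>x. entry u x + entry v x)"
definition "scaleR c u = Abs_ell2 (\<lambda>x. c * entry u x)"
definition "- u = Abs_ell2 (\<lambda>x. - entry u x)" for u :: "'a ell2"
definition "u - v = Abs_ell2 (\<lambda>x. entry u x - entry v x)"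

lemma entry_zero: "entry 0 x = 0"
  by (simp add: zero_ell2_def entry_Abs_ell2)

lemma entry_add: "entry (u + v) x = entry u x + entry v x"
  by (simp add: plus_ell2_def entry_Abs_ell2 square_summable_add entry_summable)

lemma entry_scaleR: "entry (c *\<^sub>R u) x = c * entry u x"
  by (simp add: scaleR_ell2_def entry_Abs_ell2 square_summable_scale entry_summable)

lemma entry_uminus: "entry (- u) x = - entry u x"
  by (simp add: uminus_ell2_def entry_Abs_ell2 entry_summable)

lemma entry_minus: "entry (u - v) x = entry u x - entry v x"
proof -
  have "(\<lambda>x. (entry u x + entry (- v) x)\<^sup>2) summable_on UNIV"
    by (rule square_summable_add[OF entry_summable entry_summable])
  then show ?thesis
    by (simp add: minus_ell2_def entry_Abs_ell2 entry_uminus)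
qed

instance
proof
  fix u v w :: "'a ell2" and a b :: real
  note entries = entry_zero entry_add entry_scaleR entry_uminus entry_minus
  show "u + v + w = u + (v + w)" "u + v = v + u" "0 + u = u" "- u + u = 0" "u - v = u + - v"
    by (rule ell2_eqI; simp add: entries)+
  show "a *\<^sub>R (u + v) = a *\<^sub>R u + a *\<^sub>R v" "(a + b) *\<^sub>R u = a *\<^sub>R u + b *\<^sub>R u"
    "a *\<^sub>R b *\<^sub>R u = (a * b) *\<^sub>R u" "1 *\<^sub>R u = u"
    by (rule ell2_eqI; simp add: entries algebra_simps)+
qed

end

instantiation ell2 :: (type) real_inner
begin

definition "inner u v = (\<Sum>\<^sub>\<infinity>x. entry u x * entry v x)"
definition "norm u = sqrt (inner u u)" for u :: "'a ell2"
definition "sgn u = u /\<^sub>R norm u" for u :: "'a ell2"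
definition "dist u v = norm (u - v)" for u :: "'a ell2"
definition uniformity_ell2 :: "('a ell2 \<times> 'a ell2) filter"
  where "uniformity_ell2 = (INF e\<in>{0<..}. principal {(u, v). dist u v < e})"
definition open_ell2 :: "'a ell2 set \<Rightarrow> bool"
  where "open_ell2 S \<longleftrightarrow> (\<forall>u\<in>S. \<forall>\<^sub>F (u', v) in uniformity. u' = u \<longrightarrow> v \<in> S)"

instance
proof
  fix u v w :: "'a ell2" and a :: real
  show "sgn u = u /\<^sub>R norm u" "dist u v = norm (u - v)" "norm u = sqrt (inner u u)"
    by (fact sgn_ell2_def dist_ell2_def norm_ell2_def)+
  show "uniformity = (INF e\<in>{0<..}. principal {(u, v). dist u (v :: 'a ell2) < e})"
    by (fact uniformity_ell2_def)
  show "open U \<longleftrightarrow> (\<forall>u\<in>U. \<forall>\<^sub>F (u', v) in uniformity. u' = u \<longrightarrow> v \<in> U)"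
    for U :: "'a ell2 set"
    by (fact open_ell2_def)
  show "inner u v = inner v u"
    by (simp add: inner_ell2_def mult.commute)
  show "inner (u + v) w = inner u w + inner v w"
    by (simp add: inner_ell2_def entry_add distrib_right infsum_add
        square_summable_mult entry_summable)
  show "inner (a *\<^sub>R u) v = a * inner u v"
    by (simp add: inner_ell2_def entry_scaleR mult.assoc infsum_cmult_right')
  show "0 \<le> inner u u"
    by (simp add: inner_ell2_def infsum_nonneg)
  show "inner u u = 0 \<longleftrightarrow> u = 0"
  proof
    assume "inner u u = 0"
    then have "(\<Sum>\<^sub>\<infinity>x. (entry u x)\<^sup>2) \<le> 0"
      by (simp add: inner_ell2_def power2_eq_square)
    then have "(entry u x)\<^sup>2 = 0" for x
      by (rule nonneg_infsum_le_0D[OF _ entry_summable]) auto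
    then show "u = 0" by (intro ell2_eqI) (simp add: entry_zero)
  qed (simp add: inner_ell2_def entry_zero)
qed

end

text \<open>Spaces over different index sets are the closed subspaces of families supported there.\<close>

definition ell2_on :: "'i set \<Rightarrow> 'i ell2 set"
  where "ell2_on I = {u. \<forall>x. x \<notin> I \<longrightarrow> entry u x = 0}"

definition ell2_of :: "'i set \<Rightarrow> ('i \<Rightarrow> real) \<Rightarrow> 'i ell2"
  where "ell2_of I f = Abs_ell2 (\<lambda>x. if x \<in> I then f x else 0)"

text \<open>The library's \<^const>\<open>dim\<close> is zero for infinite-dimensional spaces.\<close>

definition edim :: "'a::real_vector set \<Rightarrow> enat"
  where "edim S = (if \<exists>B. finite B \<and> S \<subseteq> span B then enat (dim S) else \<infinity>)"


section \<open>Index sets and tensors\<close>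

text \<open>
  \<open>N\<close> is the countable index set, \<open>d i\<close> the number of variables in mode \<open>i\<close>. A multi-index
  over a set \<open>\<alpha>\<close> of modes is a family with \<open>i\<close>-th member a word of length \<open>d i\<close> over \<open>N\<close>;
  \<open>multi_idx N d {1..m}\<close> is the full index set.
\<close>

definition multi_idx :: "'n set \<Rightarrow> (nat \<Rightarrow> nat) \<Rightarrow> nat set \<Rightarrow> (nat \<Rightarrow> 'n list) set"
  where "multi_idx N d \<alpha> = (\<Pi>\<^sub>E i\<in>\<alpha>. {xs. set xs \<subseteq> N \<and> length xs = d i})"

type_synonym 'n tensor = "(nat \<Rightarrow> 'n list) ell2"

abbreviation modes_space :: "'n set \<Rightarrow> (nat \<Rightarrow> nat) \<Rightarrow> nat set \<Rightarrow> 'n tensor set"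
  where "modes_space N d \<alpha> \<equiv> ell2_on (multi_idx N d \<alpha>)"

definition tensor_prod ::
  "'n set \<Rightarrow> (nat \<Rightarrow> nat) \<Rightarrow> nat set set \<Rightarrow> (nat set \<Rightarrow> 'n tensor) \<Rightarrow> 'n tensor"
  where "tensor_prod N d B x =
    ell2_of (multi_idx N d (\<Union>B)) (\<lambda>\<nu>. \<Prod>\<beta>\<in>B. entry (x \<beta>) (restrict \<nu> \<beta>))"

definition matricization ::
  "'n set \<Rightarrow> (nat \<Rightarrow> nat) \<Rightarrow> nat \<Rightarrow> nat set \<Rightarrow> 'n tensor \<Rightarrow> 'n tensor \<Rightarrow> 'n tensor"
  where "matricization N d m \<alpha> u c = ell2_of (multi_idx N d \<alpha>)
    (\<lambda>\<mu>. \<Sum>\<^sub>\<infinity>\<kappa>\<in>multi_idx N d ({1..m} - \<alpha>).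
       entry u (merge \<alpha> ({1..m} - \<alpha>) (\<mu>, \<kappa>)) * entry c \<kappa>)"

definition rank_at :: "'n set \<Rightarrow> (nat \<Rightarrow> nat) \<Rightarrow> nat \<Rightarrow> 'n tensor \<Rightarrow> nat set \<Rightarrow> enat"
  where "rank_at N d m u \<alpha> = edim (matricization N d m \<alpha> u ` modes_space N d ({1..m} - \<alpha>))"


section \<open>Singular value decompositions\<close>

definition upto_enat :: "enat \<Rightarrow> nat set"
  where "upto_enat r = {k. 1 \<le> k \<and> enat k \<le> r}"

definition orthonormal_family :: "enat \<Rightarrow> (nat \<Rightarrow> 'a::real_inner) \<Rightarrow> bool"
  where "orthonormal_family r V \<longleftrightarrow>
    (\<forall>j\<in>upto_enat r. \<forall>k\<in>upto_enat r. inner (V j) (V k) = (if j = k then 1 else 0))"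

text \<open>
  \<open>T\<close> maps \<open>X\<close> into \<open>Y\<close> and has singular values \<open>\<sigma> k\<close>, left singular vectors \<open>U k\<close> and right
  singular vectors \<open>V k\<close>, for \<open>k \<ge> 1\<close>; all of them are zero beyond the rank of \<open>T\<close>.
\<close>

definition svd :: "'a::real_inner set \<Rightarrow> 'b::real_inner set \<Rightarrow> ('a \<Rightarrow> 'b) \<Rightarrow>
    (nat \<Rightarrow> real) \<Rightarrow> (nat \<Rightarrow> 'b) \<Rightarrow> (nat \<Rightarrow> 'a) \<Rightarrow> bool"
  where "svd X Y T \<sigma> U V \<longleftrightarrow>
    orthonormal_family (edim (T ` X)) U \<and> orthonormal_family (edim (T ` X)) V \<and>
    (\<forall>k\<ge>1. U k \<in> Y \<and> V k \<in> X) \<and>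
    (\<forall>k\<in>upto_enat (edim (T ` X)). 0 < \<sigma> k) \<and>
    (\<forall>k\<ge>1. edim (T ` X) < enat k \<longrightarrow> \<sigma> k = 0 \<and> U k = 0 \<and> V k = 0) \<and>
    (\<forall>k\<ge>1. \<sigma> (Suc k) \<le> \<sigma> k) \<and>
    (\<forall>c\<in>X. ((\<lambda>k. (\<sigma> k * inner (V k) c) *\<^sub>R U k) has_sum T c) {1..})"

abbreviation mode_svd :: "'n set \<Rightarrow> (nat \<Rightarrow> nat) \<Rightarrow> nat \<Rightarrow> 'n tensor \<Rightarrow> nat set \<Rightarrow>
    (nat \<Rightarrow> real) \<Rightarrow> (nat \<Rightarrow> 'n tensor) \<Rightarrow> (nat \<Rightarrow> 'n tensor) \<Rightarrow> bool"
  where "mode_svd N d m u \<alpha> \<equiv>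
    svd (modes_space N d ({1..m} - \<alpha>)) (modes_space N d \<alpha>) (matricization N d m \<alpha> u)"


section \<open>Dimension trees\<close>

definition splits :: "nat set set \<Rightarrow> nat set \<Rightarrow> nat set \<Rightarrow> nat set \<Rightarrow> bool"
  where "splits D \<alpha> \<beta> \<beta>' \<longleftrightarrow>
    \<beta> \<in> D \<and> \<beta>' \<in> D \<and> \<alpha> = \<beta> \<union> \<beta>' \<and> \<beta> \<inter> \<beta>' = {} \<and> Min \<beta> < Min \<beta>'"

definition child1 :: "nat set set \<Rightarrow> nat set \<Rightarrow> nat set"
  where "child1 D \<alpha> = (THE \<beta>. \<exists>\<beta>'. splits D \<alpha> \<beta> \<beta>')"

definition child2 :: "nat set set \<Rightarrow> nat set \<Rightarrow> nat set"
  where "child2 D \<alpha> = (THE \<beta>'. \<exists>\<beta>. splits D \<alpha> \<beta> \<beta>')"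

primrec tree_level :: "nat set set \<Rightarrow> nat \<Rightarrow> nat \<Rightarrow> nat set set"
  where
    "tree_level D m 0 = {{1..m}}"
  | "tree_level D m (Suc l) = {\<beta>. \<exists>\<alpha>\<in>tree_level D m l. \<exists>\<beta>'. splits D \<alpha> \<beta> \<beta>' \<or> splits D \<alpha> \<beta>' \<beta>}"

definition tree_depth :: "nat set set \<Rightarrow> nat \<Rightarrow> nat"
  where "tree_depth D m = Max {l. tree_level D m l \<noteq> {}}"

text \<open>
  The last conjunct makes \<open>D\<close> a tree: unique splitting alone would also admit sets of modes that
  cannot be reached from the root, for example \<open>{1, 3}\<close> besides \<open>{1, 2}\<close> and \<open>{3, 4}\<close>.
\<close>

definition dimension_tree :: "nat \<Rightarrow> nat set set \<Rightarrow> bool"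
  where "dimension_tree m D \<longleftrightarrow>
    D \<subseteq> Pow {1..m} \<and> {} \<notin> D \<and> {1..m} \<in> D \<and> (\<forall>i\<in>{1..m}. {i} \<in> D) \<and>
    (\<forall>\<alpha>\<in>D. is_singleton \<alpha> \<or> (\<exists>!(\<beta>, \<beta>'). splits D \<alpha> \<beta> \<beta>')) \<and>
    (\<forall>\<alpha>\<in>D. \<exists>l. \<alpha> \<in> tree_level D m l)"


section \<open>Tensor formats\<close>

datatype tensor_format = Tucker | Hierarchical "nat set set"

definition valid_format :: "nat \<Rightarrow> tensor_format \<Rightarrow> bool"
  where "valid_format m F = (case F of Tucker \<Rightarrow> True | Hierarchical D \<Rightarrow> dimension_tree m D)"

text \<open>
  Ranks, singular values and mode frames are indexed by sets of modes; in the Tucker format the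
  set \<open>{i}\<close> stands for the mode \<open>i\<close>.
\<close>

definition nodes :: "nat \<Rightarrow> tensor_format \<Rightarrow> nat set set"
  where "nodes m F = (case F of
      Tucker \<Rightarrow> {{i} | i. i \<in> {1..m}}
    | Hierarchical D \<Rightarrow> D - {{1..m}})"

definition max_rank :: "nat \<Rightarrow> tensor_format \<Rightarrow> (nat set \<Rightarrow> enat) \<Rightarrow> enat"
  where "max_rank m F r = Max (r ` nodes m F)"

text \<open>The tensor product of two closed subspaces is the closed span of the elementary tensors.\<close>

definition nested_frames :: "'n set \<Rightarrow> (nat \<Rightarrow> nat) \<Rightarrow> nat \<Rightarrow> nat set set \<Rightarrow>
    (nat set \<Rightarrow> enat) \<Rightarrow> (nat set \<Rightarrow> nat \<Rightarrow> 'n tensor) \<Rightarrow> bool"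
  where "nested_frames N d m D r V \<longleftrightarrow>
    (\<forall>\<alpha>\<in>D. \<alpha> \<noteq> {1..m} \<and> \<not> is_singleton \<alpha> \<longrightarrow>
      closure (span (V \<alpha> ` upto_enat (r \<alpha>))) \<subseteq>
      closure (span {tensor_prod N d {child1 D \<alpha>, child2 D \<alpha>} x | x.
        \<forall>\<beta>\<in>{child1 D \<alpha>, child2 D \<alpha>}. x \<beta> \<in> closure (span (V \<beta> ` upto_enat (r \<beta>)))}))"

definition admissible_ranks ::
  "'n set \<Rightarrow> (nat \<Rightarrow> nat) \<Rightarrow> nat \<Rightarrow> tensor_format \<Rightarrow> (nat set \<Rightarrow> enat) set"
  where "admissible_ranks N d m F = (case F of
      Tucker \<Rightarrow> nodes m F \<rightarrow>\<^sub>E UNIV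
    | Hierarchical D \<Rightarrow> {r \<in> nodes m F \<rightarrow>\<^sub>E UNIV. \<exists>V :: nat set \<Rightarrow> nat \<Rightarrow> 'n tensor.
        (\<forall>\<alpha>\<in>nodes m F. orthonormal_family (r \<alpha>) (V \<alpha>) \<and>
           V \<alpha> ` upto_enat (r \<alpha>) \<subseteq> modes_space N d \<alpha>) \<and>
        nested_frames N d m D r V})"

definition format_set ::
  "'n set \<Rightarrow> (nat \<Rightarrow> nat) \<Rightarrow> nat \<Rightarrow> tensor_format \<Rightarrow> (nat set \<Rightarrow> enat) \<Rightarrow> 'n tensor set"
  where "format_set N d m F r =
    {v \<in> modes_space N d {1..m}. \<forall>\<alpha>\<in>nodes m F. rank_at N d m v \<alpha> \<le> r \<alpha>}"

text \<open>
  \<open>\<sigma> \<alpha> k\<close> and \<open>U \<alpha> k\<close> are singular values and left singular vectors for every node \<open>\<alpha>\<close>.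
  Up to transposition the two children of the root have the same matricization; the last
  conjunct says that their singular vectors come from one and the same decomposition. Without
  it, multiple singular values would allow unrelated choices for the two children, and the
  truncation error would not be bounded by \<open>trunc_bound\<close>, which counts only one of them.
\<close>

definition singular_system :: "'n set \<Rightarrow> (nat \<Rightarrow> nat) \<Rightarrow> nat \<Rightarrow> tensor_format \<Rightarrow> 'n tensor \<Rightarrow>
    (nat set \<Rightarrow> nat \<Rightarrow> real) \<Rightarrow> (nat set \<Rightarrow> nat \<Rightarrow> 'n tensor) \<Rightarrow> bool"
  where "singular_system N d m F u \<sigma> U \<longleftrightarrow>
    (\<forall>\<alpha>\<in>nodes m F. \<exists>V. mode_svd N d m u \<alpha> (\<sigma> \<alpha>) (U \<alpha>) V) \<and>
    (case F of Tucker \<Rightarrow> True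
     | Hierarchical D \<Rightarrow>
         mode_svd N d m u (child1 D {1..m})
           (\<sigma> (child1 D {1..m})) (U (child1 D {1..m})) (U (child2 D {1..m})))"

definition trunc_bound ::
  "nat \<Rightarrow> tensor_format \<Rightarrow> (nat set \<Rightarrow> nat \<Rightarrow> real) \<Rightarrow> (nat set \<Rightarrow> enat) \<Rightarrow> real"
  where "trunc_bound m F \<sigma> r = sqrt (\<Sum>\<alpha>\<in>(case F of
        Tucker \<Rightarrow> nodes m F
      | Hierarchical D \<Rightarrow>
          if r (child1 D {1..m}) \<le> r (child2 D {1..m})
          then D - {{1..m}, child2 D {1..m}} else D - {{1..m}, child1 D {1..m}}).
      \<Sum>\<^sub>\<infinity>k\<in>{k. r \<alpha> < enat k}. \<bar>\<sigma> \<alpha> k\<bar>\<^sup>2)"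

definition frame_proj :: "enat \<Rightarrow> (nat \<Rightarrow> 'a::real_inner) \<Rightarrow> 'a \<Rightarrow> 'a"
  where "frame_proj r U x = (\<Sum>\<^sub>\<infinity>k\<in>upto_enat r. inner (U k) x *\<^sub>R U k)"

text \<open>
  \<open>apply_modes N d m \<alpha> A v\<close> applies the operator \<open>A\<close> to the modes in \<open>\<alpha>\<close> and the identity to the
  others: at \<open>\<nu>\<close>, the other modes are frozen, and \<open>A\<close> acts on the resulting tensor over \<open>\<alpha>\<close>.
\<close>

definition apply_modes :: "'n set \<Rightarrow> (nat \<Rightarrow> nat) \<Rightarrow> nat \<Rightarrow> nat set \<Rightarrow>
    ('n tensor \<Rightarrow> 'n tensor) \<Rightarrow> 'n tensor \<Rightarrow> 'n tensor"
  where "apply_modes N d m \<alpha> A v = ell2_of (multi_idx N d {1..m})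
    (\<lambda>\<nu>. entry (A (ell2_of (multi_idx N d \<alpha>) (\<lambda>\<mu>. entry v (merge \<alpha> ({1..m} - \<alpha>) (\<mu>, \<nu>)))))
           (restrict \<nu> \<alpha>))"

text \<open>The nodes of one level are disjoint, so the operators folded here commute.\<close>

definition level_proj :: "'n set \<Rightarrow> (nat \<Rightarrow> nat) \<Rightarrow> nat \<Rightarrow> nat set set \<Rightarrow>
    (nat set \<Rightarrow> nat \<Rightarrow> 'n tensor) \<Rightarrow> (nat set \<Rightarrow> enat) \<Rightarrow> nat \<Rightarrow> 'n tensor \<Rightarrow> 'n tensor"
  where "level_proj N d m D U r l v =
    Finite_Set.fold (\<lambda>\<alpha>. apply_modes N d m \<alpha> (frame_proj (r \<alpha>) (U \<alpha>))) v (tree_level D m l)"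

definition format_proj :: "'n set \<Rightarrow> (nat \<Rightarrow> nat) \<Rightarrow> nat \<Rightarrow> tensor_format \<Rightarrow>
    (nat set \<Rightarrow> nat \<Rightarrow> 'n tensor) \<Rightarrow> (nat set \<Rightarrow> enat) \<Rightarrow> 'n tensor \<Rightarrow> 'n tensor"
  where "format_proj N d m F U r v = (case F of
      Tucker \<Rightarrow> (\<Sum>\<^sub>\<infinity>k\<in>(\<Pi>\<^sub>E \<alpha>\<in>nodes m F. upto_enat (r \<alpha>)).
        inner v (tensor_prod N d (nodes m F) (\<lambda>\<alpha>. U \<alpha> (k \<alpha>))) *\<^sub>R
        tensor_prod N d (nodes m F) (\<lambda>\<alpha>. U \<alpha> (k \<alpha>)))
    | Hierarchical D \<Rightarrow> fold (level_proj N d m D U r) [1..<Suc (tree_depth D m)] v)"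

definition kappa_P :: "nat \<Rightarrow> tensor_format \<Rightarrow> real"
  where "kappa_P m F = (case F of
      Tucker \<Rightarrow> sqrt (real m)
    | Hierarchical D \<Rightarrow> sqrt (2 * real m - 3))"


section \<open>Recompression\<close>

definition optimal_ranks :: "'n set \<Rightarrow> (nat \<Rightarrow> nat) \<Rightarrow> nat \<Rightarrow> tensor_format \<Rightarrow>
    (nat set \<Rightarrow> nat \<Rightarrow> real) \<Rightarrow> real \<Rightarrow> (nat set \<Rightarrow> enat) set"
  where "optimal_ranks N d m F \<sigma> \<eta> =
    {r. is_arg_min (max_rank m F) (\<lambda>r. r \<in> admissible_ranks N d m F \<and> trunc_bound m F \<sigma> r \<le> \<eta>) r}"

text \<open>
  The recompression of \<open>v\<close> depends on the choice of singular vectors and of a minimizer; this is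
  the set of all its possible values.
\<close>

definition recompressions ::
  "'n set \<Rightarrow> (nat \<Rightarrow> nat) \<Rightarrow> nat \<Rightarrow> tensor_format \<Rightarrow> real \<Rightarrow> 'n tensor \<Rightarrow> 'n tensor set"
  where "recompressions N d m F \<eta> v =
    {format_proj N d m F U r v | \<sigma> U r.
       singular_system N d m F v \<sigma> U \<and> r \<in> optimal_ranks N d m F \<sigma> \<eta>}"


section \<open>Rank approximation classes\<close>

definition growth_sequence :: "(nat \<Rightarrow> real) \<Rightarrow> bool"
  where "growth_sequence \<gamma> \<longleftrightarrow>
    (\<forall>n. 0 < \<gamma> n) \<and> strict_mono \<gamma> \<and> \<gamma> 0 = 1 \<and> filterlim \<gamma> at_top sequentially"

definition growth_inv :: "(nat \<Rightarrow> real) \<Rightarrow> real \<Rightarrow> nat"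
  where "growth_inv \<gamma> x = (if 1 \<le> x then Max {n. \<gamma> n \<le> x} else 0)"

definition growth_ratios :: "(nat \<Rightarrow> real) \<Rightarrow> real set"
  where "growth_ratios \<gamma> = {\<gamma> n / \<gamma> (n - 1) | n. 1 \<le> n}"

definition best_error ::
  "'n set \<Rightarrow> (nat \<Rightarrow> nat) \<Rightarrow> nat \<Rightarrow> tensor_format \<Rightarrow> 'n tensor \<Rightarrow> nat \<Rightarrow> real"
  where "best_error N d m F v n = Inf {norm (v - w) | w r.
    w \<in> format_set N d m F r \<and> r \<in> admissible_ranks N d m F \<and> max_rank m F r \<le> enat n}"

definition approx_class ::
  "'n set \<Rightarrow> (nat \<Rightarrow> nat) \<Rightarrow> nat \<Rightarrow> tensor_format \<Rightarrow> (nat \<Rightarrow> real) \<Rightarrow> 'n tensor set"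
  where "approx_class N d m F \<gamma> = {v \<in> modes_space N d {1..m}.
    bdd_above (range (\<lambda>n. \<gamma> n * best_error N d m F v n))}"

text \<open>Meaningful on \<^const>\<open>approx_class\<close> only, where the supremum is finite.\<close>

definition approx_norm ::
  "'n set \<Rightarrow> (nat \<Rightarrow> nat) \<Rightarrow> nat \<Rightarrow> tensor_format \<Rightarrow> (nat \<Rightarrow> real) \<Rightarrow> 'n tensor \<Rightarrow> real"
  where "approx_norm N d m F \<gamma> v = norm v + (SUP n. \<gamma> n * best_error N d m F v n)"

end

theory Submission
  imports Defs
begin

text \<open>
  For every node \<open>\<alpha>\<close>, projecting the modes in \<open>\<alpha>\<close> of \<open>v\<close> onto the first \<open>r \<alpha>\<close> left singular vectors
  costs the squared tail of the singular values, and since \<open>\<parallel>x - P y\<parallel>\<^sup>2 \<le> \<parallel>x - P x\<parallel>\<^sup>2 + \<parallel>x - y\<parallel>\<^sup>2\<close> for an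
  orthogonal projection \<open>P\<close>, these costs add up under composition. Conversely, by Eckart-Young each
  tail is at most \<open>\<parallel>v - x\<parallel>\<^sup>2\<close> for every \<open>x\<close> of rank at most \<open>r\<close>, and at most \<open>m\<close> or \<open>2 m - 3\<close> tails
  occur. Hence a rank \<open>n\<close> with best approximation error of \<open>u\<close> below \<open>\<alpha> \<eta>\<close> is a competitor in the
  choice of the ranks \<open>r\<close> of the recompression, so that \<open>max r \<le> n\<close>. This bounds the rank. For \<open>n\<close>
  below \<open>max r\<close> it yields \<open>\<eta> \<le> best_error u n / \<alpha>\<close>, which absorbs the error \<open>\<parallel>u - w\<parallel>\<close> into the
  approximation norm of \<open>u\<close>; for larger \<open>n\<close> the best approximation error of \<open>w\<close> vanishes.
\<close>

section \<open>Hilbert space preliminaries\<close>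

text \<open>Projections at a node and at one of its descendants need not commute, so their
  composition is in general not an orthogonal projection. The order from the root to the leaves
  saves both estimates. Errors add up because each factor is charged with its error on
  \<open>v\<close> itself, not on the intermediate tensor. Rank bounds survive because every later
  factor acts inside an earlier node or on disjoint modes, and neither raises the rank there. At the
  root, the frames of the two children belong to one decomposition, so after projecting at the child
  of smaller rank the other projection changes nothing; this removes one tail. The frames may be
  infinite. Identities between projections are therefore checked slice by slice and along single
  frame vectors instead of by rearranging series. In this way the multiple series of the Tucker
  projection becomes a composition of mode projections, and both formats share the remaining
  argument. An approximant is extracted from an infimum, which needs a strict inequality. The ratio
  bound of the growth sequence supplies it: it compensates for the step from \<open>Suc n\<close>
  back to \<open>n\<close> in the definition of \<open>growth_inv\<close>.\<close>

lemma entry_ell2_of: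
  assumes "(\<lambda>x. (f x)\<^sup>2) summable_on I"
  shows "entry (ell2_of I f) x = (if x \<in> I then f x else 0)"
proof -
  have "(\<lambda>x. (if x \<in> I then f x else 0)\<^sup>2) summable_on UNIV \<longleftrightarrow> (\<lambda>x. (f x)\<^sup>2) summable_on I"
    by (rule summable_on_cong_neutral) auto
  with assms show ?thesis
    by (simp add: ell2_of_def entry_Abs_ell2)
qed

lemma ell2_of_in [simp]:
  "(\<lambda>x. (f x)\<^sup>2) summable_on I \<Longrightarrow> ell2_of I f \<in> ell2_on I"
  by (simp add: ell2_on_def entry_ell2_of)

lemma entry_summable_on: "(\<lambda>x. (entry u x)\<^sup>2) summable_on I"
  by (rule summable_on_subset_banach[OF entry_summable]) simp

lemma entry_outside: "x \<in> ell2_on I \<Longrightarrow> p \<notin> I \<Longrightarrow> entry x p = 0"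
  by (simp add: ell2_on_def)

lemma subspace_ell2_on: "subspace (ell2_on I)"
  by (simp add: subspace_def ell2_on_def entry_zero entry_add entry_scaleR)

lemma has_sum_inner: "((\<lambda>p. entry x p * entry y p) has_sum inner x y) UNIV"
  unfolding inner_ell2_def
  by (intro has_sum_infsum square_summable_mult entry_summable)

lemma has_sum_inner_on:
  assumes "x \<in> ell2_on I \<or> y \<in> ell2_on I"
  shows "((\<lambda>p. entry x p * entry y p) has_sum inner x y) I"
proof -
  have "((\<lambda>p. entry x p * entry y p) has_sum inner x y) I \<longleftrightarrow>
      ((\<lambda>p. entry x p * entry y p) has_sum inner x y) UNIV"
    using assms by (intro has_sum_cong_neutral) (auto simp: entry_outside)
  then show ?thesis by (simp add: has_sum_inner)
qed

lemma has_sum_norm_on: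
  "x \<in> ell2_on I \<Longrightarrow> ((\<lambda>p. (entry x p)\<^sup>2) has_sum (norm x)\<^sup>2) I"
  using has_sum_inner_on[of x I x] by (simp add: power2_eq_square flip: power2_norm_eq_inner)

lemma finite_sum_entry_le:
  assumes "finite F"
  shows "(\<Sum>p\<in>F. (entry x p)\<^sup>2) \<le> (norm x)\<^sup>2"
proof -
  have x: "x \<in> ell2_on UNIV" by (simp add: ell2_on_def)
  show ?thesis
    by (rule finite_sum_le_has_sum[OF has_sum_norm_on[OF x] assms]) auto
qed

lemma abs_entry_le: "\<bar>entry x p\<bar> \<le> norm x"
proof -
  have "(entry x p)\<^sup>2 \<le> (norm x)\<^sup>2" using finite_sum_entry_le[of "{p}" x] by simp
  then show ?thesis using abs_le_square_iff[of "entry x p" "norm x"] by simp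
qed

lemma norm_ell2_le:
  assumes "\<And>F. finite F \<Longrightarrow> (\<Sum>p\<in>F. (entry x p)\<^sup>2) \<le> b\<^sup>2" "0 \<le> b"
  shows "norm x \<le> b"
proof -
  have x: "x \<in> ell2_on UNIV" by (simp add: ell2_on_def)
  have "(norm x)\<^sup>2 \<le> b\<^sup>2"
    by (rule has_sum_le_finite_sums[OF has_sum_norm_on[OF x] assms(1)])
  then show ?thesis using assms(2) by (rule power2_le_imp_le)
qed

lemma summable_on_squaresI:
  fixes f :: "'a \<Rightarrow> real"
  assumes "\<And>F. finite F \<Longrightarrow> F \<subseteq> I \<Longrightarrow> (\<Sum>p\<in>F. (f p)\<^sup>2) \<le> b"
  shows "(\<lambda>p. (f p)\<^sup>2) summable_on I"
  by (rule nonneg_bdd_above_summable_on) (auto intro!: bdd_aboveI[of _ b] assms)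

text \<open>Completeness is what makes the infinite sums in \<open>span_proj\<close> converge. The
  candidate limit is the entrywise one.\<close>

instance ell2 :: (type) complete_space
proof
  fix X :: "nat \<Rightarrow> 'a ell2" assume C: "Cauchy X"
  have "Cauchy (\<lambda>n. entry (X n) p)" for p
  proof (rule metric_CauchyI)
    fix e :: real assume "0 < e"
    then obtain M where M: "\<And>m n. m \<ge> M \<Longrightarrow> n \<ge> M \<Longrightarrow> norm (X m - X n) < e"
      using C unfolding Cauchy_def dist_norm by meson
    have "dist (entry (X m) p) (entry (X n) p) < e" if "m \<ge> M" "n \<ge> M" for m n
      using M[OF that] abs_entry_le[of "X m - X n" p] by (simp add: entry_minus dist_real_def)
    then show "\<exists>M. \<forall>m\<ge>M. \<forall>n\<ge>M. dist (entry (X m) p) (entry (X n) p) < e" by blast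
  qed
  then have "\<forall>p. \<exists>l. (\<lambda>n. entry (X n) p) \<longlonglongrightarrow> l"
    by (simp add: Cauchy_convergent_iff convergent_def)
  then obtain f where f: "\<And>p. (\<lambda>n. entry (X n) p) \<longlonglongrightarrow> f p" by metis
  \<comment> \<open>The limit is taken inside a finite sum of squares. The bound does not depend on
    \<open>F\<close>, so it yields both square summability of \<open>f\<close> and convergence in
    norm.\<close>
  have close: "\<exists>M. \<forall>n\<ge>M. \<forall>F. finite F \<longrightarrow> (\<Sum>p\<in>F. (entry (X n) p - f p)\<^sup>2) \<le> e\<^sup>2"
    if "0 < e" for e
  proof -
    obtain M where M: "\<And>m n. m \<ge> M \<Longrightarrow> n \<ge> M \<Longrightarrow> norm (X n - X m) < e"
      using C \<open>0 < e\<close> unfolding Cauchy_def dist_norm by meson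
    have "(\<Sum>p\<in>F. (entry (X n) p - f p)\<^sup>2) \<le> e\<^sup>2" if "finite F" "n \<ge> M" for F n
    proof (rule LIMSEQ_le_const2)
      show "(\<lambda>m. \<Sum>p\<in>F. (entry (X n) p - entry (X m) p)\<^sup>2) \<longlonglongrightarrow> (\<Sum>p\<in>F. (entry (X n) p - f p)\<^sup>2)"
        by (intro tendsto_intros f)
      have "(\<Sum>p\<in>F. (entry (X n) p - entry (X m) p)\<^sup>2) \<le> e\<^sup>2" if "m \<ge> M" for m
      proof -
        have "(norm (X n - X m))\<^sup>2 \<le> e\<^sup>2"
          using M[OF that \<open>n \<ge> M\<close>] by (intro power_mono) auto
        with finite_sum_entry_le[OF \<open>finite F\<close>, of "X n - X m"] show ?thesis
          by (simp add: entry_minus)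
      qed
      then show "\<exists>M. \<forall>m\<ge>M. (\<Sum>p\<in>F. (entry (X n) p - entry (X m) p)\<^sup>2) \<le> e\<^sup>2" by blast
    qed
    then show ?thesis by blast
  qed
  obtain M where M: "\<And>F. finite F \<Longrightarrow> (\<Sum>p\<in>F. (entry (X M) p - f p)\<^sup>2) \<le> 1\<^sup>2"
    using close[of 1] by auto
  have "(\<lambda>p. (entry (X M) p - f p)\<^sup>2) summable_on UNIV"
    by (rule summable_on_squaresI) (rule M)
  from square_summable_add[OF entry_summable[of "X M"] square_summable_scale[OF this, of "-1"]]
  have f2: "(\<lambda>p. (f p)\<^sup>2) summable_on UNIV" by simp
  define L where "L = Abs_ell2 f"
  have L: "entry L = f" by (simp add: L_def entry_Abs_ell2 f2)
  have "X \<longlonglongrightarrow> L"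
  proof (rule metric_LIMSEQ_I)
    fix r :: real assume "0 < r"
    then obtain M where M: "\<And>n F. n \<ge> M \<Longrightarrow> finite F \<Longrightarrow> (\<Sum>p\<in>F. (entry (X n) p - f p)\<^sup>2) \<le> (r/2)\<^sup>2"
      using close[of "r/2"] by auto
    have "norm (X n - L) \<le> r/2" if "n \<ge> M" for n
      using M[OF that] \<open>0 < r\<close> by (intro norm_ell2_le) (auto simp: entry_minus L)
    then show "\<exists>no. \<forall>n\<ge>no. dist (X n) L < r"
      using \<open>0 < r\<close> by (intro exI[of _ M]) (fastforce simp: dist_norm)
  qed
  then show "convergent X" by (rule convergentI)
qed

instance ell2 :: (type) banach ..

text \<open>With these vectors an entry becomes an inner product, so a self-adjoint operator can be
  moved off its argument entry by entry.\<close>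

definition unit_ell2 :: "'i \<Rightarrow> 'i ell2" where "unit_ell2 p = ell2_of {p} (\<lambda>_. 1)"

lemma entry_unit: "entry (unit_ell2 p) q = (if q = p then 1 else 0)"
  by (simp add: unit_ell2_def entry_ell2_of)

lemma unit_in: "p \<in> I \<Longrightarrow> unit_ell2 p \<in> ell2_on I"
  by (auto simp: ell2_on_def entry_unit)

lemma inner_unit [simp]: "inner (unit_ell2 p) x = entry x p"
proof -
  have "unit_ell2 p \<in> ell2_on {p}" by (simp add: unit_in)
  then have "((\<lambda>q. entry (unit_ell2 p) q * entry x q) has_sum inner (unit_ell2 p) x) {p}"
    by (intro has_sum_inner_on) simp
  then show ?thesis by (simp add: has_sum_finite_iff entry_unit)
qed

lemma has_sum_entry: "((f :: 'k \<Rightarrow> 'i ell2) has_sum s) A \<Longrightarrow> ((\<lambda>a. entry (f a) p) has_sum entry s p) A"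
  using has_sum_bounded_linear[OF bounded_linear_inner_right[of "unit_ell2 p"], of f A s] by simp

section \<open>Bessel's inequality and projections onto closed spans\<close>

text \<open>Zero members are allowed because singular vectors vanish beyond the rank.\<close>

definition quasi_orthonormal :: "'k set \<Rightarrow> ('k \<Rightarrow> 'a::real_inner) \<Rightarrow> bool"
  where "quasi_orthonormal K e \<longleftrightarrow>
    (\<forall>j\<in>K. \<forall>k\<in>K. inner (e j) (e k) = (if j = k \<and> e j \<noteq> 0 then 1 else 0))"

text \<open>This is \<open>frame_proj\<close> over an arbitrary index set. The Tucker projection
  needs families of indices, and rank arguments index a finite basis by itself.\<close>

definition span_proj :: "'k set \<Rightarrow> ('k \<Rightarrow> 'a::real_inner) \<Rightarrow> 'a \<Rightarrow> 'a"
  where "span_proj K e x = (\<Sum>\<^sub>\<infinity>k\<in>K. inner (e k) x *\<^sub>R e k)"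

text \<open>Orthogonal projections of the whole type. All tensor spaces share one type, so
  \<open>S\<close> records the index set on which the values live.\<close>

definition projector_on :: "'a::real_inner set \<Rightarrow> ('a \<Rightarrow> 'a) \<Rightarrow> bool"
  where "projector_on S A \<longleftrightarrow> linear A \<and> (\<forall>x y. inner (A x) y = inner x (A y)) \<and>
    (\<forall>x. A (A x) = A x) \<and> range A \<subseteq> S"

lemma quasi_orthonormal_cases: "quasi_orthonormal K e \<Longrightarrow> k \<in> K \<Longrightarrow> e k = 0 \<or> inner (e k) (e k) = 1"
  by (auto simp: quasi_orthonormal_def)

lemma quasi_orthonormal_subset: "quasi_orthonormal K e \<Longrightarrow> J \<subseteq> K \<Longrightarrow> quasi_orthonormal J e"
  unfolding quasi_orthonormal_def by (meson subsetD)

lemma quasi_orthonormal_norm_le: "quasi_orthonormal K e \<Longrightarrow> k \<in> K \<Longrightarrow> norm (e k) \<le> 1"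
  by (auto simp: quasi_orthonormal_def norm_eq_sqrt_inner split: if_splits)

lemma quasi_orthonormal_inner_self:
  "quasi_orthonormal K e \<Longrightarrow> k \<in> K \<Longrightarrow> inner (e k) x * inner (e k) (e k) = inner (e k) x"
  by (cases "e k = 0") (auto simp: quasi_orthonormal_def)

lemma inner_sum_quasi_orthonormal:
  assumes "quasi_orthonormal K e" "finite F" "F \<subseteq> K" "j \<in> K"
  shows "inner (e j) (\<Sum>k\<in>F. c k *\<^sub>R e k) = (if j \<in> F then c j * inner (e j) (e j) else 0)"
proof -
  have "inner (e j) (\<Sum>k\<in>F. c k *\<^sub>R e k) = (\<Sum>k\<in>F. if k = j then c j * inner (e j) (e j) else 0)"
    unfolding inner_sum_right
    using assms by (intro sum.cong) (auto simp: quasi_orthonormal_def)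
  then show ?thesis using assms(2) by simp
qed

lemma norm_sum_quasi_orthonormal:
  assumes "quasi_orthonormal K e" "finite F" "F \<subseteq> K"
  shows "(norm (\<Sum>k\<in>F. inner (e k) x *\<^sub>R e k))\<^sup>2 = (\<Sum>k\<in>F. (inner (e k) x)\<^sup>2)"
proof -
  have *: "inner (e j) (\<Sum>k\<in>F. inner (e k) x *\<^sub>R e k) = inner (e j) x" if "j \<in> F" for j
  proof -
    have "j \<in> K" using that assms(3) by blast
    with inner_sum_quasi_orthonormal[OF assms this, of "\<lambda>k. inner (e k) x"] that
      quasi_orthonormal_inner_self[OF assms(1) this, of x]
    show ?thesis by simp
  qed
  show ?thesis
    unfolding power2_norm_eq_inner
    by (subst inner_sum_left) (simp add: * power2_eq_square)
qed

lemma bessel: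
  assumes "quasi_orthonormal K e" "finite F" "F \<subseteq> K"
  shows "(\<Sum>k\<in>F. (inner (e k) x)\<^sup>2) \<le> (norm x)\<^sup>2"
proof -
  let ?y = "\<Sum>k\<in>F. inner (e k) x *\<^sub>R e k"
  have "inner x ?y = (\<Sum>k\<in>F. (inner (e k) x)\<^sup>2)"
    by (simp add: inner_sum_right power2_eq_square inner_commute)
  moreover have "inner ?y ?y = (\<Sum>k\<in>F. (inner (e k) x)\<^sup>2)"
    using norm_sum_quasi_orthonormal[OF assms] by (simp add: power2_norm_eq_inner)
  moreover have "0 \<le> inner (x - ?y) (x - ?y)" by simp
  ultimately show ?thesis
    by (simp add: inner_diff_left inner_diff_right inner_commute power2_norm_eq_inner)
qed

lemma span_proj_summable:
  fixes e :: "'k \<Rightarrow> 'a::{real_inner, complete_space}"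
  assumes e: "quasi_orthonormal K e"
  shows "(\<lambda>k. inner (e k) x *\<^sub>R e k) summable_on K"
proof -
  let ?f = "\<lambda>k. inner (e k) x *\<^sub>R e k" and ?g = "\<lambda>k. (inner (e k) x)\<^sup>2"
  have g: "?g summable_on K"
    by (rule summable_on_squaresI) (rule bessel[OF e])
  have "\<exists>P. eventually P (finite_subsets_at_top K) \<and>
      (\<forall>F F'. P F \<and> P F' \<longrightarrow> dist (sum ?f F) (sum ?f F') < r)" if "0 < r" for r
  proof -
    have "0 < (r/2)\<^sup>2" using that by simp
    \<comment> \<open>Half of \<open>(r/2)\<^sup>2\<close> is taken so that the non-strict
      approximation still gives a strict bound below \<open>r/2\<close>.\<close>
    then obtain F0 where F0: "finite F0" "F0 \<subseteq> K" "dist (sum ?g F0) (infsum ?g K) \<le> (r/2)\<^sup>2 / 2"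
      using infsum_finite_approximation[OF g, of "(r/2)\<^sup>2 / 2"] by (metis half_gt_zero)
    define P where "P F \<longleftrightarrow> finite F \<and> F0 \<subseteq> F \<and> F \<subseteq> K" for F
    have "eventually P (finite_subsets_at_top K)"
      unfolding eventually_finite_subsets_at_top P_def using F0 by blast
    moreover have half: "norm (sum ?f F - sum ?f F0) < r/2" if "P F" for F
    proof -
      have F: "finite F" "F0 \<subseteq> F" "F \<subseteq> K" using that by (auto simp: P_def)
      have "(norm (sum ?f F - sum ?f F0))\<^sup>2 = (norm (sum ?f (F - F0)))\<^sup>2"
        using F by (simp add: sum_diff)
      also have "\<dots> = sum ?g (F - F0)"
        using F by (intro norm_sum_quasi_orthonormal[OF e]) auto
      also have "\<dots> = sum ?g F - sum ?g F0"
        using F by (simp add: sum_diff)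
      also have "\<dots> \<le> infsum ?g K - sum ?g F0"
        using F by (intro diff_right_mono finite_sum_le_infsum[OF g]) auto
      also have "\<dots> \<le> (r/2)\<^sup>2 / 2"
        using F0(3) unfolding dist_real_def by linarith
      also have "\<dots> < (r/2)\<^sup>2" using \<open>0 < (r/2)\<^sup>2\<close> by simp
      finally show ?thesis by (rule power2_less_imp_less) (use \<open>0 < r\<close> in simp)
    qed
    moreover have "dist (sum ?f F) (sum ?f F') < r" if "P F" "P F'" for F F'
    proof -
      have "norm ((sum ?f F - sum ?f F0) - (sum ?f F' - sum ?f F0)) < r/2 + r/2"
        by (rule le_less_trans[OF norm_triangle_ineq4 add_strict_mono[OF half[OF that(1)] half[OF that(2)]]])
      then show ?thesis unfolding dist_norm by (simp only: diff_diff_eq2 diff_add_cancel field_sum_of_halves)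
    qed
    ultimately show ?thesis by blast
  qed
  then have "cauchy_filter (filtermap (sum ?f) (finite_subsets_at_top K))"
    by (simp add: cauchy_filter_metric_filtermap)
  moreover have "complete (UNIV::'a set)"
    by (meson Cauchy_convergent UNIV_I complete_def convergent_def)
  ultimately obtain L' where "(sum ?f \<longlongrightarrow> L') (finite_subsets_at_top K)"
    using complete_uniform[where S=UNIV] by (force simp add: filterlim_def)
  then show ?thesis
    using summable_on_def has_sum_def by blast
qed

lemma has_sum_span_proj:
  fixes e :: "'k \<Rightarrow> 'a::{real_inner, complete_space}"
  assumes "quasi_orthonormal K e"
  shows "((\<lambda>k. inner (e k) x *\<^sub>R e k) has_sum span_proj K e x) K"
  unfolding span_proj_def by (intro has_sum_infsum span_proj_summable assms)

lemma has_sum_inner_right: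
  "(f has_sum s) A \<Longrightarrow> ((\<lambda>a. inner y (f a)) has_sum inner y s) A"
  by (rule has_sum_bounded_linear[OF bounded_linear_inner_right])

lemma inner_span_proj:
  fixes e :: "'k \<Rightarrow> 'a::{real_inner, complete_space}"
  assumes e: "quasi_orthonormal K e" and j: "j \<in> K"
  shows "inner (e j) (span_proj K e x) = inner (e j) x"
proof -
  have "((\<lambda>k. inner (e j) (inner (e k) x *\<^sub>R e k)) has_sum inner (e j) (span_proj K e x)) K"
    by (rule has_sum_inner_right[OF has_sum_span_proj[OF e]])
  moreover have "((\<lambda>k. inner (e j) (inner (e k) x *\<^sub>R e k)) has_sum inner (e j) x) K"
    by (rule has_sum_finite_neutralI[of "{j}"])
      (use e j in \<open>auto simp: quasi_orthonormal_def\<close>)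
  ultimately show ?thesis by (rule has_sum_unique)
qed

lemma has_sum_inner_span_proj:
  fixes e :: "'k \<Rightarrow> 'a::{real_inner, complete_space}"
  assumes "quasi_orthonormal K e"
  shows "((\<lambda>k. inner (e k) x * inner (e k) y) has_sum inner (span_proj K e x) y) K"
  using has_sum_inner_right[OF has_sum_span_proj[OF assms], of y x]
  by (simp add: inner_commute)

lemma span_proj_fixes:
  assumes "quasi_orthonormal K e" "j \<in> K"
  shows "span_proj K e (e j) = e j"
proof -
  have "((\<lambda>k. inner (e k) (e j) *\<^sub>R e k) has_sum e j) K"
    by (rule has_sum_finite_neutralI[of "{j}"])
      (use assms in \<open>auto simp: quasi_orthonormal_def\<close>)
  then show ?thesis unfolding span_proj_def by (rule infsumI)
qed

lemma span_proj_orthogonal: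
  assumes "\<And>k. k \<in> K \<Longrightarrow> inner (e k) x = 0"
  shows "span_proj K e x = 0"
  unfolding span_proj_def by (rule infsum_0) (simp add: assms)

lemma projector_span_proj:
  fixes e :: "'k \<Rightarrow> 'a::{real_inner, complete_space}"
  assumes e: "quasi_orthonormal K e"
  shows "projector_on UNIV (span_proj K e)"
  unfolding projector_on_def
proof (intro conjI allI)
  show "linear (span_proj K e)"
  proof (rule linearI)
    fix x y :: 'a and r :: real
    have "((\<lambda>k. inner (e k) (x + y) *\<^sub>R e k) has_sum (span_proj K e x + span_proj K e y)) K"
      using has_sum_add[OF has_sum_span_proj[OF e, of x] has_sum_span_proj[OF e, of y]]
      by (simp add: inner_add_right scaleR_left_distrib)
    then show "span_proj K e (x + y) = span_proj K e x + span_proj K e y"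
      unfolding span_proj_def by (rule infsumI)
    have "((\<lambda>k. inner (e k) (r *\<^sub>R x) *\<^sub>R e k) has_sum (r *\<^sub>R span_proj K e x)) K"
      using has_sum_scaleR[OF has_sum_span_proj[OF e, of x], of r] by simp
    then show "span_proj K e (r *\<^sub>R x) = r *\<^sub>R span_proj K e x"
      unfolding span_proj_def by (rule infsumI)
  qed
  show "inner (span_proj K e x) y = inner x (span_proj K e y)" for x y
  proof -
    have "((\<lambda>k. inner (e k) x * inner (e k) y) has_sum inner x (span_proj K e y)) K"
      using has_sum_inner_span_proj[OF e, of y x] by (simp add: mult.commute inner_commute)
    with has_sum_inner_span_proj[OF e, of x y] show ?thesis by (rule has_sum_unique)
  qed
  show "span_proj K e (span_proj K e x) = span_proj K e x" for x
  proof -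
    have "((\<lambda>k. inner (e k) (span_proj K e x) *\<^sub>R e k) has_sum span_proj K e x) K"
      using has_sum_span_proj[OF e, of x] by (rule has_sum_cong[THEN iffD1, rotated])
        (simp add: inner_span_proj[OF e])
    then show ?thesis by (subst span_proj_def) (rule infsumI)
  qed
qed simp

section \<open>Orthogonal projectors: Pythagoras and the accumulation of errors\<close>

lemma projector_linear: "projector_on S A \<Longrightarrow> linear A"
  and projector_adjoint: "projector_on S A \<Longrightarrow> inner (A x) y = inner x (A y)"
  and projector_idem: "projector_on S A \<Longrightarrow> A (A x) = A x"
  and projector_in: "projector_on S A \<Longrightarrow> A x \<in> S"
  by (auto simp: projector_on_def)

lemma projector_diff: "projector_on S A \<Longrightarrow> A (x - y) = A x - A y"
  by (simp add: linear_diff projector_linear)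

text \<open>The residual \<open>x - A x\<close> is annihilated by \<open>A\<close>, hence orthogonal
  to its range. The free \<open>y\<close> serves both the norm identity (\<open>y = x\<close>) and
  the error estimate (a difference in place of \<open>y\<close>).\<close>

lemma projector_pythagoras:
  assumes "projector_on S A"
  shows "(norm (x - A x + A y))\<^sup>2 = (norm (x - A x))\<^sup>2 + (norm (A y))\<^sup>2"
proof -
  have "inner (x - A x) (A y) = 0"
    using projector_adjoint[OF assms, of "x - A x" y] projector_diff[OF assms, of x "A x"]
      projector_idem[OF assms, of x] by simp
  then show ?thesis
    by (simp add: power2_norm_eq_inner inner_add_left inner_add_right inner_commute)
qed

lemma projector_norm_sq: "projector_on S A \<Longrightarrow> (norm x)\<^sup>2 = (norm (x - A x))\<^sup>2 + (norm (A x))\<^sup>2"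
  using projector_pythagoras[of S A x x] by simp

lemma projector_norm_le:
  assumes "projector_on S A"
  shows "norm (A x) \<le> norm x"
proof (rule power2_le_imp_le)
  show "(norm (A x))\<^sup>2 \<le> (norm x)\<^sup>2"
    unfolding projector_norm_sq[OF assms, of x] by simp
qed simp

lemma projector_bounded: "projector_on S A \<Longrightarrow> bounded_linear A"
  by (intro bounded_linear_intro[of A 1])
    (auto simp: projector_linear linear_add linear_scale projector_norm_le)

lemma projector_error:
  assumes "projector_on S A"
  shows "(norm (x - A y))\<^sup>2 \<le> (norm (x - A x))\<^sup>2 + (norm (x - y))\<^sup>2"
proof -
  have "(norm (x - A y))\<^sup>2 = (norm (x - A x))\<^sup>2 + (norm (A (x - y)))\<^sup>2"
    using projector_pythagoras[OF assms, of x "x - y"] by (simp add: projector_diff[OF assms])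
  also have "(norm (A (x - y)))\<^sup>2 \<le> (norm (x - y))\<^sup>2"
    by (intro power_mono projector_norm_le[OF assms]) auto
  finally show ?thesis by simp
qed

text \<open>The induction peels off the projection applied last. By \<open>projector_error\<close>
  it contributes its error on the original \<open>x\<close>, so commutation never enters.\<close>

lemma fold_projector_error:
  assumes "\<And>b. b \<in> set bs \<Longrightarrow> projector_on S (P b)" "distinct bs"
  shows "(norm (x - fold P bs x))\<^sup>2 \<le> (\<Sum>b\<in>set bs. (norm (x - P b x))\<^sup>2)"
  using assms
proof (induction bs rule: rev_induct)
  case (snoc b bs)
  have "(norm (x - P b (fold P bs x)))\<^sup>2 \<le> (norm (x - P b x))\<^sup>2 + (norm (x - fold P bs x))\<^sup>2"
    using snoc.prems by (intro projector_error[of S]) simp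
  with snoc show ?case by simp
qed simp

lemma fold_projector_norm_le:
  assumes "\<And>b. b \<in> set bs \<Longrightarrow> projector_on S (P b)"
  shows "norm (fold P bs x) \<le> norm x"
  using assms
proof (induction bs arbitrary: x)
  case (Cons b bs)
  then have "norm (P b x) \<le> norm x" by (intro projector_norm_le[of S]) simp
  moreover have "norm (fold P bs (P b x)) \<le> norm (P b x)" by (rule Cons.IH) (use Cons.prems in simp)
  ultimately show ?case by simp
qed simp

lemma span_proj_in:
  fixes e :: "'k \<Rightarrow> 'i ell2"
  assumes "quasi_orthonormal K e" "\<And>k. k \<in> K \<Longrightarrow> e k \<in> ell2_on I"
  shows "span_proj K e x \<in> ell2_on I"
  unfolding ell2_on_def
proof (intro CollectI allI impI)
  fix p assume p: "p \<notin> I"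
  have "((\<lambda>k. entry (inner (e k) x *\<^sub>R e k) p) has_sum entry (span_proj K e x) p) K"
    by (rule has_sum_entry[OF has_sum_span_proj[OF assms(1)]])
  moreover have "((\<lambda>k. entry (inner (e k) x *\<^sub>R e k) p) has_sum 0) K"
    by (rule has_sum_0) (simp add: entry_scaleR entry_outside[OF assms(2) p])
  ultimately show "entry (span_proj K e x) p = 0" by (rule has_sum_unique)
qed

lemma projector_span_proj_on:
  fixes e :: "'k \<Rightarrow> 'i ell2"
  assumes "quasi_orthonormal K e" "\<And>k. k \<in> K \<Longrightarrow> e k \<in> ell2_on I"
  shows "projector_on (ell2_on I) (span_proj K e)"
  using projector_span_proj[OF assms(1)] span_proj_in[OF assms]
  unfolding projector_on_def by auto

lemma span_proj_singleton: "span_proj {k} e x = inner (e k) x *\<^sub>R e k"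
  by (simp add: span_proj_def)

section \<open>Slices of tensors and operators acting on some of the modes\<close>

locale tensor_modes =
  fixes N :: "'n set" and d :: "nat \<Rightarrow> nat"
begin

abbreviation "idx \<equiv> multi_idx N d"
abbreviation "modes \<equiv> modes_space N d"

text \<open>The modes outside \<open>\<beta>\<close> are frozen at \<open>\<nu>\<close>. Values of
  \<open>\<nu>\<close> inside \<open>\<beta>\<close> are overridden, so \<open>\<nu>\<close> may be
  an index over all modes or over the complement of \<open>\<beta>\<close> only.\<close>

definition slice :: "nat set \<Rightarrow> (nat \<Rightarrow> 'n list) \<Rightarrow> 'n tensor \<Rightarrow> 'n tensor"
  where "slice \<beta> \<nu> x = ell2_of (idx \<beta>) (\<lambda>\<mu>. entry x (override_on \<nu> \<mu> \<beta>))"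

text \<open>
  For \<open>M = {1..m}\<close> this is \<^const>\<open>apply_modes\<close>. The ambient set of modes is a parameter because
  an operator on modes inside \<open>\<alpha>\<close> also acts on the columns of the matricization over \<open>\<alpha>\<close>.
\<close>

definition lift :: "nat set \<Rightarrow> nat set \<Rightarrow> ('n tensor \<Rightarrow> 'n tensor) \<Rightarrow> 'n tensor \<Rightarrow> 'n tensor"
  where "lift M \<beta> A x = ell2_of (idx M) (\<lambda>\<nu>. entry (A (slice \<beta> \<nu> x)) (restrict \<nu> \<beta>))"

text \<open>The two-factor tensor product, to which \<open>tensor_prod\<close> is reduced one factor
  at a time.\<close>

definition tensor2 :: "nat set \<Rightarrow> nat set \<Rightarrow> 'n tensor \<Rightarrow> 'n tensor \<Rightarrow> 'n tensor"
  where "tensor2 \<alpha> \<beta> a b =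
    ell2_of (idx (\<alpha> \<union> \<beta>)) (\<lambda>\<zeta>. entry a (restrict \<zeta> \<alpha>) * entry b (restrict \<zeta> \<beta>))"

section \<open>Splitting and joining multi-indices\<close>

lemma restrict_idx: "\<nu> \<in> idx M \<Longrightarrow> \<beta> \<subseteq> M \<Longrightarrow> restrict \<nu> \<beta> \<in> idx \<beta>"
  by (auto simp: multi_idx_def PiE_iff)

lemma override_idx: "\<kappa> \<in> idx (M - \<beta>) \<Longrightarrow> \<mu> \<in> idx \<beta> \<Longrightarrow> \<beta> \<subseteq> M \<Longrightarrow> override_on \<kappa> \<mu> \<beta> \<in> idx M"
  unfolding multi_idx_def override_on_def by (auto simp: PiE_iff extensional_def)

lemma override_idx': "\<nu> \<in> idx M \<Longrightarrow> \<mu> \<in> idx \<beta> \<Longrightarrow> \<beta> \<subseteq> M \<Longrightarrow> override_on \<nu> \<mu> \<beta> \<in> idx M"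
  unfolding multi_idx_def override_on_def by (auto simp: PiE_iff extensional_def)

lemma restrict_override:
  assumes "\<mu> \<in> idx \<beta>"
  shows "restrict (override_on \<nu> \<mu> \<beta>) \<beta> = \<mu>"
proof
  fix i show "restrict (override_on \<nu> \<mu> \<beta>) \<beta> i = \<mu> i"
    using PiE_arb[OF assms[unfolded multi_idx_def], of i]
    by (cases "i \<in> \<beta>") (auto simp: override_on_def)
qed

lemma restrict_override_other:
  "\<alpha> \<inter> \<beta> = {} \<Longrightarrow> restrict (override_on \<nu> \<mu> \<beta>) \<alpha> = restrict \<nu> \<alpha>"
  by (rule restrict_ext) (auto simp: override_on_def)

lemma restrict_override_compl:
  assumes "\<kappa> \<in> idx (M - \<beta>)"
  shows "restrict (override_on \<kappa> \<mu> \<beta>) (M - \<beta>) = \<kappa>"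
proof
  fix i show "restrict (override_on \<kappa> \<mu> \<beta>) (M - \<beta>) i = \<kappa> i"
    using PiE_arb[OF assms[unfolded multi_idx_def], of i]
    by (cases "i \<in> M - \<beta>") (auto simp: override_on_def)
qed

lemma override_restrict:
  assumes "\<nu> \<in> idx M" "\<beta> \<subseteq> M"
  shows "override_on (restrict \<nu> (M - \<beta>)) (restrict \<nu> \<beta>) \<beta> = \<nu>"
proof
  fix i show "override_on (restrict \<nu> (M - \<beta>)) (restrict \<nu> \<beta>) \<beta> i = \<nu> i"
    using PiE_arb[OF assms(1)[unfolded multi_idx_def], of i] assms(2)
    by (cases "i \<in> M") (auto simp: override_on_def)
qed

text \<open>Turns a sum over all modes into an iterated sum over frozen and free modes.\<close>

lemma bij_override:
  assumes "\<beta> \<subseteq> M"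
  shows "bij_betw (\<lambda>(\<kappa>, \<mu>). override_on \<kappa> \<mu> \<beta>) (idx (M - \<beta>) \<times> idx \<beta>) (idx M)"
  by (rule bij_betw_byWitness[where f' = "\<lambda>\<nu>. (restrict \<nu> (M - \<beta>), restrict \<nu> \<beta>)"])
    (use assms in \<open>auto simp: restrict_override restrict_override_compl override_restrict
      override_idx restrict_idx\<close>)

section \<open>Slices and Fubini's theorem\<close>

lemma slice_summable: "(\<lambda>\<mu>. (entry x (override_on \<nu> \<mu> \<beta>))\<^sup>2) summable_on idx \<beta>"
proof -
  have "inj_on (\<lambda>\<mu>. override_on \<nu> \<mu> \<beta>) (idx \<beta>)"
    by (rule inj_on_inverseI[of _ "\<lambda>\<nu>. restrict \<nu> \<beta>"]) (simp add: restrict_override)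
  then show ?thesis
    using summable_on_reindex[of "\<lambda>\<mu>. override_on \<nu> \<mu> \<beta>" "idx \<beta>" "\<lambda>p. (entry x p)\<^sup>2"]
    by (simp add: o_def entry_summable_on)
qed

lemma entry_slice: "entry (slice \<beta> \<nu> x) \<mu> = (if \<mu> \<in> idx \<beta> then entry x (override_on \<nu> \<mu> \<beta>) else 0)"
  unfolding slice_def by (rule entry_ell2_of[OF slice_summable])

lemma slice_in [simp]: "slice \<beta> \<nu> x \<in> modes \<beta>"
  unfolding slice_def by (rule ell2_of_in[OF slice_summable])

lemma slice_add: "slice \<beta> \<nu> (x + y) = slice \<beta> \<nu> x + slice \<beta> \<nu> y"
  and slice_diff: "slice \<beta> \<nu> (x - y) = slice \<beta> \<nu> x - slice \<beta> \<nu> y"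
  and slice_scaleR: "slice \<beta> \<nu> (c *\<^sub>R x) = c *\<^sub>R slice \<beta> \<nu> x"
  and slice_zero [simp]: "slice \<beta> \<nu> 0 = 0"
  by (rule ell2_eqI; simp add: entry_slice entry_add entry_minus entry_scaleR entry_zero)+

lemma slice_cong: "(\<And>i. i \<notin> \<beta> \<Longrightarrow> \<nu> i = \<nu>' i) \<Longrightarrow> slice \<beta> \<nu> x = slice \<beta> \<nu>' x"
  unfolding slice_def by (intro arg_cong[of _ _ "ell2_of _"] ext arg_cong[of _ _ "entry x"])
    (auto simp: override_on_def)

lemma slice_override [simp]: "slice \<beta> (override_on \<nu> \<mu> \<beta>) x = slice \<beta> \<nu> x"
  by (rule slice_cong) (simp add: override_on_def)

lemma slice_restrict:
  assumes "\<nu> \<in> idx M"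
  shows "slice \<beta> (restrict \<nu> (M - \<beta>)) x = slice \<beta> \<nu> x"
proof (rule slice_cong)
  fix i assume "i \<notin> \<beta>"
  then show "restrict \<nu> (M - \<beta>) i = \<nu> i"
    using PiE_arb[OF assms[unfolded multi_idx_def], of i] by auto
qed

lemma slice_slice:
  assumes "\<beta> \<subseteq> \<alpha>" "\<kappa> \<in> idx (\<alpha> - \<beta>)"
  shows "slice \<beta> \<kappa> (slice \<alpha> \<nu> x) = slice \<beta> (override_on \<nu> \<kappa> (\<alpha> - \<beta>)) x"
proof (rule ell2_eqI)
  fix \<mu>
  have "override_on \<nu> (override_on \<kappa> \<mu> \<beta>) \<alpha> = override_on (override_on \<nu> \<kappa> (\<alpha> - \<beta>)) \<mu> \<beta>"
    by (rule ext) (use assms(1) in \<open>auto simp: override_on_def\<close>)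
  then show "entry (slice \<beta> \<kappa> (slice \<alpha> \<nu> x)) \<mu> = entry (slice \<beta> (override_on \<nu> \<kappa> (\<alpha> - \<beta>)) x) \<mu>"
    using assms by (auto simp: entry_slice override_idx)
qed

text \<open>The standard way to prove tensor identities below: on slices along
  \<open>\<beta>\<close>, a lifted operator is just the operator itself
  (\<open>slice_lift\<close>).\<close>

lemma eq_by_slices:
  assumes "x \<in> modes M" "y \<in> modes M" "\<beta> \<subseteq> M"
    and "\<And>\<kappa>. \<kappa> \<in> idx (M - \<beta>) \<Longrightarrow> slice \<beta> \<kappa> x = slice \<beta> \<kappa> y"
  shows "x = y"
proof (rule ell2_eqI)
  fix \<nu> show "entry x \<nu> = entry y \<nu>"
  proof (cases "\<nu> \<in> idx M")
    case True
    then have "entry (slice \<beta> (restrict \<nu> (M - \<beta>)) x) (restrict \<nu> \<beta>) =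
        entry (slice \<beta> (restrict \<nu> (M - \<beta>)) y) (restrict \<nu> \<beta>)"
      using assms(4)[of "restrict \<nu> (M - \<beta>)"] by (simp add: restrict_idx)
    then show ?thesis
      using True assms(3) by (simp add: entry_slice restrict_idx override_restrict)
  qed (use assms in \<open>simp add: entry_outside\<close>)
qed

lemma has_sum_inner_slices:
  assumes "\<beta> \<subseteq> M" and "x \<in> modes M \<or> y \<in> modes M"
  shows "((\<lambda>\<kappa>. inner (slice \<beta> \<kappa> x) (slice \<beta> \<kappa> y)) has_sum inner x y) (idx (M - \<beta>))"
proof -
  let ?f = "\<lambda>\<nu>. entry x \<nu> * entry y \<nu>"
  have "((\<lambda>p. ?f (case p of (\<kappa>, \<mu>) \<Rightarrow> override_on \<kappa> \<mu> \<beta>)) has_sum inner x y)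
      (idx (M - \<beta>) \<times> idx \<beta>)"
    by (rule has_sum_reindex_bij_betw[OF bij_override[OF assms(1)], THEN iffD2, of ?f,
          OF has_sum_inner_on[OF assms(2)]])
  then show ?thesis
  proof (rule has_sum_Sigma')
    fix \<kappa>
    have "((\<lambda>\<mu>. entry (slice \<beta> \<kappa> x) \<mu> * entry (slice \<beta> \<kappa> y) \<mu>) has_sum
        inner (slice \<beta> \<kappa> x) (slice \<beta> \<kappa> y)) (idx \<beta>)"
      by (rule has_sum_inner_on) simp
    then show "((\<lambda>\<mu>. ?f (case (\<kappa>, \<mu>) of (\<kappa>, \<mu>) \<Rightarrow> override_on \<kappa> \<mu> \<beta>)) has_sum
        inner (slice \<beta> \<kappa> x) (slice \<beta> \<kappa> y)) (idx \<beta>)"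
      by (rule has_sum_cong[THEN iffD1, rotated]) (simp add: entry_slice)
  qed
qed

lemma has_sum_norm_slices:
  assumes "\<beta> \<subseteq> M" and "x \<in> modes M"
  shows "((\<lambda>\<kappa>. (norm (slice \<beta> \<kappa> x))\<^sup>2) has_sum (norm x)\<^sup>2) (idx (M - \<beta>))"
  using has_sum_inner_slices[OF assms(1), of x x] assms(2) by (simp add: power2_norm_eq_inner)

text \<open>Tonelli: columns with square-summable norms fit together to a tensor. Without this,
  \<open>ell2_of\<close> would return an unspecified element.\<close>

lemma assemble_summable:
  assumes "\<beta> \<subseteq> M" and y: "\<And>\<kappa>. \<kappa> \<in> idx (M - \<beta>) \<Longrightarrow> y \<kappa> \<in> modes \<beta>"
    and s: "(\<lambda>\<kappa>. (norm (y \<kappa>))\<^sup>2) summable_on idx (M - \<beta>)"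
  shows "(\<lambda>\<nu>. (entry (y (restrict \<nu> (M - \<beta>))) (restrict \<nu> \<beta>))\<^sup>2) summable_on idx M"
proof -
  let ?g = "\<lambda>(\<kappa>, \<mu>). (entry (y \<kappa>) \<mu>)\<^sup>2"
  have *: "(\<Sum>\<^sub>\<infinity>\<mu>\<in>idx \<beta>. (entry (y \<kappa>) \<mu>)\<^sup>2) = (norm (y \<kappa>))\<^sup>2" if "\<kappa> \<in> idx (M - \<beta>)" for \<kappa>
    by (rule infsumI[OF has_sum_norm_on[OF y[OF that]]])
  have "(\<lambda>p. norm (?g p)) summable_on (idx (M - \<beta>) \<times> idx \<beta>)"
    unfolding Infinite_Sum.abs_summable_on_Sigma_iff
    using s by (auto simp: entry_summable_on * cong: summable_on_cong)
  then have "?g summable_on (idx (M - \<beta>) \<times> idx \<beta>)"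
    by (rule abs_summable_summable)
  then have "(\<lambda>p. (\<lambda>\<nu>. (entry (y (restrict \<nu> (M - \<beta>))) (restrict \<nu> \<beta>))\<^sup>2)
      (case p of (\<kappa>, \<mu>) \<Rightarrow> override_on \<kappa> \<mu> \<beta>)) summable_on (idx (M - \<beta>) \<times> idx \<beta>)"
    by (rule summable_on_cong[THEN iffD1, rotated])
      (auto simp: restrict_override restrict_override_compl)
  then show ?thesis
    by (subst (asm) summable_on_reindex_bij_betw[OF bij_override[OF assms(1)]])
qed

section \<open>Lifted projectors\<close>

lemma lift_summable:
  assumes A: "projector_on (modes \<beta>) A" and \<beta>: "\<beta> \<subseteq> M"
  shows "(\<lambda>\<nu>. (entry (A (slice \<beta> \<nu> x)) (restrict \<nu> \<beta>))\<^sup>2) summable_on idx M"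
proof -
  \<comment> \<open>\<open>x\<close> may have support outside \<open>idx M\<close>, so its slices
    are compared with those of its restriction to \<open>idx M\<close>.\<close>
  define z where "z = ell2_of (idx M) (entry x)"
  have z: "z \<in> modes M" unfolding z_def by (intro ell2_of_in entry_summable_on)
  have sz: "slice \<beta> \<kappa> z = slice \<beta> \<kappa> x" if "\<kappa> \<in> idx (M - \<beta>)" for \<kappa>
    by (rule ell2_eqI)
      (use that \<beta> in \<open>simp add: entry_slice z_def entry_ell2_of entry_summable_on override_idx\<close>)
  have "(\<lambda>\<kappa>. (norm (slice \<beta> \<kappa> x))\<^sup>2) summable_on idx (M - \<beta>)"
    using has_sum_imp_summable[OF has_sum_norm_slices[OF \<beta> z]]
    by (rule summable_on_cong[THEN iffD1, rotated]) (simp add: sz)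
  then have "(\<lambda>\<kappa>. (norm (A (slice \<beta> \<kappa> x)))\<^sup>2) summable_on idx (M - \<beta>)"
    by (rule summable_on_comparison_test)
      (auto intro!: power_mono projector_norm_le[OF A])
  then have "(\<lambda>\<nu>. (entry (A (slice \<beta> (restrict \<nu> (M - \<beta>)) x)) (restrict \<nu> \<beta>))\<^sup>2) summable_on idx M"
    by (intro assemble_summable \<beta>) (auto intro: projector_in[OF A])
  then show ?thesis
    by (rule summable_on_cong[THEN iffD1, rotated]) (simp add: slice_restrict)
qed

context
  fixes M \<beta> A
  assumes A: "projector_on (modes \<beta>) A" and \<beta>: "\<beta> \<subseteq> M"
begin

lemma entry_lift:
  "entry (lift M \<beta> A x) \<nu> = (if \<nu> \<in> idx M then entry (A (slice \<beta> \<nu> x)) (restrict \<nu> \<beta>) else 0)"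
  unfolding lift_def by (rule entry_ell2_of[OF lift_summable[OF A \<beta>]])

lemma lift_in: "lift M \<beta> A x \<in> modes M"
  unfolding lift_def by (rule ell2_of_in[OF lift_summable[OF A \<beta>]])

lemma slice_lift: "\<kappa> \<in> idx (M - \<beta>) \<Longrightarrow> slice \<beta> \<kappa> (lift M \<beta> A x) = A (slice \<beta> \<kappa> x)"
proof (rule ell2_eqI)
  fix \<mu> assume "\<kappa> \<in> idx (M - \<beta>)"
  then show "entry (slice \<beta> \<kappa> (lift M \<beta> A x)) \<mu> = entry (A (slice \<beta> \<kappa> x)) \<mu>"
    by (auto simp: entry_slice entry_lift override_idx \<beta> restrict_override
        entry_outside[OF projector_in[OF A]])
qed

text \<open>Self-adjointness moves \<open>A\<close> to the coordinate vector. An entry of the lift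
  thus becomes a linear functional of one slice, and functionals on disjoint modes can be
  multiplied.\<close>

lemma entry_lift_inner:
  "\<nu> \<in> idx M \<Longrightarrow> entry (lift M \<beta> A x) \<nu> = inner (A (unit_ell2 (restrict \<nu> \<beta>))) (slice \<beta> \<nu> x)"
  by (simp add: entry_lift projector_adjoint[OF A])

text \<open>Linearity and idempotence hold on every slice; self-adjointness follows by summing the
  slicewise identities.\<close>

lemma projector_lift: "projector_on (modes M) (lift M \<beta> A)"
  unfolding projector_on_def
proof (intro conjI allI)
  note eqI = eq_by_slices[OF _ _ \<beta>]
  note sub = subspace_add[OF subspace_ell2_on] subspace_scale[OF subspace_ell2_on]
  show "linear (lift M \<beta> A)"
    by (rule linearI; rule eqI)
      (simp_all add: sub lift_in slice_lift slice_add slice_scaleR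
        linear_add[OF projector_linear[OF A]] linear_scale[OF projector_linear[OF A]])
  show "lift M \<beta> A (lift M \<beta> A x) = lift M \<beta> A x" for x
    by (rule eqI) (simp_all add: lift_in slice_lift projector_idem[OF A])
  show "inner (lift M \<beta> A x) y = inner x (lift M \<beta> A y)" for x y
  proof -
    have "((\<lambda>\<kappa>. inner (slice \<beta> \<kappa> (lift M \<beta> A x)) (slice \<beta> \<kappa> y)) has_sum inner (lift M \<beta> A x) y)
        (idx (M - \<beta>))"
      by (intro has_sum_inner_slices \<beta>) (simp add: lift_in)
    then have "((\<lambda>\<kappa>. inner (slice \<beta> \<kappa> x) (slice \<beta> \<kappa> (lift M \<beta> A y))) has_sum inner (lift M \<beta> A x) y)
        (idx (M - \<beta>))"
      by (rule has_sum_cong[THEN iffD1, rotated]) (simp add: slice_lift projector_adjoint[OF A])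
    moreover have "((\<lambda>\<kappa>. inner (slice \<beta> \<kappa> x) (slice \<beta> \<kappa> (lift M \<beta> A y))) has_sum inner x (lift M \<beta> A y))
        (idx (M - \<beta>))"
      by (intro has_sum_inner_slices \<beta>) (simp add: lift_in)
    ultimately show ?thesis by (rule has_sum_unique)
  qed
  show "range (lift M \<beta> A) \<subseteq> modes M" by (auto intro: lift_in)
qed

end

section \<open>Elementary tensors with two factors and commutation of lifts\<close>

lemma tensor2_summable:
  assumes "\<alpha> \<inter> \<beta> = {}" "b \<in> modes \<beta>"
  shows "(\<lambda>\<zeta>. (entry a (restrict \<zeta> \<alpha>) * entry b (restrict \<zeta> \<beta>))\<^sup>2) summable_on idx (\<alpha> \<union> \<beta>)"
proof -
  have [simp]: "\<alpha> \<union> \<beta> - \<beta> = \<alpha>" using assms(1) by auto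
  \<comment> \<open>The \<open>\<beta>\<close>-columns of the product are the multiples
    \<open>entry a \<kappa> *\<^sub>R b\<close>.\<close>
  have "(\<lambda>\<zeta>. (entry (entry a (restrict \<zeta> (\<alpha> \<union> \<beta> - \<beta>)) *\<^sub>R b) (restrict \<zeta> \<beta>))\<^sup>2) summable_on idx (\<alpha> \<union> \<beta>)"
  proof (rule assemble_summable)
    show "(\<lambda>\<kappa>. (norm (entry a \<kappa> *\<^sub>R b))\<^sup>2) summable_on idx (\<alpha> \<union> \<beta> - \<beta>)"
      by (simp add: power_mult_distrib summable_on_cmult_left entry_summable_on)
  qed (use assms subspace_ell2_on in \<open>auto intro: subspace_scale\<close>)
  then show ?thesis by (simp add: entry_scaleR)
qed

lemma entry_tensor2:
  assumes "\<alpha> \<inter> \<beta> = {}" "b \<in> modes \<beta>"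
  shows "entry (tensor2 \<alpha> \<beta> a b) \<zeta> =
    (if \<zeta> \<in> idx (\<alpha> \<union> \<beta>) then entry a (restrict \<zeta> \<alpha>) * entry b (restrict \<zeta> \<beta>) else 0)"
  unfolding tensor2_def by (rule entry_ell2_of[OF tensor2_summable[OF assms]])

lemma tensor2_in: "\<alpha> \<inter> \<beta> = {} \<Longrightarrow> b \<in> modes \<beta> \<Longrightarrow> tensor2 \<alpha> \<beta> a b \<in> modes (\<alpha> \<union> \<beta>)"
  unfolding tensor2_def by (intro ell2_of_in tensor2_summable)

lemma tensor2_commute:
  "\<alpha> \<inter> \<beta> = {} \<Longrightarrow> a \<in> modes \<alpha> \<Longrightarrow> b \<in> modes \<beta> \<Longrightarrow> tensor2 \<alpha> \<beta> a b = tensor2 \<beta> \<alpha> b a"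
  by (rule ell2_eqI) (simp add: entry_tensor2 Int_commute Un_commute)

lemma tensor2_scaleR:
  "\<alpha> \<inter> \<beta> = {} \<Longrightarrow> b \<in> modes \<beta> \<Longrightarrow> tensor2 \<alpha> \<beta> (r *\<^sub>R a) (s *\<^sub>R b) = (r * s) *\<^sub>R tensor2 \<alpha> \<beta> a b"
  by (rule ell2_eqI) (simp add: entry_tensor2 entry_scaleR subspace_scale[OF subspace_ell2_on])

lemma slice_tensor2:
  assumes "\<alpha> \<inter> \<beta> = {}" "b \<in> modes \<beta>" "\<kappa> \<in> idx \<alpha>"
  shows "slice \<beta> \<kappa> (tensor2 \<alpha> \<beta> a b) = entry a \<kappa> *\<^sub>R b"
proof (rule ell2_eqI)
  fix \<mu>
  have [simp]: "\<alpha> \<union> \<beta> - \<beta> = \<alpha>" using assms(1) by auto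
  show "entry (slice \<beta> \<kappa> (tensor2 \<alpha> \<beta> a b)) \<mu> = entry (entry a \<kappa> *\<^sub>R b) \<mu>"
    using override_idx[of \<kappa> "\<alpha> \<union> \<beta>" \<beta> \<mu>] assms restrict_override_compl[of \<kappa> "\<alpha> \<union> \<beta>" \<beta> \<mu>]
    by (auto simp: entry_slice entry_tensor2 entry_scaleR restrict_override entry_outside)
qed

text \<open>The pairing with an elementary tensor is evaluated by contracting over
  \<open>\<beta>\<close> first and over \<open>\<alpha>\<close> afterwards.\<close>

lemma has_sum_inner_tensor2:
  assumes "\<alpha> \<inter> \<beta> = {}" "b \<in> modes \<beta>"
  shows "((\<lambda>\<xi>. entry a \<xi> * inner b (slice \<beta> (override_on \<nu> \<xi> \<alpha>) x)) has_sum
    inner (tensor2 \<alpha> \<beta> a b) (slice (\<alpha> \<union> \<beta>) \<nu> x)) (idx \<alpha>)"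
proof -
  have [simp]: "\<alpha> \<union> \<beta> - \<beta> = \<alpha>" using assms(1) by auto
  have "((\<lambda>\<kappa>. inner (slice \<beta> \<kappa> (tensor2 \<alpha> \<beta> a b)) (slice \<beta> \<kappa> (slice (\<alpha> \<union> \<beta>) \<nu> x))) has_sum
    inner (tensor2 \<alpha> \<beta> a b) (slice (\<alpha> \<union> \<beta>) \<nu> x)) (idx \<alpha>)"
    using has_sum_inner_slices[of \<beta> "\<alpha> \<union> \<beta>" "tensor2 \<alpha> \<beta> a b" "slice (\<alpha> \<union> \<beta>) \<nu> x"] by simp
  then show ?thesis
    by (rule has_sum_cong[THEN iffD1, rotated])
      (simp add: slice_tensor2 slice_slice assms)
qed

lemma inner_tensor2:
  assumes "\<alpha> \<inter> \<beta> = {}" "a \<in> modes \<alpha>" "b \<in> modes \<beta>" "b' \<in> modes \<beta>"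
  shows "inner (tensor2 \<alpha> \<beta> a b) (tensor2 \<alpha> \<beta> a' b') = inner a a' * inner b b'"
proof -
  have [simp]: "\<alpha> \<union> \<beta> - \<beta> = \<alpha>" using assms(1) by auto
  have "((\<lambda>\<kappa>. inner (slice \<beta> \<kappa> (tensor2 \<alpha> \<beta> a b)) (slice \<beta> \<kappa> (tensor2 \<alpha> \<beta> a' b'))) has_sum
    inner (tensor2 \<alpha> \<beta> a b) (tensor2 \<alpha> \<beta> a' b')) (idx \<alpha>)"
    using has_sum_inner_slices[of \<beta> "\<alpha> \<union> \<beta>" "tensor2 \<alpha> \<beta> a b" "tensor2 \<alpha> \<beta> a' b'"]
    by (simp add: tensor2_in assms)
  then have "((\<lambda>\<kappa>. entry a \<kappa> * entry a' \<kappa> * inner b b') has_sum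
    inner (tensor2 \<alpha> \<beta> a b) (tensor2 \<alpha> \<beta> a' b')) (idx \<alpha>)"
    by (rule has_sum_cong[THEN iffD1, rotated])
      (simp add: slice_tensor2 assms)
  moreover have "((\<lambda>\<kappa>. entry a \<kappa> * entry a' \<kappa> * inner b b') has_sum (inner a a' * inner b b')) (idx \<alpha>)"
    by (intro has_sum_cmult_left has_sum_inner_on) (simp add: assms)
  ultimately show ?thesis by (rule has_sum_unique)
qed

text \<open>Two successive contractions are one contraction with an elementary tensor. By
  \<open>tensor2_commute\<close> the right-hand side is symmetric in the two operators, so
  commutation becomes a corollary.\<close>

lemma entry_lift_lift:
  assumes A: "projector_on (modes \<alpha>) A" and B: "projector_on (modes \<beta>) B"
    and "\<alpha> \<subseteq> M" "\<beta> \<subseteq> M" and dis: "\<alpha> \<inter> \<beta> = {}" and \<nu>: "\<nu> \<in> idx M"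
  shows "entry (lift M \<alpha> A (lift M \<beta> B x)) \<nu> =
    inner (tensor2 \<alpha> \<beta> (A (unit_ell2 (restrict \<nu> \<alpha>))) (B (unit_ell2 (restrict \<nu> \<beta>)))) (slice (\<alpha> \<union> \<beta>) \<nu> x)"
proof -
  let ?a = "A (unit_ell2 (restrict \<nu> \<alpha>))" and ?b = "B (unit_ell2 (restrict \<nu> \<beta>))"
  have "((\<lambda>\<xi>. entry ?a \<xi> * entry (slice \<alpha> \<nu> (lift M \<beta> B x)) \<xi>) has_sum
      inner ?a (slice \<alpha> \<nu> (lift M \<beta> B x))) (idx \<alpha>)"
    by (rule has_sum_inner_on) simp
  then have "((\<lambda>\<xi>. entry ?a \<xi> * inner ?b (slice \<beta> (override_on \<nu> \<xi> \<alpha>) x)) has_sum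
      inner ?a (slice \<alpha> \<nu> (lift M \<beta> B x))) (idx \<alpha>)"
  proof (rule has_sum_cong[THEN iffD1, rotated])
    fix \<xi> assume \<xi>: "\<xi> \<in> idx \<alpha>"
    have "restrict (override_on \<nu> \<xi> \<alpha>) \<beta> = restrict \<nu> \<beta>"
      using dis by (intro restrict_override_other) auto
    then show "entry ?a \<xi> * entry (slice \<alpha> \<nu> (lift M \<beta> B x)) \<xi> =
        entry ?a \<xi> * inner ?b (slice \<beta> (override_on \<nu> \<xi> \<alpha>) x)"
      using \<xi> \<nu> assms by (simp add: entry_slice entry_lift_inner override_idx')
  qed
  moreover have "((\<lambda>\<xi>. entry ?a \<xi> * inner ?b (slice \<beta> (override_on \<nu> \<xi> \<alpha>) x)) has_sum
      inner (tensor2 \<alpha> \<beta> ?a ?b) (slice (\<alpha> \<union> \<beta>) \<nu> x)) (idx \<alpha>)"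
    by (rule has_sum_inner_tensor2[OF dis projector_in[OF B]])
  ultimately show ?thesis
    unfolding entry_lift_inner[OF A \<open>\<alpha> \<subseteq> M\<close> \<nu>] by (rule has_sum_unique)
qed

lemma lift_commute:
  assumes A: "projector_on (modes \<alpha>) A" and B: "projector_on (modes \<beta>) B"
    and "\<alpha> \<subseteq> M" "\<beta> \<subseteq> M" and dis: "\<alpha> \<inter> \<beta> = {}"
  shows "lift M \<alpha> A (lift M \<beta> B x) = lift M \<beta> B (lift M \<alpha> A x)"
proof (rule ell2_eqI)
  fix \<nu>
  show "entry (lift M \<alpha> A (lift M \<beta> B x)) \<nu> = entry (lift M \<beta> B (lift M \<alpha> A x)) \<nu>"
  proof (cases "\<nu> \<in> idx M")
    case True
    have "\<beta> \<inter> \<alpha> = {}" using dis by auto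
    from entry_lift_lift[OF A B assms(3,4) dis True] entry_lift_lift[OF B A assms(4,3) this True]
    show ?thesis
      by (simp only: tensor2_commute[OF dis projector_in[OF A] projector_in[OF B]] Un_commute[of \<beta> \<alpha>])
  qed (simp add: entry_lift assms)
qed

text \<open>A single summand of \<open>span_proj\<close>. It is a projector for a unit vector and
  also for zero, which occurs beyond the rank.\<close>

definition line_proj :: "'n tensor \<Rightarrow> 'n tensor \<Rightarrow> 'n tensor"
  where "line_proj a x = inner a x *\<^sub>R a"

lemma projector_line_proj:
  assumes "a \<in> modes \<alpha>" "a = 0 \<or> inner a a = 1"
  shows "projector_on (modes \<alpha>) (line_proj a)"
proof -
  have "line_proj a = span_proj {()} (\<lambda>_. a)"
    by (simp add: line_proj_def span_proj_singleton fun_eq_iff)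
  then show ?thesis
    by simp (rule projector_span_proj_on; use assms in \<open>auto simp: quasi_orthonormal_def\<close>)
qed

text \<open>Applied to a coordinate vector, \<open>line_proj a\<close> returns a multiple of
  \<open>a\<close>, so \<open>entry_lift_lift\<close> already exhibits the projection onto the line
  of the product. This carries the induction over the factors of a Tucker product.\<close>

lemma lift_line_proj_tensor2:
  assumes a: "a \<in> modes \<alpha>" "a = 0 \<or> inner a a = 1" and b: "b \<in> modes \<beta>" "b = 0 \<or> inner b b = 1"
    and M: "\<alpha> \<subseteq> M" "\<beta> \<subseteq> M" and dis: "\<alpha> \<inter> \<beta> = {}"
  shows "lift M \<alpha> (line_proj a) (lift M \<beta> (line_proj b) x) =
    lift M (\<alpha> \<union> \<beta>) (line_proj (tensor2 \<alpha> \<beta> a b)) x"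
proof (rule ell2_eqI)
  fix \<nu>
  let ?c = "tensor2 \<alpha> \<beta> a b"
  have A: "projector_on (modes \<alpha>) (line_proj a)" and B: "projector_on (modes \<beta>) (line_proj b)"
    by (intro projector_line_proj a b)+
  have "?c = 0 \<or> inner ?c ?c = 1"
    using a b inner_tensor2[OF dis a(1) b(1) b(1), of a] by auto
  then have C: "projector_on (modes (\<alpha> \<union> \<beta>)) (line_proj ?c)"
    using b(1) dis by (intro projector_line_proj tensor2_in)
  show "entry (lift M \<alpha> (line_proj a) (lift M \<beta> (line_proj b) x)) \<nu> =
      entry (lift M (\<alpha> \<union> \<beta>) (line_proj ?c) x) \<nu>"
  proof (cases "\<nu> \<in> idx M")
    case True
    have \<zeta>: "restrict \<nu> (\<alpha> \<union> \<beta>) \<in> idx (\<alpha> \<union> \<beta>)" using M by (intro restrict_idx[OF True]) auto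
    have *: "entry ?c (restrict \<nu> (\<alpha> \<union> \<beta>)) = entry a (restrict \<nu> \<alpha>) * entry b (restrict \<nu> \<beta>)"
      using \<zeta> by (simp add: entry_tensor2 dis b Int_absorb1)
    have "entry (lift M \<alpha> (line_proj a) (lift M \<beta> (line_proj b) x)) \<nu> =
        (entry a (restrict \<nu> \<alpha>) * entry b (restrict \<nu> \<beta>)) * inner ?c (slice (\<alpha> \<union> \<beta>) \<nu> x)"
      unfolding entry_lift_lift[OF A B M dis True]
      by (simp add: line_proj_def tensor2_scaleR dis b inner_commute[of _ "unit_ell2 _"])
    also have "\<dots> = entry (lift M (\<alpha> \<union> \<beta>) (line_proj ?c) x) \<nu>"
      using M by (subst entry_lift_inner[OF C _ True])
        (simp_all add: line_proj_def * inner_commute[of _ "unit_ell2 _"])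
    finally show ?thesis .
  next
    case False
    have "\<alpha> \<union> \<beta> \<subseteq> M" using M by auto
    then show ?thesis using False by (simp add: entry_lift A C M)
  qed
qed

lemma slice_full:
  assumes "x \<in> modes M" "\<nu> \<in> idx M"
  shows "slice M \<nu> x = x"
proof (rule ell2_eqI)
  fix \<mu>
  have "override_on \<nu> \<mu> M = \<mu>" if \<mu>: "\<mu> \<in> idx M"
  proof
    fix i show "override_on \<nu> \<mu> M i = \<mu> i"
      using PiE_arb[OF \<mu>[unfolded multi_idx_def], of i] PiE_arb[OF assms(2)[unfolded multi_idx_def], of i]
      by (cases "i \<in> M") (auto simp: override_on_def)
  qed
  then show "entry (slice M \<nu> x) \<mu> = entry x \<mu>"
    using assms(1) by (auto simp: entry_slice entry_outside)
qed

lemma lift_full: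
  assumes A: "projector_on (modes M) A" and x: "x \<in> modes M"
  shows "lift M M A x = A x"
proof (rule ell2_eqI)
  fix \<nu>
  show "entry (lift M M A x) \<nu> = entry (A x) \<nu>"
  proof (cases "\<nu> \<in> idx M")
    case True
    then have "restrict \<nu> M = \<nu>" by (simp add: multi_idx_def PiE_iff extensional_restrict)
    then show ?thesis using True by (simp add: entry_lift[OF A] slice_full x)
  qed (simp add: entry_lift[OF A] entry_outside[OF projector_in[OF A]])
qed

text \<open>Replaces an infinite expansion of \<open>z\<close>: on each slice, all coefficients of
  the frame projection vanish, so that projection vanishes as well. No series has to be exchanged
  with \<open>lift\<close>.\<close>

lemma lift_span_proj_eq_0:
  assumes U: "quasi_orthonormal K U" "\<And>k. k \<in> K \<Longrightarrow> U k \<in> modes \<beta>" and \<beta>: "\<beta> \<subseteq> M"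
    and z: "lift M \<beta> (span_proj K U) z = z"
    and comp: "\<And>k. k \<in> K \<Longrightarrow> lift M \<beta> (line_proj (U k)) z = 0"
  shows "z = 0"
proof -
  note P = projector_span_proj_on[OF U]
  show ?thesis
  proof (rule eq_by_slices[OF _ _ \<beta>])
    show "z \<in> modes M" using lift_in[OF P \<beta>, of z] z by simp
    show "0 \<in> modes M" by (rule subspace_0[OF subspace_ell2_on])
    fix \<kappa> assume \<kappa>: "\<kappa> \<in> idx (M - \<beta>)"
    have "inner (U k) (slice \<beta> \<kappa> z) = 0" if k: "k \<in> K" for k
    proof -
      have Uk: "U k = 0 \<or> inner (U k) (U k) = 1"
        using U(1) k by (auto simp: quasi_orthonormal_def)
      have "line_proj (U k) (slice \<beta> \<kappa> z) = slice \<beta> \<kappa> (lift M \<beta> (line_proj (U k)) z)"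
        using k Uk by (intro slice_lift[symmetric] projector_line_proj U \<beta> \<kappa>)
      then show ?thesis by (auto simp: comp[OF k] line_proj_def)
    qed
    then have "span_proj K U (slice \<beta> \<kappa> z) = 0" by (rule span_proj_orthogonal)
    then show "slice \<beta> \<kappa> z = slice \<beta> \<kappa> 0"
      using slice_lift[OF P \<beta> \<kappa>, of z] z by simp
  qed
qed

end

section \<open>Ranks and singular value decompositions of matricizations\<close>

lemma has_sum_sum_finite:
  fixes f :: "'k \<Rightarrow> 'i \<Rightarrow> 'a::real_normed_vector"
  assumes "finite F" "\<And>k. k \<in> F \<Longrightarrow> (f k has_sum s k) A"
  shows "((\<lambda>i. \<Sum>k\<in>F. f k i) has_sum (\<Sum>k\<in>F. s k)) A"
  using assms by (induction F rule: finite_induct) (auto intro: has_sum_add)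

text \<open>Taking \<open>B\<close> inside \<open>S\<close> keeps the spanning vectors in the mode
  space when \<open>S\<close> is the range of a matricization.\<close>

lemma edim_leD:
  assumes "edim S \<le> enat n"
  obtains B where "finite B" "card B \<le> n" "B \<subseteq> S" "S \<subseteq> span B"
proof -
  from assms obtain B0 where B0: "finite B0" "S \<subseteq> span B0" and dim: "dim S \<le> n"
    by (auto simp: edim_def split: if_splits)
  obtain B where B: "B \<subseteq> S" "independent B" "S \<subseteq> span B" "card B = dim S"
    by (rule basis_exists)
  have "finite B"
    using independent_span_bound[OF B0(1) B(2)] B(1) B0(2) by blast
  with B dim show ?thesis by (intro that[of B]) auto
qed

lemma edim_leI: "finite B \<Longrightarrow> S \<subseteq> span B \<Longrightarrow> edim S \<le> enat (card B)"
  unfolding edim_def using dim_le_card[of S B] by auto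

text \<open>Gram-Schmidt followed by normalization with \<open>sgn\<close>. A zero vector may
  remain, which \<open>quasi_orthonormal\<close> tolerates.\<close>

lemma orthonormal_span_exists:
  fixes B :: "'a::real_inner set"
  assumes "finite B"
  obtains C where "finite C" "card C \<le> card B" "span C = span B" "quasi_orthonormal C (\<lambda>c. c)"
proof -
  obtain C0 where C0: "finite C0" "card C0 \<le> card B" "span C0 = span B" "pairwise orthogonal C0"
    using basis_orthogonal[OF assms] by blast
  let ?C = "sgn ` C0"
  have "span ?C \<subseteq> span C0"
    by (intro span_minimal subspace_span) (auto simp: sgn_div_norm intro: span_scale span_base)
  moreover have "c \<in> span ?C" if "c \<in> C0" for c
  proof -
    have "norm c *\<^sub>R sgn c \<in> span ?C" using that by (intro span_scale span_base) auto
    then show ?thesis by (simp add: sgn_div_norm) (cases "c = 0"; simp add: span_zero)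
  qed
  then have "span C0 \<subseteq> span ?C" by (intro span_minimal subspace_span) auto
  moreover have "card ?C \<le> card C0" by (rule card_image_le[OF C0(1)])
  moreover have "inner (sgn c) (sgn c') = (if sgn c = sgn c' \<and> sgn c \<noteq> 0 then 1 else 0)"
    if "c \<in> C0" "c' \<in> C0" for c c'
  proof (cases "c = c'")
    case True
    then show ?thesis by (simp add: sgn_div_norm sgn_zero_iff power2_norm_eq_inner[symmetric] power2_eq_square)
  next
    case False
    then have 0: "inner (sgn c) (sgn c') = 0"
      using C0(4) that by (auto simp: pairwise_def orthogonal_def sgn_div_norm)
    \<comment> \<open>Orthogonal vectors with the same normalization would be orthogonal to
      themselves, hence zero.\<close>
    then have "\<not> (sgn c = sgn c' \<and> sgn c \<noteq> 0)" by auto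
    with 0 show ?thesis by simp
  qed
  ultimately show ?thesis
    using C0 by (intro that[of ?C]) (auto simp: quasi_orthonormal_def)
qed

lemma span_proj_fixes_span:
  assumes C: "finite C" "quasi_orthonormal C (\<lambda>c. c)"
    and "x \<in> span C"
  shows "span_proj C (\<lambda>c. c) x = x"
  using assms(3)
proof (induction rule: span_induct)
  case base
  have "span_proj C (\<lambda>c. c) = (\<lambda>x. \<Sum>c\<in>C. inner c x *\<^sub>R c)"
    using C(1) by (simp add: span_proj_def fun_eq_iff)
  then show ?case
    by (auto simp: subspace_def inner_add_right scaleR_left_distrib sum.distrib
        simp flip: scaleR_scaleR scaleR_sum_right)
next
  case (step x)
  then show ?case using span_proj_fixes[OF C(2)] by simp
qed

lemma span_proj_in_span:
  assumes "finite C"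
  shows "span_proj C (\<lambda>c. c) x \<in> span C"
  unfolding span_proj_def infsum_finite[OF assms]
  by (intro span_sum span_scale span_base)

text \<open>For positive indices, the singular vectors vanish exactly where
  \<open>\<sigma> k\<close> does. The norm facts carry the factor \<open>\<sigma> k\<close> and thus
  hold within and beyond the rank alike.\<close>

lemma svd_facts:
  assumes "svd X Y T \<sigma> U V"
  shows svd_orthonormal_U: "quasi_orthonormal {1..} U"
    and svd_orthonormal_V: "quasi_orthonormal {1..} V"
    and svd_in_U: "1 \<le> k \<Longrightarrow> U k \<in> Y" and svd_in_V: "1 \<le> k \<Longrightarrow> V k \<in> X"
    and svd_nonneg: "1 \<le> k \<Longrightarrow> 0 \<le> \<sigma> k"
    and svd_decreasing: "1 \<le> j \<Longrightarrow> j \<le> k \<Longrightarrow> \<sigma> k \<le> \<sigma> j"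
    and svd_norm_U: "1 \<le> k \<Longrightarrow> \<sigma> k * inner (U k) (U k) = \<sigma> k"
    and svd_norm_V: "1 \<le> k \<Longrightarrow> \<sigma> k * inner (V k) (V k) = \<sigma> k"
    and svd_has_sum: "c \<in> X \<Longrightarrow> ((\<lambda>k. (\<sigma> k * inner (V k) c) *\<^sub>R U k) has_sum T c) {1..}"
proof -
  note svd = assms[unfolded svd_def orthonormal_family_def upto_enat_def]
  let ?r = "edim (T ` X)"
  have beyond: "\<sigma> k = 0 \<and> U k = 0 \<and> V k = 0" if "1 \<le> k" "\<not> enat k \<le> ?r" for k
    using svd that by auto
  have ortho: "inner (U j) (U k) = (if j = k then 1 else 0)" "inner (V j) (V k) = (if j = k then 1 else 0)"
    if "1 \<le> j" "1 \<le> k" "enat j \<le> ?r" "enat k \<le> ?r" for j k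
    using svd that by auto
  show "quasi_orthonormal {1..} U" "quasi_orthonormal {1..} V"
    unfolding quasi_orthonormal_def using beyond ortho
    by (metis atLeast_iff inner_zero_left inner_zero_right zero_neq_one)+
  show "1 \<le> k \<Longrightarrow> U k \<in> Y" "1 \<le> k \<Longrightarrow> V k \<in> X"
    "c \<in> X \<Longrightarrow> ((\<lambda>k. (\<sigma> k * inner (V k) c) *\<^sub>R U k) has_sum T c) {1..}"
    using svd by auto
  show "0 \<le> \<sigma> k" if "1 \<le> k"
    using svd that beyond[OF that] by (cases "enat k \<le> ?r") (auto simp: less_imp_le)
  show "\<sigma> k * inner (U k) (U k) = \<sigma> k" "\<sigma> k * inner (V k) (V k) = \<sigma> k" if "1 \<le> k"
    using that beyond[OF that] ortho[OF that that] by (cases "enat k \<le> ?r"; simp)+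
  show "\<sigma> k \<le> \<sigma> j" if "1 \<le> j" "j \<le> k"
    using that(2)
  proof (induction rule: dec_induct)
    case (step n)
    have "\<sigma> (Suc n) \<le> \<sigma> n" using svd step.hyps that(1) by auto
    with step.IH show ?case by simp
  qed simp
qed

lemma svd_inner_left:
  assumes "svd X Y T \<sigma> U V" "1 \<le> k" "c \<in> X"
  shows "inner (U k) (T c) = \<sigma> k * inner (V k) c"
proof -
  have "((\<lambda>j. inner (U k) ((\<sigma> j * inner (V j) c) *\<^sub>R U j)) has_sum inner (U k) (T c)) {1..}"
    by (rule has_sum_inner_right[OF svd_has_sum[OF assms(1,3)]])
  moreover have "inner (U k) (U j) = 0" if "1 \<le> j" "j \<noteq> k" for j
    using svd_orthonormal_U[OF assms(1)] that assms(2) by (auto simp: quasi_orthonormal_def)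
  then have "((\<lambda>j. inner (U k) ((\<sigma> j * inner (V j) c) *\<^sub>R U j)) has_sum
      (\<sigma> k * inner (U k) (U k)) * inner (V k) c) {1..}"
    by (intro has_sum_finite_neutralI[of "{k}"]) (use assms(2) in auto)
  ultimately show ?thesis
    using svd_norm_U[OF assms(1,2)] by (metis has_sum_unique)
qed

lemma svd_apply_right:
  assumes "svd X Y T \<sigma> U V" "1 \<le> k"
  shows "T (V k) = \<sigma> k *\<^sub>R U k"
proof -
  have "((\<lambda>j. (\<sigma> j * inner (V j) (V k)) *\<^sub>R U j) has_sum T (V k)) {1..}"
    by (rule svd_has_sum[OF assms(1) svd_in_V[OF assms]])
  moreover have "inner (V j) (V k) = 0" if "1 \<le> j" "j \<noteq> k" for j
    using svd_orthonormal_V[OF assms(1)] that assms(2) by (auto simp: quasi_orthonormal_def)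
  then have "((\<lambda>j. (\<sigma> j * inner (V j) (V k)) *\<^sub>R U j) has_sum
      (\<sigma> k * inner (V k) (V k)) *\<^sub>R U k) {1..}"
    by (intro has_sum_finite_neutralI[of "{k}"]) (use assms(2) in auto)
  ultimately show ?thesis
    using svd_norm_V[OF assms] by (metis has_sum_unique)
qed

lemma tail_sum_le:
  fixes \<sigma> a :: "nat \<Rightarrow> real"
  assumes nonneg: "\<And>k. 1 \<le> k \<Longrightarrow> 0 \<le> \<sigma> k" and dec: "\<And>j k. 1 \<le> j \<Longrightarrow> j \<le> k \<Longrightarrow> \<sigma> k \<le> \<sigma> j"
    and a: "\<And>k. 0 \<le> a k" "\<And>k. 1 \<le> k \<Longrightarrow> a k \<le> 1" and sum_a: "(\<Sum>k=1..n. a k) \<le> real r"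
  shows "(\<Sum>k\<in>{r<..n}. (\<sigma> k)\<^sup>2) \<le> (\<Sum>k=1..n. (\<sigma> k)\<^sup>2 * (1 - a k))"
proof (cases "r < n")
  case True
  let ?t = "(\<sigma> (Suc r))\<^sup>2"
  have split: "{1..n} = {1..r} \<union> {r<..n}" using True by auto
  have disj: "(\<Sum>k=1..n. f k) = (\<Sum>k=1..r. f k) + (\<Sum>k\<in>{r<..n}. f k)" for f :: "nat \<Rightarrow> real"
    unfolding split by (rule sum.union_disjoint) auto
  have "(\<Sum>k\<in>{r<..n}. (\<sigma> k)\<^sup>2 * a k) \<le> (\<Sum>k\<in>{r<..n}. ?t * a k)"
    by (intro sum_mono mult_right_mono power_mono dec a nonneg) auto
  also have "\<dots> \<le> ?t * (real r - (\<Sum>k=1..r. a k))"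
    using sum_a unfolding disj sum_distrib_left[symmetric] by (intro mult_left_mono) auto
  also have "\<dots> = (\<Sum>k=1..r. ?t * (1 - a k))"
    by (simp add: sum_distrib_left[symmetric] sum_subtractf)
  also have "\<dots> \<le> (\<Sum>k=1..r. (\<sigma> k)\<^sup>2 * (1 - a k))"
    by (intro sum_mono mult_right_mono power_mono dec nonneg) (auto simp: a)
  finally show ?thesis unfolding disj by (simp add: algebra_simps sum_subtractf)
qed (auto intro!: sum_nonneg mult_nonneg_nonneg simp: a)

section \<open>Matricizations read through slices\<close>

context tensor_modes
begin

context
  fixes m :: nat and M \<alpha> :: "nat set"
  assumes M: "M = {1..m}" and \<alpha>: "\<alpha> \<subseteq> M"
begin

private abbreviation "mtx \<equiv> matricization N d m \<alpha>"

lemma compl_compl: "M - (M - \<alpha>) = \<alpha>" using \<alpha> by auto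

lemma override_swap:
  assumes "\<mu> \<in> idx \<alpha>" "\<kappa> \<in> idx (M - \<alpha>)"
  shows "override_on \<mu> \<kappa> (M - \<alpha>) = override_on \<kappa> \<mu> \<alpha>"
proof
  fix i show "override_on \<mu> \<kappa> (M - \<alpha>) i = override_on \<kappa> \<mu> \<alpha> i"
    using PiE_arb[OF assms(1)[unfolded multi_idx_def], of i]
      PiE_arb[OF assms(2)[unfolded multi_idx_def], of i]
    by (auto simp: override_on_def)
qed

lemma merge_override:
  assumes "\<mu> \<in> idx \<alpha>"
  shows "merge \<alpha> (M - \<alpha>) (\<mu>, \<kappa>) = override_on \<mu> \<kappa> (M - \<alpha>)"
proof
  fix i show "merge \<alpha> (M - \<alpha>) (\<mu>, \<kappa>) i = override_on \<mu> \<kappa> (M - \<alpha>) i"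
    using PiE_arb[OF assms(1)[unfolded multi_idx_def], of i]
    by (auto simp: merge_def override_on_def)
qed

context
  fixes x :: "'n tensor"
  assumes x: "x \<in> modes M"
begin

lemma mat_summable: "(\<lambda>\<mu>. (inner (slice (M - \<alpha>) \<mu> x) c)\<^sup>2) summable_on idx \<alpha>"
proof (rule summable_on_comparison_test)
  show "(\<lambda>\<mu>. (norm (slice (M - \<alpha>) \<mu> x))\<^sup>2 * (norm c)\<^sup>2) summable_on idx \<alpha>"
    using has_sum_imp_summable[OF has_sum_norm_slices[of "M - \<alpha>" M x]] x
    by (intro summable_on_cmult_left) (simp add: compl_compl)
  show "(inner (slice (M - \<alpha>) \<mu> x) c)\<^sup>2 \<le> (norm (slice (M - \<alpha>) \<mu> x))\<^sup>2 * (norm c)\<^sup>2" for \<mu>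
    using Cauchy_Schwarz_ineq[of "slice (M - \<alpha>) \<mu> x" c] by (simp add: power2_norm_eq_inner)
qed auto

text \<open>Slices along \<open>M - \<alpha>\<close> are the rows of the matricization, slices along
  \<open>\<alpha>\<close> its columns.\<close>

lemma mat_eq:
  assumes "c \<in> modes (M - \<alpha>)"
  shows "mtx x c = ell2_of (idx \<alpha>) (\<lambda>\<mu>. inner (slice (M - \<alpha>) \<mu> x) c)"
proof -
  have "(\<Sum>\<^sub>\<infinity>\<kappa>\<in>idx (M - \<alpha>). entry x (merge \<alpha> (M - \<alpha>) (\<mu>, \<kappa>)) * entry c \<kappa>) =
      inner (slice (M - \<alpha>) \<mu> x) c" if "\<mu> \<in> idx \<alpha>" for \<mu>
  proof (rule infsumI)
    have "((\<lambda>\<kappa>. entry (slice (M - \<alpha>) \<mu> x) \<kappa> * entry c \<kappa>) has_sum inner (slice (M - \<alpha>) \<mu> x) c) (idx (M - \<alpha>))"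
      by (rule has_sum_inner_on) (simp add: assms)
    then show "((\<lambda>\<kappa>. entry x (merge \<alpha> (M - \<alpha>) (\<mu>, \<kappa>)) * entry c \<kappa>) has_sum
        inner (slice (M - \<alpha>) \<mu> x) c) (idx (M - \<alpha>))"
      by (rule has_sum_cong[THEN iffD1, rotated]) (simp add: entry_slice merge_override that)
  qed
  then show ?thesis
    unfolding matricization_def M[symmetric] ell2_of_def
    by (intro arg_cong[of _ _ Abs_ell2] ext) simp
qed

lemma entry_mat: "c \<in> modes (M - \<alpha>) \<Longrightarrow> \<mu> \<in> idx \<alpha> \<Longrightarrow> entry (mtx x c) \<mu> = inner (slice (M - \<alpha>) \<mu> x) c"
  by (simp add: mat_eq entry_ell2_of mat_summable)

lemma mat_in: "c \<in> modes (M - \<alpha>) \<Longrightarrow> mtx x c \<in> modes \<alpha>"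
  by (simp add: mat_eq mat_summable)

text \<open>The columns lie in the range of the matricization, which links its rank to
  slices.\<close>

lemma mat_unit:
  assumes \<kappa>: "\<kappa> \<in> idx (M - \<alpha>)"
  shows "mtx x (unit_ell2 \<kappa>) = slice \<alpha> \<kappa> x"
proof (rule ell2_eqI)
  fix \<mu>
  have u: "unit_ell2 \<kappa> \<in> modes (M - \<alpha>)" using \<kappa> by (rule unit_in)
  show "entry (mtx x (unit_ell2 \<kappa>)) \<mu> = entry (slice \<alpha> \<kappa> x) \<mu>"
  proof (cases "\<mu> \<in> idx \<alpha>")
    case True
    then show ?thesis
      by (simp add: entry_mat u inner_commute[of _ "unit_ell2 \<kappa>"] entry_slice \<kappa> override_swap)
  qed (simp add: entry_outside[OF mat_in[OF u]] entry_slice)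
qed

text \<open>Summing over rows or over columns gives the same value, because both compute the pairing
  of \<open>x\<close> with the elementary tensor of \<open>y\<close> and \<open>c\<close>.\<close>

lemma mat_adjoint:
  assumes c: "c \<in> modes (M - \<alpha>)" and y: "y \<in> modes \<alpha>"
  shows "((\<lambda>\<kappa>. entry c \<kappa> * inner y (slice \<alpha> \<kappa> x)) has_sum inner y (mtx x c)) (idx (M - \<alpha>))"
proof -
  \<comment> \<open>\<open>?z\<close> is \<open>x\<close> written as a slice over all modes, the
    form required by \<open>has_sum_inner_tensor2\<close>. Extensional indices are
    \<open>undefined\<close> outside their domain, so this base point completes every index
    correctly.\<close>
  let ?z = "slice (\<alpha> \<union> (M - \<alpha>)) (\<lambda>_. undefined) x"
  have dis: "\<alpha> \<inter> (M - \<alpha>) = {}" "(M - \<alpha>) \<inter> \<alpha> = {}" by auto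
  have undef: "override_on (\<lambda>_. undefined) \<xi> \<beta> = \<xi>" if "\<xi> \<in> idx \<beta>" for \<xi> \<beta>
  proof
    fix i show "override_on (\<lambda>_. undefined) \<xi> \<beta> i = \<xi> i"
      using PiE_arb[OF that[unfolded multi_idx_def], of i] by (auto simp: override_on_def)
  qed
  have "((\<lambda>\<xi>. entry y \<xi> * inner c (slice (M - \<alpha>) (override_on (\<lambda>_. undefined) \<xi> \<alpha>) x)) has_sum
    inner (tensor2 \<alpha> (M - \<alpha>) y c) ?z) (idx \<alpha>)"
    by (rule has_sum_inner_tensor2[OF dis(1) c])
  then have "((\<lambda>\<xi>. entry y \<xi> * entry (mtx x c) \<xi>) has_sum
    inner (tensor2 \<alpha> (M - \<alpha>) y c) ?z) (idx \<alpha>)"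
    by (rule has_sum_cong[THEN iffD1, rotated]) (simp add: undef entry_mat c inner_commute)
  moreover have "((\<lambda>\<xi>. entry y \<xi> * entry (mtx x c) \<xi>) has_sum inner y (mtx x c)) (idx \<alpha>)"
    using y by (intro has_sum_inner_on) simp
  ultimately have eq: "inner y (mtx x c) = inner (tensor2 \<alpha> (M - \<alpha>) y c) ?z"
    by (rule has_sum_unique[rotated])
  have "((\<lambda>\<kappa>. entry c \<kappa> * inner y (slice \<alpha> (override_on (\<lambda>_. undefined) \<kappa> (M - \<alpha>)) x)) has_sum
    inner (tensor2 (M - \<alpha>) \<alpha> c y) (slice ((M - \<alpha>) \<union> \<alpha>) (\<lambda>_. undefined) x)) (idx (M - \<alpha>))"
    by (rule has_sum_inner_tensor2[OF dis(2) y])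
  then have "((\<lambda>\<kappa>. entry c \<kappa> * inner y (slice \<alpha> (override_on (\<lambda>_. undefined) \<kappa> (M - \<alpha>)) x)) has_sum
    inner y (mtx x c)) (idx (M - \<alpha>))"
    by (simp only: eq tensor2_commute[OF dis(1) y c] Un_commute[of \<alpha>])
  then show ?thesis
    by (rule has_sum_cong[THEN iffD1, rotated]) (simp add: undef)
qed

text \<open>A Hilbert-Schmidt bound: Bessel's inequality in every row, summed over the rows.\<close>

lemma sum_norm_mat_le:
  assumes V: "quasi_orthonormal F V" "\<And>k. k \<in> F \<Longrightarrow> V k \<in> modes (M - \<alpha>)" and F: "finite F"
  shows "(\<Sum>k\<in>F. (norm (mtx x (V k)))\<^sup>2) \<le> (norm x)\<^sup>2"
proof (rule has_sum_mono)
  show "((\<lambda>\<mu>. \<Sum>k\<in>F. (entry (mtx x (V k)) \<mu>)\<^sup>2) has_sum (\<Sum>k\<in>F. (norm (mtx x (V k)))\<^sup>2)) (idx \<alpha>)"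
    by (intro has_sum_sum_finite F has_sum_norm_on mat_in V)
  show "((\<lambda>\<mu>. (norm (slice (M - \<alpha>) \<mu> x))\<^sup>2) has_sum (norm x)\<^sup>2) (idx \<alpha>)"
    using has_sum_norm_slices[of "M - \<alpha>" M x] x by (simp add: compl_compl)
  show "(\<Sum>k\<in>F. (entry (mtx x (V k)) \<mu>)\<^sup>2) \<le> (norm (slice (M - \<alpha>) \<mu> x))\<^sup>2" if "\<mu> \<in> idx \<alpha>" for \<mu>
    using bessel[OF V(1) F order.refl, of "slice (M - \<alpha>) \<mu> x"]
    by (simp add: entry_mat V that inner_commute)
qed

text \<open>Elements of the range are infinite combinations of columns. They stay in the
  finite-dimensional span because the orthogonal projection onto it fixes every column and, by
  \<open>mat_adjoint\<close>, can be pulled through the sum.\<close>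

lemma rank_at_leI:
  assumes B: "finite B" "B \<subseteq> modes \<alpha>"
    and slices: "\<And>\<kappa>. \<kappa> \<in> idx (M - \<alpha>) \<Longrightarrow> slice \<alpha> \<kappa> x \<in> span B"
  shows "rank_at N d m x \<alpha> \<le> enat (card B)"
proof -
  obtain C where C: "finite C" "card C \<le> card B" "span C = span B" "quasi_orthonormal C (\<lambda>c. c)"
    by (rule orthonormal_span_exists[OF B(1)])
  let ?A = "span_proj C (\<lambda>c. c)"
  have "span B \<subseteq> modes \<alpha>" by (rule span_minimal[OF B(2) subspace_ell2_on])
  then have "C \<subseteq> modes \<alpha>" using span_superset[of C] C(3) by auto
  then have A: "projector_on (modes \<alpha>) ?A" using C(4) by (intro projector_span_proj_on) auto
  have "mtx x c \<in> span B" if c: "c \<in> modes (M - \<alpha>)" for c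
  proof -
    have "?A (mtx x c) = mtx x c"
    proof (rule ell2_eqI)
      fix p show "entry (?A (mtx x c)) p = entry (mtx x c) p"
      proof (cases "p \<in> idx \<alpha>")
        case True
        have "((\<lambda>\<kappa>. entry c \<kappa> * inner (?A (unit_ell2 p)) (slice \<alpha> \<kappa> x)) has_sum
            inner (?A (unit_ell2 p)) (mtx x c)) (idx (M - \<alpha>))"
          by (rule mat_adjoint[OF c projector_in[OF A]])
        then have "((\<lambda>\<kappa>. entry c \<kappa> * inner (unit_ell2 p) (slice \<alpha> \<kappa> x)) has_sum
            inner (?A (unit_ell2 p)) (mtx x c)) (idx (M - \<alpha>))"
          by (rule has_sum_cong[THEN iffD1, rotated])
            (simp add: projector_adjoint[OF A] span_proj_fixes_span[OF C(1,4)] slices C(3))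
        moreover have "((\<lambda>\<kappa>. entry c \<kappa> * inner (unit_ell2 p) (slice \<alpha> \<kappa> x)) has_sum
            inner (unit_ell2 p) (mtx x c)) (idx (M - \<alpha>))"
          by (rule mat_adjoint[OF c unit_in[OF True]])
        ultimately have "inner (?A (unit_ell2 p)) (mtx x c) = inner (unit_ell2 p) (mtx x c)"
          by (rule has_sum_unique)
        then show ?thesis by (simp add: projector_adjoint[OF A])
      qed (simp add: entry_outside[OF mat_in[OF c]] entry_outside[OF projector_in[OF A]])
    qed
    then show ?thesis using span_proj_in_span[OF C(1), of "mtx x c"] C(3) by simp
  qed
  then show ?thesis
    unfolding rank_at_def M[symmetric] by (intro edim_leI B(1)) auto
qed

text \<open>The last conclusion turns the rank bound into invariance under a lifted projection, a
  property that is inherited under commuting operators.\<close>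

lemma rank_at_leD:
  assumes "rank_at N d m x \<alpha> \<le> enat n"
  obtains C where "finite C" "card C \<le> n" "C \<subseteq> modes \<alpha>" "quasi_orthonormal C (\<lambda>c. c)"
    "\<And>c. c \<in> modes (M - \<alpha>) \<Longrightarrow> mtx x c \<in> span C"
    "lift M \<alpha> (span_proj C (\<lambda>c. c)) x = x"
proof -
  from assms obtain B where B: "finite B" "card B \<le> n"
      "B \<subseteq> mtx x ` modes (M - \<alpha>)" "mtx x ` modes (M - \<alpha>) \<subseteq> span B"
    unfolding rank_at_def M[symmetric] by (rule edim_leD)
  have "B \<subseteq> modes \<alpha>" using B(3) mat_in by blast
  then have "span B \<subseteq> modes \<alpha>" by (rule span_minimal[OF _ subspace_ell2_on])
  obtain C where C: "finite C" "card C \<le> card B" "span C = span B" "quasi_orthonormal C (\<lambda>c. c)"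
    by (rule orthonormal_span_exists[OF B(1)])
  have CM: "C \<subseteq> modes \<alpha>" using span_superset[of C] C(3) \<open>span B \<subseteq> modes \<alpha>\<close> by auto
  then have A: "projector_on (modes \<alpha>) (span_proj C (\<lambda>c. c))"
    using C(4) by (intro projector_span_proj_on) auto
  have "lift M \<alpha> (span_proj C (\<lambda>c. c)) x = x"
  proof (rule eq_by_slices[OF lift_in[OF A \<alpha>] x \<alpha>])
    fix \<kappa> assume \<kappa>: "\<kappa> \<in> idx (M - \<alpha>)"
    have "slice \<alpha> \<kappa> x \<in> span C"
      using mat_unit[OF \<kappa>] unit_in[OF \<kappa>] B(4) C(3) by (metis image_subset_iff)
    then show "slice \<alpha> \<kappa> (lift M \<alpha> (span_proj C (\<lambda>c. c)) x) = slice \<alpha> \<kappa> x"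
      by (simp add: slice_lift[OF A \<alpha> \<kappa>] span_proj_fixes_span[OF C(1,4)])
  qed
  then show ?thesis using B C CM by (intro that[of C]) auto
qed

end

lemma mat_diff:
  assumes "x \<in> modes M" "y \<in> modes M" "c \<in> modes (M - \<alpha>)"
  shows "mtx (x - y) c = mtx x c - mtx y c"
proof (rule ell2_eqI)
  fix \<mu>
  have xy: "x - y \<in> modes M" using assms subspace_diff[OF subspace_ell2_on] by blast
  show "entry (mtx (x - y) c) \<mu> = entry (mtx x c - mtx y c) \<mu>"
    using assms xy by (cases "\<mu> \<in> idx \<alpha>")
      (simp_all add: entry_mat entry_minus slice_diff inner_diff_left entry_outside[OF mat_in])
qed

section \<open>Tails of the singular values\<close>

context
  fixes v :: "'n tensor" and \<sigma> :: "nat \<Rightarrow> real" and U V :: "nat \<Rightarrow> 'n tensor"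
  assumes v: "v \<in> modes M" and svd: "mode_svd N d m v \<alpha> \<sigma> U V"
begin

private lemma svd': "svd (modes (M - \<alpha>)) (modes \<alpha>) (mtx v) \<sigma> U V"
  using svd by (simp add: M)

text \<open>Each \<open>\<sigma> k\<close> is the norm of the image of \<open>V k\<close>, so the
  Hilbert-Schmidt bound applies. The tails in \<open>trunc_bound\<close> are therefore genuine sums
  and not the default value of \<open>infsum\<close>.\<close>

lemma svd_square_summable: "(\<lambda>k. (\<sigma> k)\<^sup>2) summable_on {1..}"
proof (rule summable_on_squaresI)
  fix F assume F: "finite F" "F \<subseteq> {1::nat..}"
  have "(\<sigma> k)\<^sup>2 = (norm (mtx v (V k)))\<^sup>2" if "k \<in> F" for k
    using F(2) that svd_norm_U[OF svd', of k]
    by (auto simp: svd_apply_right[OF svd'] power_mult_distrib power2_norm_eq_inner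
        power2_eq_square[of "\<sigma> k"])
  then have "(\<Sum>k\<in>F. (\<sigma> k)\<^sup>2) = (\<Sum>k\<in>F. (norm (mtx v (V k)))\<^sup>2)" by simp
  also have "\<dots> \<le> (norm v)\<^sup>2"
    using F svd_in_V[OF svd']
    by (intro sum_norm_mat_le v quasi_orthonormal_subset[OF svd_orthonormal_V[OF svd']]) auto
  finally show "(\<Sum>k\<in>F. (\<sigma> k)\<^sup>2) \<le> (norm v)\<^sup>2" .
qed

text \<open>Singular values are indexed from 1, and \<open>r < enat k\<close> excludes
  \<open>k = 0\<close> even for \<open>r = 0\<close>.\<close>

lemma tail_set_subset: "{k. r < enat k} \<subseteq> {1..}"
proof
  fix k assume "k \<in> {k. r < enat k}"
  then have "0 < enat k" using le_less_trans[of 0 r "enat k"] by simp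
  then show "k \<in> {1..}" by (simp add: zero_enat_def)
qed

lemma tail_summable: "(\<lambda>k. (\<sigma> k)\<^sup>2) summable_on {k. r < enat k}"
  by (rule summable_on_subset_banach[OF svd_square_summable tail_set_subset])

text \<open>
  Only finite sums are needed: by Bessel, \<open>v - w\<close> dominates its action on the right singular vectors
  \<open>V k\<close>. There \<open>v\<close> produces \<open>\<sigma> k *\<^sub>R U k\<close>, while the range of \<open>w\<close> has dimension at most \<open>r\<close> and
  hence captures at most a total weight of \<open>r\<close> of the vectors \<open>U k\<close>.
\<close>

lemma eckart_young:
  assumes w: "w \<in> modes M" and rank: "rank_at N d m w \<alpha> \<le> r"
  shows "(\<Sum>\<^sub>\<infinity>k\<in>{k. r < enat k}. \<bar>\<sigma> k\<bar>\<^sup>2) \<le> (norm (v - w))\<^sup>2"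
proof (cases r)
  case (enat n)
  obtain C where C: "finite C" "card C \<le> n" "C \<subseteq> modes \<alpha>" "quasi_orthonormal C (\<lambda>c. c)"
      "\<And>c. c \<in> modes (M - \<alpha>) \<Longrightarrow> mtx w c \<in> span C"
    using rank_at_leD[OF w rank[unfolded enat]] by metis
  let ?A = "span_proj C (\<lambda>c. c)"
  have A: "projector_on (modes \<alpha>) ?A"
    using C(3,4) by (intro projector_span_proj_on) auto
  define a where "a k = (norm (?A (U k)))\<^sup>2" for k
  have a_eq: "a k = (\<Sum>c\<in>C. (inner c (U k))\<^sup>2)" for k
    using norm_sum_quasi_orthonormal[OF C(4,1) order.refl, of "U k"] C(1)
    by (simp add: a_def span_proj_def)
  have vw: "v - w \<in> modes M" using v w subspace_diff[OF subspace_ell2_on] by blast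
  have "(\<Sum>k\<in>F. (\<sigma> k)\<^sup>2) \<le> (norm (v - w))\<^sup>2" if F: "finite F" "F \<subseteq> {k. r < enat k}" for F
  proof -
    define K where "K = Max (insert 0 F)"
    have FK: "F \<subseteq> {n<..K}" using F by (auto simp: K_def enat)
    have "(\<Sum>k\<in>F. (\<sigma> k)\<^sup>2) \<le> (\<Sum>k\<in>{n<..K}. (\<sigma> k)\<^sup>2)"
      by (rule sum_mono2) (use FK in auto)
    also have "\<dots> \<le> (\<Sum>k=1..K. (\<sigma> k)\<^sup>2 * (1 - a k))"
    proof (rule tail_sum_le[OF svd_nonneg[OF svd'] svd_decreasing[OF svd']])
      show "0 \<le> a k" for k by (simp add: a_def)
      show "a k \<le> 1" if "1 \<le> k" for k
      proof -
        have "norm (?A (U k)) \<le> 1"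
          using projector_norm_le[OF A] quasi_orthonormal_norm_le[OF svd_orthonormal_U[OF svd']] that
          by (meson atLeast_iff order.trans)
        then show ?thesis by (simp add: a_def power_le_one)
      qed
      \<comment> \<open>This bounds the trace of the projection: after exchanging the sums, Bessel's
        inequality for \<open>U\<close> gives at most 1 for each vector in \<open>C\<close>.\<close>
      have "(\<Sum>k=1..K. a k) = (\<Sum>c\<in>C. \<Sum>k=1..K. (inner (U k) c)\<^sup>2)"
        unfolding a_eq by (subst sum.swap) (simp add: inner_commute)
      also have "\<dots> \<le> (\<Sum>c\<in>C. (norm c)\<^sup>2)"
        by (intro sum_mono bessel[OF svd_orthonormal_U[OF svd']]) auto
      also have "\<dots> \<le> (\<Sum>c\<in>C. 1)"
        using quasi_orthonormal_norm_le[OF C(4)] by (intro sum_mono) (auto simp: power_le_one)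
      also have "\<dots> \<le> real n" using C(2) by simp
      finally show "(\<Sum>k=1..K. a k) \<le> real n" .
    qed auto
    also have "\<dots> \<le> (\<Sum>k=1..K. (norm (mtx (v - w) (V k)))\<^sup>2)"
    proof (rule sum_mono)
      fix k assume "k \<in> {1..K}"
      then have k: "1 \<le> k" by simp
      have Vk: "V k \<in> modes (M - \<alpha>)" by (rule svd_in_V[OF svd' k])
      let ?y = "mtx (v - w) (V k)"
      have y: "?y = \<sigma> k *\<^sub>R U k - mtx w (V k)"
        using mat_diff[OF v w Vk] by (simp add: svd_apply_right[OF svd' k])
      have "?A (mtx w (V k)) = mtx w (V k)"
        by (rule span_proj_fixes_span[OF C(1,4) C(5)[OF Vk]])
      \<comment> \<open>The projection fixes the contribution of \<open>w\<close>, so the part of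
        \<open>?y\<close> orthogonal to \<open>C\<close> comes from \<open>v\<close> alone.\<close>
      then have "?y - ?A ?y = \<sigma> k *\<^sub>R (U k - ?A (U k))"
        unfolding y using projector_linear[OF A]
        by (simp add: linear_diff linear_scale algebra_simps)
      then have "(norm (?y - ?A ?y))\<^sup>2 = (\<sigma> k)\<^sup>2 * (norm (U k - ?A (U k)))\<^sup>2"
        by (simp add: power_mult_distrib)
      also have "(norm (U k - ?A (U k)))\<^sup>2 = inner (U k) (U k) - a k"
        using projector_norm_sq[OF A, of "U k"] by (simp add: a_def power2_norm_eq_inner)
      also have "(\<sigma> k)\<^sup>2 * (inner (U k) (U k) - a k) = (\<sigma> k)\<^sup>2 * (1 - a k)"
        using svd_norm_U[OF svd' k] by (simp add: power2_eq_square algebra_simps)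
      finally show "(\<sigma> k)\<^sup>2 * (1 - a k) \<le> (norm ?y)\<^sup>2"
        using projector_norm_sq[OF A, of ?y] zero_le_power2[of "norm (?A ?y)"] by linarith
    qed
    also have "\<dots> \<le> (norm (v - w))\<^sup>2"
      using svd_in_V[OF svd']
      by (intro sum_norm_mat_le vw quasi_orthonormal_subset[OF svd_orthonormal_V[OF svd']]) auto
    finally show ?thesis .
  qed
  then show ?thesis by (intro infsum_le_finite_sums) (simp_all add: tail_summable)
qed simp

text \<open>In each column only the discarded terms remain, with coefficients
  \<open>\<sigma> k * entry (V k) \<kappa>\<close>. Summed over the columns, they give at most the
  square of \<open>\<sigma> k\<close>, since \<open>V k\<close> has norm at most 1.\<close>

lemma truncation_error:
  "(norm (v - lift M \<alpha> (frame_proj r U) v))\<^sup>2 \<le> (\<Sum>\<^sub>\<infinity>k\<in>{k. r < enat k}. \<bar>\<sigma> k\<bar>\<^sup>2)"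
proof -
  let ?A = "frame_proj r U" and ?R = "{k. r < enat k}"
  have A_eq: "?A = span_proj (upto_enat r) U" by (simp add: frame_proj_def span_proj_def fun_eq_iff)
  have sub: "upto_enat r \<subseteq> {1..}" by (auto simp: upto_enat_def)
  note onU = quasi_orthonormal_subset[OF svd_orthonormal_U[OF svd'] sub]
  have A: "projector_on (modes \<alpha>) ?A"
    unfolding A_eq by (rule projector_span_proj_on[OF onU svd_in_U[OF svd']]) (auto simp: upto_enat_def)
  have col: "((\<lambda>k. (\<sigma> k * entry (V k) \<kappa>)\<^sup>2) has_sum (norm (slice \<alpha> \<kappa> v - ?A (slice \<alpha> \<kappa> v)))\<^sup>2) ?R"
    if \<kappa>: "\<kappa> \<in> idx (M - \<alpha>)" for \<kappa>
  proof -
    let ?s = "slice \<alpha> \<kappa> v"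
    let ?y = "?s - ?A ?s"
    have u: "unit_ell2 \<kappa> \<in> modes (M - \<alpha>)" by (rule unit_in[OF \<kappa>])
    have "((\<lambda>k. (\<sigma> k * entry (V k) \<kappa>) *\<^sub>R U k) has_sum ?s) {1..}"
      using svd_has_sum[OF svd' u] by (simp add: mat_unit[OF v \<kappa>] inner_commute[of _ "unit_ell2 \<kappa>"])
    \<comment> \<open>Pairing the expanded column with its own residual gives the squared norm of
      the residual: retained terms vanish and discarded ones turn into squares.\<close>
    then have "((\<lambda>k. inner ?y ((\<sigma> k * entry (V k) \<kappa>) *\<^sub>R U k)) has_sum inner ?y ?s) {1..}"
      by (rule has_sum_inner_right)
    moreover have "inner ?y ?s = (norm ?y)\<^sup>2"
    proof -
      have "inner ?y (?A ?s) = 0"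
        using projector_adjoint[OF A, of ?y ?s] by (simp add: projector_diff[OF A] projector_idem[OF A])
      then show ?thesis by (simp add: power2_norm_eq_inner inner_diff_right)
    qed
    moreover have "inner ?y (U k) = 0" if "1 \<le> k" "k \<notin> ?R" for k
    proof -
      have "?A (U k) = U k"
        unfolding A_eq using that by (intro span_proj_fixes[OF onU]) (auto simp: upto_enat_def not_less)
      then show ?thesis by (simp add: inner_diff_left projector_adjoint[OF A])
    qed
    moreover have "inner ?y (U k) = \<sigma> k * entry (V k) \<kappa>" if k: "k \<in> ?R" for k
    proof -
      have k1: "1 \<le> k" using k tail_set_subset by blast
      have "inner (U j) (U k) = 0" if "j \<in> upto_enat r" for j
      proof -
        have "j \<noteq> k" using that k by (auto simp: upto_enat_def)
        then show ?thesis
          using svd_orthonormal_U[OF svd'] k1 that by (auto simp: quasi_orthonormal_def upto_enat_def)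
      qed
      then have "?A (U k) = 0" unfolding A_eq by (rule span_proj_orthogonal)
      then have "inner ?y (U k) = inner (U k) ?s"
        unfolding inner_diff_left projector_adjoint[OF A] by (simp add: inner_commute)
      also have "\<dots> = \<sigma> k * entry (V k) \<kappa>"
        using svd_inner_left[OF svd' k1 u] by (simp add: mat_unit[OF v \<kappa>] inner_commute[of _ "unit_ell2 \<kappa>"])
      finally show ?thesis .
    qed
    ultimately show ?thesis
      using tail_set_subset[of r]
      by (subst has_sum_cong_neutral[where T = "{1..}" and g = "\<lambda>k. inner ?y ((\<sigma> k * entry (V k) \<kappa>) *\<^sub>R U k)"])
        (auto simp: power2_eq_square)
  qed
  have "((\<lambda>\<kappa>. (norm (slice \<alpha> \<kappa> v - ?A (slice \<alpha> \<kappa> v)))\<^sup>2) has_sum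
      (norm (v - lift M \<alpha> ?A v))\<^sup>2) (idx (M - \<alpha>))"
    using has_sum_norm_slices[OF \<alpha> subspace_diff[OF subspace_ell2_on v lift_in[OF A \<alpha>, of v]]]
    by (rule has_sum_cong[THEN iffD1, rotated]) (simp add: slice_diff slice_lift[OF A \<alpha>])
  then show ?thesis
  proof (rule has_sum_le_finite_sums)
    \<comment> \<open>With finitely many columns, the sums over \<open>\<kappa>\<close> and
      \<open>k\<close> can be exchanged.\<close>
    fix F assume F: "finite F" "F \<subseteq> idx (M - \<alpha>)"
    show "(\<Sum>\<kappa>\<in>F. (norm (slice \<alpha> \<kappa> v - ?A (slice \<alpha> \<kappa> v)))\<^sup>2) \<le> (\<Sum>\<^sub>\<infinity>k\<in>?R. \<bar>\<sigma> k\<bar>\<^sup>2)"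
    proof (rule has_sum_mono)
      show "((\<lambda>k. \<Sum>\<kappa>\<in>F. (\<sigma> k * entry (V k) \<kappa>)\<^sup>2) has_sum
          (\<Sum>\<kappa>\<in>F. (norm (slice \<alpha> \<kappa> v - ?A (slice \<alpha> \<kappa> v)))\<^sup>2)) ?R"
        using F by (intro has_sum_sum_finite col) auto
      show "((\<lambda>k. \<bar>\<sigma> k\<bar>\<^sup>2) has_sum (\<Sum>\<^sub>\<infinity>k\<in>?R. \<bar>\<sigma> k\<bar>\<^sup>2)) ?R"
        by (rule has_sum_infsum) (simp add: tail_summable)
      show "(\<Sum>\<kappa>\<in>F. (\<sigma> k * entry (V k) \<kappa>)\<^sup>2) \<le> \<bar>\<sigma> k\<bar>\<^sup>2" if "k \<in> ?R" for k
      proof -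
        have "k \<in> {1..}" using that tail_set_subset by blast
        have "(\<Sum>\<kappa>\<in>F. (entry (V k) \<kappa>)\<^sup>2) \<le> (norm (V k))\<^sup>2" by (rule finite_sum_entry_le[OF F(1)])
        also have "\<dots> \<le> 1"
          using quasi_orthonormal_norm_le[OF svd_orthonormal_V[OF svd'] \<open>k \<in> {1..}\<close>] by (simp add: power_le_one)
        finally have "(\<sigma> k)\<^sup>2 * (\<Sum>\<kappa>\<in>F. (entry (V k) \<kappa>)\<^sup>2) \<le> (\<sigma> k)\<^sup>2"
          using mult_left_mono[of _ 1 "(\<sigma> k)\<^sup>2"] by simp
        then show ?thesis by (simp add: power_mult_distrib sum_distrib_left)
      qed
    qed
  qed
qed

end

end

end

section \<open>Compositions of mode projections\<close>

declare One_nat_def [simp del]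

context tensor_modes
begin

text \<open>An operator on modes inside \<open>\<alpha>\<close> maps every column over
  \<open>\<alpha>\<close> by the same linear map, and therefore cannot enlarge the dimension of
  their span.\<close>

lemma slice_lift_sub:
  assumes A: "projector_on (modes \<beta>) A" and "\<beta> \<subseteq> \<alpha>" "\<alpha> \<subseteq> M" and \<kappa>: "\<kappa> \<in> idx (M - \<alpha>)"
  shows "slice \<alpha> \<kappa> (lift M \<beta> A x) = lift \<alpha> \<beta> A (slice \<alpha> \<kappa> x)"
proof (rule ell2_eqI)
  fix \<mu>
  have \<beta>M: "\<beta> \<subseteq> M" using assms by auto
  show "entry (slice \<alpha> \<kappa> (lift M \<beta> A x)) \<mu> = entry (lift \<alpha> \<beta> A (slice \<alpha> \<kappa> x)) \<mu>"
  proof (cases "\<mu> \<in> idx \<alpha>")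
    case True
    have "slice \<beta> \<mu> (slice \<alpha> \<kappa> x) = slice \<beta> (restrict \<mu> (\<alpha> - \<beta>)) (slice \<alpha> \<kappa> x)"
      by (rule slice_restrict[OF True, symmetric])
    also have "\<dots> = slice \<beta> (override_on \<kappa> (restrict \<mu> (\<alpha> - \<beta>)) (\<alpha> - \<beta>)) x"
      using assms(2) by (intro slice_slice restrict_idx[OF True]) auto
    also have "\<dots> = slice \<beta> (override_on \<kappa> \<mu> \<alpha>) x"
      by (rule slice_cong) (auto simp: override_on_def)
    finally have "slice \<beta> \<mu> (slice \<alpha> \<kappa> x) = slice \<beta> (override_on \<kappa> \<mu> \<alpha>) x" .
    moreover have "restrict (override_on \<kappa> \<mu> \<alpha>) \<beta> = restrict \<mu> \<beta>"
      using assms(2) by (intro restrict_ext) (auto simp: override_on_def)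
    ultimately show ?thesis
      using True override_idx[OF \<kappa> True assms(3)]
      by (simp add: entry_slice entry_lift[OF A \<beta>M] entry_lift[OF A assms(2)])
  qed (simp add: entry_slice entry_lift[OF A assms(2)])
qed

lemma apply_modes_eq_lift:
  assumes "\<beta> \<subseteq> {1..m}"
  shows "apply_modes N d m \<beta> A x = lift {1..m} \<beta> A x"
proof -
  have "merge \<beta> ({1..m} - \<beta>) (\<mu>, \<nu>) = override_on \<nu> \<mu> \<beta>" if \<nu>: "\<nu> \<in> idx {1..m}" for \<mu> \<nu>
  proof
    fix i show "merge \<beta> ({1..m} - \<beta>) (\<mu>, \<nu>) i = override_on \<nu> \<mu> \<beta> i"
      using PiE_arb[OF \<nu>[unfolded multi_idx_def], of i] assms by (auto simp: merge_def override_on_def)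
  qed
  then show ?thesis
    unfolding apply_modes_def lift_def slice_def ell2_of_def
    by (intro arg_cong[of _ _ Abs_ell2] ext) (auto cong: if_cong)
qed

text \<open>For \<open>\<beta>\<close> inside \<open>\<alpha>\<close>, a basis of the column space
  is mapped to a spanning set. For disjoint modes, the projection onto the old column space commutes
  with the operator and still fixes the result.\<close>

lemma rank_at_lift_le:
  assumes A: "projector_on (modes \<beta>) A" and \<beta>: "\<beta> \<subseteq> {1..m}" and \<alpha>: "\<alpha> \<subseteq> {1..m}"
    and nested: "\<beta> \<subseteq> \<alpha> \<or> \<alpha> \<inter> \<beta> = {}" and x: "x \<in> modes {1..m}"
    and rank: "rank_at N d m x \<alpha> \<le> r"
  shows "rank_at N d m (lift {1..m} \<beta> A x) \<alpha> \<le> r"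
proof (cases r)
  case (enat n)
  let ?M = "{1..m}" and ?y = "lift {1..m} \<beta> A x"
  obtain C where C: "finite C" "card C \<le> n" "C \<subseteq> modes \<alpha>" "quasi_orthonormal C (\<lambda>c. c)"
    and fix_x: "lift ?M \<alpha> (span_proj C (\<lambda>c. c)) x = x"
    using rank_at_leD[OF refl \<alpha> x rank[unfolded enat]] by metis
  have P: "projector_on (modes \<alpha>) (span_proj C (\<lambda>c. c))"
    using C(3,4) by (intro projector_span_proj_on) auto
  have col: "slice \<alpha> \<kappa> z \<in> span C" if "lift ?M \<alpha> (span_proj C (\<lambda>c. c)) z = z" "\<kappa> \<in> idx (?M - \<alpha>)" for z \<kappa>
    using slice_lift[OF P \<alpha> that(2), of z] span_proj_in_span[OF C(1)] that(1) by metis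
  from nested have "\<exists>B. finite B \<and> card B \<le> card C \<and> B \<subseteq> modes \<alpha> \<and>
      (\<forall>\<kappa>\<in>idx (?M - \<alpha>). slice \<alpha> \<kappa> ?y \<in> span B)"
  proof
    assume "\<beta> \<subseteq> \<alpha>"
    then have L: "projector_on (modes \<alpha>) (lift \<alpha> \<beta> A)" by (rule projector_lift[OF A])
    have "slice \<alpha> \<kappa> ?y \<in> span (lift \<alpha> \<beta> A ` C)" if "\<kappa> \<in> idx (?M - \<alpha>)" for \<kappa>
      unfolding slice_lift_sub[OF A \<open>\<beta> \<subseteq> \<alpha>\<close> \<alpha> that] linear_span_image[OF projector_linear[OF L]]
      using col[OF fix_x that] by simp
    then show ?thesis
      using C(1) card_image_le[OF C(1)] projector_in[OF L] by (intro exI[of _ "lift \<alpha> \<beta> A ` C"]) auto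
  next
    assume "\<alpha> \<inter> \<beta> = {}"
    then have "lift ?M \<alpha> (span_proj C (\<lambda>c. c)) ?y = ?y"
      by (simp add: lift_commute[OF P A \<alpha> \<beta>] fix_x)
    then show ?thesis using C(1,3) col by blast
  qed
  then obtain B where B: "finite B" "card B \<le> card C" "B \<subseteq> modes \<alpha>"
      "\<And>\<kappa>. \<kappa> \<in> idx (?M - \<alpha>) \<Longrightarrow> slice \<alpha> \<kappa> ?y \<in> span B"
    by blast
  have "rank_at N d m ?y \<alpha> \<le> enat (card B)"
    by (rule rank_at_leI[OF refl \<alpha> lift_in[OF A \<beta>] B(1,3,4)])
  also have "\<dots> \<le> r" using B(2) C(2) by (simp add: enat)
  finally show ?thesis .
qed simp

lemma upto_enat_enat: "upto_enat (enat n) = {1..n}"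
  by (auto simp: upto_enat_def)

lemma frame_proj_eq: "frame_proj r U = span_proj (upto_enat r) U"
  by (simp add: frame_proj_def span_proj_def fun_eq_iff)

lemma projector_frame_proj:
  assumes "quasi_orthonormal {1..} U" "\<And>k. 1 \<le> k \<Longrightarrow> U k \<in> modes \<alpha>"
  shows "projector_on (modes \<alpha>) (frame_proj r U)"
  unfolding frame_proj_eq
  by (rule projector_span_proj_on[OF quasi_orthonormal_subset[OF assms(1)] assms(2)])
    (auto simp: upto_enat_def)

lemma rank_at_lift_frame_proj:
  assumes U: "quasi_orthonormal {1..} U" "\<And>k. 1 \<le> k \<Longrightarrow> U k \<in> modes \<alpha>" and \<alpha>: "\<alpha> \<subseteq> {1..m}"
  shows "rank_at N d m (lift {1..m} \<alpha> (frame_proj r U) x) \<alpha> \<le> r"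
proof (cases r)
  case (enat n)
  note P = projector_frame_proj[OF U, of r]
  let ?B = "U ` {1..n}"
  have "rank_at N d m (lift {1..m} \<alpha> (frame_proj r U) x) \<alpha> \<le> enat (card ?B)"
  proof (rule rank_at_leI[OF refl \<alpha> lift_in[OF P \<alpha>]])
    show "?B \<subseteq> modes \<alpha>" using U(2) by auto
    fix \<kappa> assume \<kappa>: "\<kappa> \<in> idx ({1..m} - \<alpha>)"
    have "slice \<alpha> \<kappa> (lift {1..m} \<alpha> (frame_proj r U) x) =
        (\<Sum>k=1..n. inner (U k) (slice \<alpha> \<kappa> x) *\<^sub>R U k)"
      using slice_lift[OF P \<alpha> \<kappa>, of x] by (simp add: frame_proj_def enat upto_enat_enat)
    then show "slice \<alpha> \<kappa> (lift {1..m} \<alpha> (frame_proj r U) x) \<in> span ?B"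
      by (simp only:) (intro span_sum span_scale span_base; auto)
  qed auto
  also have "\<dots> \<le> r" using card_image_le[of "{1..n}" U] by (simp add: enat)
  finally show ?thesis .
qed simp

section \<open>Ranks along a sequence of projections\<close>

lemma fold_lift_in:
  assumes "\<And>b. b \<in> set bs \<Longrightarrow> projector_on (modes b) (A b) \<and> b \<subseteq> M" and "x \<in> modes M"
  shows "fold (\<lambda>b. lift M b (A b)) bs x \<in> modes M"
  using assms
proof (induction bs rule: rev_induct)
  case (snoc b bs)
  then show ?case by (auto intro: lift_in)
qed simp

lemma rank_at_fold_lift_le:
  assumes P: "\<And>b. b \<in> set bs \<Longrightarrow> projector_on (modes b) (A b) \<and> b \<subseteq> {1..m}"
    and \<alpha>: "\<alpha> \<subseteq> {1..m}" "\<And>b. b \<in> set bs \<Longrightarrow> b \<subseteq> \<alpha> \<or> \<alpha> \<inter> b = {}"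
    and x: "x \<in> modes {1..m}" and rank: "rank_at N d m x \<alpha> \<le> r"
  shows "rank_at N d m (fold (\<lambda>b. lift {1..m} b (A b)) bs x) \<alpha> \<le> r"
  using P \<alpha>(2)
proof (induction bs rule: rev_induct)
  case (snoc b bs)
  then show ?case
    using fold_lift_in[of bs A "{1..m}" x] x \<alpha>(1) by (auto intro!: rank_at_lift_le)
qed (use rank in simp)

text \<open>The projection at \<open>\<alpha>\<close> establishes the bound. By the sorting, all
  later nodes lie inside \<open>\<alpha>\<close> or are disjoint from it, so the bound
  persists.\<close>

lemma rank_at_truncation_le:
  assumes U: "\<And>b. b \<in> set bs \<Longrightarrow> quasi_orthonormal {1..} (U b)"
      "\<And>b k. b \<in> set bs \<Longrightarrow> 1 \<le> k \<Longrightarrow> U b k \<in> modes b"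
    and bs: "\<And>b. b \<in> set bs \<Longrightarrow> b \<subseteq> {1..m}" "sorted_wrt (\<lambda>a b. b \<subseteq> a \<or> a \<inter> b = {}) bs"
    and x: "x \<in> modes {1..m}" and \<alpha>: "\<alpha> \<in> set bs"
  shows "rank_at N d m (fold (\<lambda>b. lift {1..m} b (frame_proj (r b) (U b))) bs x) \<alpha> \<le> r \<alpha>"
proof -
  obtain ys zs where bs_eq: "bs = ys @ \<alpha> # zs" using \<alpha> by (meson split_list)
  let ?P = "\<lambda>b. lift {1..m} b (frame_proj (r b) (U b))"
  have P: "projector_on (modes b) (frame_proj (r b) (U b)) \<and> b \<subseteq> {1..m}" if "b \<in> set bs" for b
    using that U bs(1) by (auto intro: projector_frame_proj)
  have "rank_at N d m (fold ?P zs (?P \<alpha> (fold ?P ys x))) \<alpha> \<le> r \<alpha>"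
    using bs(2) bs(1)[OF \<alpha>] P unfolding bs_eq
    by (intro rank_at_fold_lift_le rank_at_lift_frame_proj U lift_in)
      (auto simp: sorted_wrt_append bs_eq)
  then show ?thesis by (simp add: bs_eq)
qed

text \<open>
  At the root of a dimension tree, the two frames are the left and right singular vectors of one
  decomposition. This is why the truncation error counts only the child of smaller rank.
\<close>

lemma truncation_absorb:
  assumes U: "quasi_orthonormal K U" "\<And>k. k \<in> K \<Longrightarrow> U k \<in> modes \<alpha>" and \<alpha>: "\<alpha> \<subseteq> M"
    and U': "quasi_orthonormal K' U'" "\<And>k. k \<in> K' \<Longrightarrow> U' k \<in> modes \<alpha>'" and \<alpha>': "\<alpha>' \<subseteq> M"
    and "K \<subseteq> K'" and dis: "\<alpha> \<inter> \<alpha>' = {}"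
    and eq: "\<And>k. k \<in> K \<Longrightarrow> lift M \<alpha> (line_proj (U k)) v = lift M \<alpha>' (line_proj (U' k)) v"
  shows "lift M \<alpha>' (span_proj K' U') (lift M \<alpha> (span_proj K U) v) = lift M \<alpha> (span_proj K U) v"
proof -
  let ?P = "lift M \<alpha> (span_proj K U)" and ?P' = "lift M \<alpha>' (span_proj K' U')"
  have A: "projector_on (modes \<alpha>) (span_proj K U)" and A': "projector_on (modes \<alpha>') (span_proj K' U')"
    using U U' by (auto intro!: projector_span_proj_on)
  note P = projector_lift[OF A \<alpha>] and P' = projector_lift[OF A' \<alpha>']
  \<comment> \<open>By commutation, \<open>z\<close> is the difference of the two sides of the
    claim. As an image of \<open>?P\<close> it can be tested along the single vectors
    \<open>U k\<close>.\<close>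
  define z where "z = ?P (?P' v - v)"
  have line: "projector_on (modes \<alpha>) (line_proj (U k))" "projector_on (modes \<alpha>') (line_proj (U' k))"
    if "k \<in> K" for k
  proof -
    have "k \<in> K'" using that \<open>K \<subseteq> K'\<close> by auto
    moreover note quasi_orthonormal_cases[OF U(1) that] quasi_orthonormal_cases[OF U'(1) this]
    ultimately show "projector_on (modes \<alpha>) (line_proj (U k))" "projector_on (modes \<alpha>') (line_proj (U' k))"
      using U(2) U'(2) that by (auto intro!: projector_line_proj)
  qed
  have "z = 0"
  proof (rule lift_span_proj_eq_0[OF U \<alpha>])
    show "?P z = z" by (simp add: z_def projector_idem[OF P])
    fix k assume k: "k \<in> K"
    let ?Q = "lift M \<alpha> (line_proj (U k))" and ?Q' = "lift M \<alpha>' (line_proj (U' k))"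
    note L = line(1)[OF k] and L' = line(2)[OF k]
    have k': "k \<in> K'" using k \<open>K \<subseteq> K'\<close> by auto
    have QP: "?Q (?P y) = ?Q y" for y
      by (rule eq_by_slices[OF lift_in[OF L \<alpha>] lift_in[OF L \<alpha>] \<alpha>])
        (simp add: slice_lift[OF L \<alpha>] slice_lift[OF A \<alpha>] line_proj_def inner_span_proj[OF U(1) k])
    have PQ': "?P' (?Q' y) = ?Q' y" for y
    proof (rule eq_by_slices[OF lift_in[OF A' \<alpha>'] lift_in[OF L' \<alpha>'] \<alpha>'])
      fix \<kappa> assume \<kappa>: "\<kappa> \<in> idx (M - \<alpha>')"
      show "slice \<alpha>' \<kappa> (?P' (?Q' y)) = slice \<alpha>' \<kappa> (?Q' y)"
         unfolding slice_lift[OF A' \<alpha>' \<kappa>] slice_lift[OF L' \<alpha>' \<kappa>]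
        by (simp add: line_proj_def linear_scale[OF projector_linear[OF A']] span_proj_fixes[OF U'(1) k'])
    qed
    have "?Q z = ?Q (?P' v) - ?Q v"
      by (simp add: z_def QP projector_diff[OF projector_lift[OF L \<alpha>]])
    also have "?Q (?P' v) = ?P' (?Q v)" by (rule lift_commute[OF L A' \<alpha> \<alpha>' dis])
    \<comment> \<open>The component of \<open>v\<close> along \<open>U k\<close> is also its
      component along \<open>U' k\<close>, so it lies in the range of \<open>?P'\<close>.\<close>
    also have "?P' (?Q v) = ?Q v" unfolding eq[OF k] by (rule PQ')
    finally show "?Q z = 0" by simp
  qed
  then show ?thesis
    by (simp add: z_def projector_diff[OF P] lift_commute[OF A A' \<alpha> \<alpha>' dis])
qed

text \<open>Both sides are the k-th term of the decomposition, \<open>\<sigma> k\<close> times the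
  tensor product of \<open>U k\<close> and \<open>V k\<close>.\<close>

lemma svd_components_eq:
  assumes \<alpha>: "\<alpha> \<subseteq> {1..m}" and v: "v \<in> modes {1..m}" and svd: "mode_svd N d m v \<alpha> \<sigma> U V" and k: "1 \<le> k"
  shows "lift {1..m} \<alpha> (line_proj (U k)) v = lift {1..m} ({1..m} - \<alpha>) (line_proj (V k)) v"
proof (rule ell2_eqI)
  fix \<nu>
  let ?M = "{1..m}" let ?\<alpha>' = "?M - \<alpha>"
  have "U k = 0 \<or> inner (U k) (U k) = 1" "V k = 0 \<or> inner (V k) (V k) = 1"
    using svd_orthonormal_U[OF svd] svd_orthonormal_V[OF svd] k by (auto simp: quasi_orthonormal_def)
  then have L: "projector_on (modes \<alpha>) (line_proj (U k))" "projector_on (modes ?\<alpha>') (line_proj (V k))"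
    using svd_in_U[OF svd k] svd_in_V[OF svd k] by (auto intro!: projector_line_proj)
  show "entry (lift ?M \<alpha> (line_proj (U k)) v) \<nu> = entry (lift ?M ?\<alpha>' (line_proj (V k)) v) \<nu>"
  proof (cases "\<nu> \<in> idx ?M")
    case True
    let ?\<mu> = "restrict \<nu> \<alpha>" and ?\<kappa> = "restrict \<nu> ?\<alpha>'"
    have \<mu>: "?\<mu> \<in> idx \<alpha>" and \<kappa>: "?\<kappa> \<in> idx ?\<alpha>'" using \<alpha> by (auto intro!: restrict_idx[OF True])
    have "inner (U k) (slice \<alpha> \<nu> v) = inner (U k) (matricization N d m \<alpha> v (unit_ell2 ?\<kappa>))"
      by (simp add: mat_unit[OF refl \<alpha> v \<kappa>] slice_restrict[OF True])
    also have "\<dots> = \<sigma> k * entry (V k) ?\<kappa>"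
      by (subst svd_inner_left[OF svd k unit_in[OF \<kappa>]]) (simp add: inner_commute[of _ "unit_ell2 _"])
    finally have 1: "inner (U k) (slice \<alpha> \<nu> v) = \<sigma> k * entry (V k) ?\<kappa>" .
    have "slice ?\<alpha>' \<nu> v = slice ?\<alpha>' ?\<mu> v"
      using slice_restrict[OF True, of ?\<alpha>' v] by (simp add: compl_compl[OF refl \<alpha>])
    then have "inner (V k) (slice ?\<alpha>' \<nu> v) = entry (matricization N d m \<alpha> v (V k)) ?\<mu>"
      by (simp add: entry_mat[OF refl \<alpha> v svd_in_V[OF svd k] \<mu>] inner_commute)
    also have "\<dots> = \<sigma> k * entry (U k) ?\<mu>"
      by (simp add: svd_apply_right[OF svd k] entry_scaleR)
    finally show ?thesis
      using True 1 \<alpha> by (simp add: entry_lift[OF L(1)] entry_lift[OF L(2)] line_proj_def entry_scaleR)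
  qed (simp add: entry_lift[OF L(1)] entry_lift[OF L(2)] \<alpha>)
qed

end

section \<open>The Tucker projection\<close>

context tensor_modes
begin

lemma idx_empty: "idx {} = {\<lambda>_. undefined}"
  by (simp add: multi_idx_def)

context
  fixes x :: "nat set \<Rightarrow> 'n tensor"
begin

lemma tensor_prod_summable:
  assumes "finite B" "pairwise disjnt B" "\<And>\<beta>. \<beta> \<in> B \<Longrightarrow> x \<beta> \<in> modes \<beta>"
  shows "(\<lambda>\<nu>. (\<Prod>\<beta>\<in>B. entry (x \<beta>) (restrict \<nu> \<beta>))\<^sup>2) summable_on idx (\<Union>B)"
  using assms
proof (induction B rule: finite_induct)
  case (insert \<beta> B)
  have dis: "\<beta> \<inter> \<Union>B = {}"
    using insert.prems(1) insert.hyps(2) by (auto simp: pairwise_insert disjnt_iff)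
  define b where "b = ell2_of (idx (\<Union>B)) (\<lambda>\<nu>. \<Prod>\<gamma>\<in>B. entry (x \<gamma>) (restrict \<nu> \<gamma>))"
  have IH: "(\<lambda>\<nu>. (\<Prod>\<gamma>\<in>B. entry (x \<gamma>) (restrict \<nu> \<gamma>))\<^sup>2) summable_on idx (\<Union>B)"
    by (rule insert.IH) (use insert.prems in \<open>auto simp: pairwise_insert\<close>)
  then have b: "b \<in> modes (\<Union>B)" "\<And>\<zeta>. \<zeta> \<in> idx (\<Union>B) \<Longrightarrow> entry b \<zeta> = (\<Prod>\<gamma>\<in>B. entry (x \<gamma>) (restrict \<zeta> \<gamma>))"
    by (simp_all add: b_def entry_ell2_of)
  have "(\<lambda>\<zeta>. (entry (x \<beta>) (restrict \<zeta> \<beta>) * entry b (restrict \<zeta> (\<Union>B)))\<^sup>2) summable_on idx (\<beta> \<union> \<Union>B)"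
    by (rule tensor2_summable[OF dis b(1)])
  then have "(\<lambda>\<nu>. (\<Prod>\<gamma>\<in>insert \<beta> B. entry (x \<gamma>) (restrict \<nu> \<gamma>))\<^sup>2) summable_on idx (\<beta> \<union> \<Union>B)"
  proof (rule summable_on_cong[THEN iffD1, rotated])
    fix \<zeta> assume \<zeta>: "\<zeta> \<in> idx (\<beta> \<union> \<Union>B)"
    have "entry b (restrict \<zeta> (\<Union>B)) = (\<Prod>\<gamma>\<in>B. entry (x \<gamma>) (restrict (restrict \<zeta> (\<Union>B)) \<gamma>))"
      by (intro b(2) restrict_idx[OF \<zeta>]) auto
    also have "\<dots> = (\<Prod>\<gamma>\<in>B. entry (x \<gamma>) (restrict \<zeta> \<gamma>))"
      by (intro prod.cong refl arg_cong[of _ _ "entry _"]) (auto simp: Int_absorb1)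
    finally show "(entry (x \<beta>) (restrict \<zeta> \<beta>) * entry b (restrict \<zeta> (\<Union>B)))\<^sup>2 =
        (\<Prod>\<gamma>\<in>insert \<beta> B. entry (x \<gamma>) (restrict \<zeta> \<gamma>))\<^sup>2"
      using insert.hyps by simp
  qed
  then show ?case by (simp only: Union_insert)
qed (simp add: idx_empty)

lemma entry_tensor_prod:
  assumes "finite B" "pairwise disjnt B" "\<And>\<beta>. \<beta> \<in> B \<Longrightarrow> x \<beta> \<in> modes \<beta>"
  shows "entry (tensor_prod N d B x) \<nu> =
    (if \<nu> \<in> idx (\<Union>B) then \<Prod>\<beta>\<in>B. entry (x \<beta>) (restrict \<nu> \<beta>) else 0)"
  unfolding tensor_prod_def by (rule entry_ell2_of[OF tensor_prod_summable[OF assms]])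

lemma tensor_prod_in:
  assumes "finite B" "pairwise disjnt B" "\<And>\<beta>. \<beta> \<in> B \<Longrightarrow> x \<beta> \<in> modes \<beta>"
  shows "tensor_prod N d B x \<in> modes (\<Union>B)"
  unfolding tensor_prod_def by (rule ell2_of_in[OF tensor_prod_summable[OF assms]])

lemma tensor_prod_insert:
  assumes B: "finite B" "\<beta> \<notin> B" "pairwise disjnt (insert \<beta> B)"
    "\<And>\<gamma>. \<gamma> \<in> insert \<beta> B \<Longrightarrow> x \<gamma> \<in> modes \<gamma>"
  shows "tensor_prod N d (insert \<beta> B) x = tensor2 \<beta> (\<Union>B) (x \<beta>) (tensor_prod N d B x)"
proof (rule ell2_eqI)
  fix \<nu>
  have B': "pairwise disjnt B" "\<And>\<gamma>. \<gamma> \<in> B \<Longrightarrow> x \<gamma> \<in> modes \<gamma>" and dis: "\<beta> \<inter> \<Union>B = {}"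
    using B by (auto simp: pairwise_insert disjnt_iff)
  note in_B = tensor_prod_in[OF B(1) B']
  have *: "(\<Prod>\<gamma>\<in>B. entry (x \<gamma>) (restrict (restrict \<nu> (\<Union>B)) \<gamma>)) = (\<Prod>\<gamma>\<in>B. entry (x \<gamma>) (restrict \<nu> \<gamma>))"
    by (intro prod.cong refl arg_cong[of _ _ "entry _"]) (auto simp: Int_absorb1)
  have "finite (insert \<beta> B)" using B(1) by simp
  note all = entry_tensor_prod[OF this B(3,4), of \<nu>, unfolded Union_insert]
  show "entry (tensor_prod N d (insert \<beta> B) x) \<nu> = entry (tensor2 \<beta> (\<Union>B) (x \<beta>) (tensor_prod N d B x)) \<nu>"
  proof (cases "\<nu> \<in> idx (\<beta> \<union> \<Union>B)")
    case True
    then have "restrict \<nu> (\<Union>B) \<in> idx (\<Union>B)" by (rule restrict_idx) auto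
    with entry_tensor_prod[OF B(1) B'] have "entry (tensor_prod N d B x) (restrict \<nu> (\<Union>B)) =
        (\<Prod>\<gamma>\<in>B. entry (x \<gamma>) (restrict \<nu> \<gamma>))"
      by (simp only: * if_True)
    then show ?thesis
      using True B(1,2) all by (simp add: entry_tensor2[OF dis in_B])
  qed (simp only: entry_tensor2[OF dis in_B] all if_False)
qed

lemma tensor_prod_empty: "tensor_prod N d {} x = unit_ell2 (\<lambda>_. undefined)"
  by (rule ell2_eqI, subst entry_tensor_prod) (simp_all add: entry_unit idx_empty)

end

lemma inner_tensor_prod:
  assumes "finite B" "pairwise disjnt B"
    and "\<And>\<beta>. \<beta> \<in> B \<Longrightarrow> x \<beta> \<in> modes \<beta>" "\<And>\<beta>. \<beta> \<in> B \<Longrightarrow> y \<beta> \<in> modes \<beta>"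
  shows "inner (tensor_prod N d B x) (tensor_prod N d B y) = (\<Prod>\<beta>\<in>B. inner (x \<beta>) (y \<beta>))"
  using assms
proof (induction B rule: finite_induct)
  case empty
  show ?case by (simp add: tensor_prod_empty entry_unit)
next
  case (insert \<beta> B)
  have dis: "\<beta> \<inter> \<Union>B = {}"
    using insert.prems(1) insert.hyps(2) by (auto simp: pairwise_insert disjnt_iff)
  have B: "pairwise disjnt B" using insert.prems(1) by (simp add: pairwise_insert)
  have in_B: "tensor_prod N d B x \<in> modes (\<Union>B)" "tensor_prod N d B y \<in> modes (\<Union>B)"
    using insert by (auto intro!: tensor_prod_in[OF _ B])
  have "inner (tensor_prod N d (insert \<beta> B) x) (tensor_prod N d (insert \<beta> B) y) =
      inner (x \<beta>) (y \<beta>) * inner (tensor_prod N d B x) (tensor_prod N d B y)"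
    using insert
    by (subst (1 2) tensor_prod_insert)
      (auto simp: inner_tensor2[OF dis _ in_B])
  with insert B show ?case by simp
qed

lemma tensor_prod_cases:
  assumes B: "finite B" "pairwise disjnt B" "\<And>\<beta>. \<beta> \<in> B \<Longrightarrow> x \<beta> \<in> modes \<beta>"
    and x: "\<And>\<beta>. \<beta> \<in> B \<Longrightarrow> x \<beta> = 0 \<or> inner (x \<beta>) (x \<beta>) = 1"
  shows "tensor_prod N d B x = 0 \<or> inner (tensor_prod N d B x) (tensor_prod N d B x) = 1"
proof (cases "\<exists>\<beta>\<in>B. x \<beta> = 0")
  case True
  then have "(\<Prod>\<beta>\<in>B. inner (x \<beta>) (x \<beta>)) = 0"
    using B(1) by (intro prod_zero) auto
  then have "inner (tensor_prod N d B x) (tensor_prod N d B x) = 0"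
    by (simp only: inner_tensor_prod[OF B B(3)])
  then have "tensor_prod N d B x = 0" by (simp only: inner_eq_zero_iff)
  then show ?thesis ..
next
  case False
  then have "(\<Prod>\<beta>\<in>B. inner (x \<beta>) (x \<beta>)) = 1"
    using x by (intro prod.neutral) blast
  then have "inner (tensor_prod N d B x) (tensor_prod N d B x) = 1"
    by (simp only: inner_tensor_prod[OF B B(3)])
  then show ?thesis ..
qed

text \<open>Contracting with one frame after the other, each step uses that \<open>x\<close> is fixed in that mode.\<close>

lemma fixed_orthogonal_tensor_prods_eq_0:
  fixes U :: "nat set \<Rightarrow> nat \<Rightarrow> 'n tensor" and K :: "nat set \<Rightarrow> nat set"
  assumes "finite B" "pairwise disjnt B" "\<Union>B \<subseteq> M"
    and U: "\<And>\<beta>. \<beta> \<in> B \<Longrightarrow> quasi_orthonormal (K \<beta>) (U \<beta>)"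
      "\<And>\<beta> k. \<beta> \<in> B \<Longrightarrow> k \<in> K \<beta> \<Longrightarrow> U \<beta> k \<in> modes \<beta>"
    and x: "x \<in> modes M" "\<And>\<beta>. \<beta> \<in> B \<Longrightarrow> lift M \<beta> (span_proj (K \<beta>) (U \<beta>)) x = x"
    and comp: "\<And>k. k \<in> (\<Pi>\<^sub>E \<beta>\<in>B. K \<beta>) \<Longrightarrow>
      lift M (\<Union>B) (line_proj (tensor_prod N d B (\<lambda>\<beta>. U \<beta> (k \<beta>)))) x = 0"
  shows "x = 0"
  using assms(1-3) U x(2) comp
proof (induction B rule: finite_induct)
  case empty
  \<comment> \<open>\<open>?o\<close> is the only index over no modes, and the empty tensor product
    is its unit vector. Projecting onto it is the identity, so the hypothesis already says that
    \<open>x\<close> vanishes.\<close>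
  let ?o = "\<lambda>_ :: nat. undefined :: 'n list"
  have e: "unit_ell2 ?o \<in> modes {}" by (rule unit_in) (simp add: idx_empty)
  then have L: "projector_on (modes {}) (line_proj (unit_ell2 ?o))"
    by (rule projector_line_proj) (simp add: entry_unit)
  have 0: "lift M {} (line_proj (unit_ell2 ?o)) x = 0"
    using empty.prems(6)[of "\<lambda>_. undefined"] by (simp add: tensor_prod_empty)
  show ?case
  proof (rule eq_by_slices[OF x(1) subspace_0[OF subspace_ell2_on], of "{}"])
    fix \<kappa> assume \<kappa>: "\<kappa> \<in> idx (M - {})"
    have "line_proj (unit_ell2 ?o) (slice {} \<kappa> x) = 0"
      using slice_lift[OF L _ \<kappa>, of x] 0 by simp
    then have "entry (slice {} \<kappa> x) ?o *\<^sub>R unit_ell2 ?o = 0"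
      by (simp add: line_proj_def)
    then have *: "entry (slice {} \<kappa> x) ?o = 0"
      by (metis entry_scaleR entry_unit entry_zero mult.right_neutral)
    show "slice {} \<kappa> x = slice {} \<kappa> 0"
    proof (rule ell2_eqI)
      fix p show "entry (slice {} \<kappa> x) p = entry (slice {} \<kappa> 0) p"
        using * entry_outside[OF slice_in[of "{}" \<kappa> x], of p]
        by (cases "p = ?o") (simp_all add: idx_empty entry_zero)
    qed
  qed simp
next
  case (insert \<beta> B)
  have dis: "\<beta> \<inter> \<Union>B = {}"
    using insert.prems(1) insert.hyps(2) by (auto simp: pairwise_insert disjnt_iff)
  have B: "pairwise disjnt B" "\<Union>B \<subseteq> M" and \<beta>: "\<beta> \<subseteq> M"
    using insert.prems(1,2) by (auto simp: pairwise_insert)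
  have U\<beta>: "quasi_orthonormal (K \<beta>) (U \<beta>)" "\<And>k. k \<in> K \<beta> \<Longrightarrow> U \<beta> k \<in> modes \<beta>"
    using insert.prems(3,4) by auto
  have A: "projector_on (modes \<beta>) (span_proj (K \<beta>) (U \<beta>))"
    using U\<beta> by (auto intro: projector_span_proj_on)
  show ?case
  proof (rule insert.IH[OF B])
    fix k assume k: "k \<in> (\<Pi>\<^sub>E \<beta>\<in>B. K \<beta>)"
    let ?e = "tensor_prod N d B (\<lambda>\<beta>. U \<beta> (k \<beta>))"
    have Uk: "U \<gamma> (k \<gamma>) \<in> modes \<gamma>" if "\<gamma> \<in> B" for \<gamma>
      using that insert.prems(4)[of \<gamma> "k \<gamma>"] k by auto
    have e: "?e \<in> modes (\<Union>B)" by (rule tensor_prod_in[OF insert.hyps(1) B(1) Uk])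
    have "U \<gamma> (k \<gamma>) = 0 \<or> inner (U \<gamma> (k \<gamma>)) (U \<gamma> (k \<gamma>)) = 1" if "\<gamma> \<in> B" for \<gamma>
      using quasi_orthonormal_cases[OF insert.prems(3)[of \<gamma>], of "k \<gamma>"] that k by auto
    then have e1: "?e = 0 \<or> inner ?e ?e = 1"
      by (intro tensor_prod_cases insert.hyps(1) B(1) Uk)
    have Q: "projector_on (modes (\<Union>B)) (line_proj ?e)" by (rule projector_line_proj[OF e e1])
    show "lift M (\<Union>B) (line_proj ?e) x = 0"
    \<comment> \<open>The component along \<open>?e\<close> is still fixed by the projection in mode
      \<open>\<beta>\<close>. Its further components along each \<open>U \<beta> j\<close> are those
      of \<open>x\<close> along full products, which vanish by assumption.\<close>
    proof (rule lift_span_proj_eq_0[OF U\<beta> \<beta>])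
      show "lift M \<beta> (span_proj (K \<beta>) (U \<beta>)) (lift M (\<Union>B) (line_proj ?e) x) = lift M (\<Union>B) (line_proj ?e) x"
        using insert.prems(5)[of \<beta>] by (simp add: lift_commute[OF A Q \<beta> B(2) dis])
      fix j assume j: "j \<in> K \<beta>"
      let ?k = "k(\<beta> := j)"
      have U_j: "(\<lambda>\<gamma>. U \<gamma> (?k \<gamma>)) \<beta> = U \<beta> j" by simp
      have same: "tensor_prod N d B (\<lambda>\<gamma>. U \<gamma> (?k \<gamma>)) = ?e"
        unfolding tensor_prod_def using insert.hyps(2)
        by (intro arg_cong[of _ _ "ell2_of _"] ext prod.cong) auto
      have "lift M \<beta> (line_proj (U \<beta> j)) (lift M (\<Union>B) (line_proj ?e) x) =
          lift M (\<beta> \<union> \<Union>B) (line_proj (tensor2 \<beta> (\<Union>B) (U \<beta> j) ?e)) x"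
        using quasi_orthonormal_cases[OF U\<beta>(1) j]
        by (intro lift_line_proj_tensor2 U\<beta>(2) j e e1 \<beta> B(2) dis)
      also have "tensor2 \<beta> (\<Union>B) (U \<beta> j) ?e = tensor_prod N d (insert \<beta> B) (\<lambda>\<gamma>. U \<gamma> (?k \<gamma>))"
      proof -
        have "U \<gamma> (?k \<gamma>) \<in> modes \<gamma>" if "\<gamma> \<in> insert \<beta> B" for \<gamma>
          using that Uk U\<beta>(2)[OF j] insert.hyps(2) by (cases "\<gamma> = \<beta>") auto
        then show ?thesis
          by (subst tensor_prod_insert[OF insert.hyps insert.prems(1)]) (simp_all only: same U_j)
      qed
      also have "lift M (\<beta> \<union> \<Union>B) (line_proj \<dots>) x = 0"
        using insert.prems(6)[OF PiE_fun_upd[where x = \<beta>, OF j k]] by (simp only: Union_insert)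
      finally show "lift M \<beta> (line_proj (U \<beta> j)) (lift M (\<Union>B) (line_proj ?e) x) = 0" .
    qed
  qed (use insert.prems in auto)
qed

lemma quasi_orthonormal_tensor_prods:
  fixes U :: "nat set \<Rightarrow> nat \<Rightarrow> 'n tensor"
  assumes B: "finite B" "pairwise disjnt B"
    and U: "\<And>\<beta>. \<beta> \<in> B \<Longrightarrow> quasi_orthonormal (K \<beta>) (U \<beta>)"
      "\<And>\<beta> k. \<beta> \<in> B \<Longrightarrow> k \<in> K \<beta> \<Longrightarrow> U \<beta> k \<in> modes \<beta>"
  shows "quasi_orthonormal (\<Pi>\<^sub>E \<beta>\<in>B. K \<beta>) (\<lambda>k. tensor_prod N d B (\<lambda>\<beta>. U \<beta> (k \<beta>)))"
  unfolding quasi_orthonormal_def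
proof (intro ballI)
  fix j k assume j: "j \<in> (\<Pi>\<^sub>E \<beta>\<in>B. K \<beta>)" and k: "k \<in> (\<Pi>\<^sub>E \<beta>\<in>B. K \<beta>)"
  let ?e = "\<lambda>k. tensor_prod N d B (\<lambda>\<beta>. U \<beta> (k \<beta>))"
  have inner_e: "inner (?e j) (?e k) = (\<Prod>\<beta>\<in>B. inner (U \<beta> (j \<beta>)) (U \<beta> (k \<beta>)))"
    using j k by (intro inner_tensor_prod B U(2)) auto
  show "inner (?e j) (?e k) = (if j = k \<and> ?e j \<noteq> 0 then 1 else 0)"
  proof (cases "j = k")
    case True
    have "U \<beta> (k \<beta>) = 0 \<or> inner (U \<beta> (k \<beta>)) (U \<beta> (k \<beta>)) = 1" if "\<beta> \<in> B" for \<beta>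
      using quasi_orthonormal_cases[OF U(1)[OF that], of "k \<beta>"] that k by auto
    then have "?e k = 0 \<or> inner (?e k) (?e k) = 1"
      using k by (intro tensor_prod_cases B U(2)) auto
    then show ?thesis using True by auto
  next
    case False
    then obtain \<beta> where \<beta>: "\<beta> \<in> B" "j \<beta> \<noteq> k \<beta>" using j k by (meson PiE_ext)
    then have "inner (U \<beta> (j \<beta>)) (U \<beta> (k \<beta>)) = 0"
      using U(1)[OF \<beta>(1)] PiE_mem[OF j \<beta>(1)] PiE_mem[OF k \<beta>(1)] by (auto simp: quasi_orthonormal_def)
    then show ?thesis using False \<beta>(1) B(1) unfolding inner_e by auto
  qed
qed

text \<open>The difference of the two sides is fixed by every mode projection and orthogonal to
  every product of frame vectors, hence zero.\<close>

lemma tensor_prods_projection_eq_fold: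
  fixes U :: "nat set \<Rightarrow> nat \<Rightarrow> 'n tensor" and K :: "nat set \<Rightarrow> nat set"
  assumes bs: "distinct bs" "pairwise disjnt (set bs)" "\<Union>(set bs) = M"
    and U: "\<And>\<beta>. \<beta> \<in> set bs \<Longrightarrow> quasi_orthonormal (K \<beta>) (U \<beta>)"
      "\<And>\<beta> k. \<beta> \<in> set bs \<Longrightarrow> k \<in> K \<beta> \<Longrightarrow> U \<beta> k \<in> modes \<beta>"
    and v: "v \<in> modes M"
  shows "span_proj (\<Pi>\<^sub>E \<beta>\<in>set bs. K \<beta>) (\<lambda>k. tensor_prod N d (set bs) (\<lambda>\<beta>. U \<beta> (k \<beta>))) v =
    fold (\<lambda>\<beta>. lift M \<beta> (span_proj (K \<beta>) (U \<beta>))) bs v"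
proof -
  let ?B = "set bs" and ?KK = "\<Pi>\<^sub>E \<beta>\<in>set bs. K \<beta>"
  let ?e = "\<lambda>k. tensor_prod N d ?B (\<lambda>\<beta>. U \<beta> (k \<beta>))"
  let ?P = "\<lambda>\<beta>. lift M \<beta> (span_proj (K \<beta>) (U \<beta>))"
  define w where "w = span_proj ?KK ?e v"
  define w' where "w' = fold ?P bs v"
  have sub: "\<beta> \<subseteq> M" if "\<beta> \<in> ?B" for \<beta> using that bs(3) by auto
  have A: "projector_on (modes \<beta>) (span_proj (K \<beta>) (U \<beta>))" if "\<beta> \<in> ?B" for \<beta>
    using U that by (auto intro: projector_span_proj_on)
  note P = projector_lift[OF A sub]
  have Uk: "U \<beta> (k \<beta>) \<in> modes \<beta>" if "k \<in> ?KK" "\<beta> \<in> ?B" for k \<beta>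
    using that by (auto intro!: U(2))
  have e: "quasi_orthonormal ?KK ?e" by (intro quasi_orthonormal_tensor_prods bs U) auto
  have e_in: "?e k \<in> modes M" if "k \<in> ?KK" for k
    using tensor_prod_in[of ?B "\<lambda>\<beta>. U \<beta> (k \<beta>)"] bs Uk[OF that] by simp
  \<comment> \<open>In mode \<open>\<beta>\<close> the product consists of multiples of one frame
    vector, which the projection fixes.\<close>
  have P_e: "?P \<beta> (?e k) = ?e k" if k: "k \<in> ?KK" and \<beta>: "\<beta> \<in> ?B" for k \<beta>
  proof (rule eq_by_slices[OF lift_in[OF A[OF \<beta>] sub[OF \<beta>]] e_in[OF k] sub[OF \<beta>]])
    fix \<kappa> assume \<kappa>: "\<kappa> \<in> idx (M - \<beta>)"
    let ?B' = "?B - {\<beta>}"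
    have B: "insert \<beta> ?B' = ?B" "finite ?B'" "\<beta> \<notin> ?B'" using \<beta> by auto
    have pw: "pairwise disjnt ?B'" using bs(2) by (rule pairwise_subset) auto
    have dis: "\<Union>?B' \<inter> \<beta> = {}" using bs(2) \<beta> by (auto simp: pairwise_def disjnt_iff)
    have M_eq: "M - \<beta> = \<Union>?B'" using bs(3) dis \<beta> by auto
    let ?b = "tensor_prod N d ?B' (\<lambda>\<gamma>. U \<gamma> (k \<gamma>))"
    have b: "?b \<in> modes (\<Union>?B')" using Uk[OF k] by (intro tensor_prod_in B pw) auto
    have "?e k = tensor2 \<beta> (\<Union>?B') (U \<beta> (k \<beta>)) ?b"
      using tensor_prod_insert[of ?B' \<beta> "\<lambda>\<gamma>. U \<gamma> (k \<gamma>)"] B bs(2) Uk[OF k] by (simp add: insert_absorb \<beta>)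
    also have "\<dots> = tensor2 (\<Union>?B') \<beta> ?b (U \<beta> (k \<beta>))"
      using dis b by (intro tensor2_commute Uk k \<beta>) auto
    finally have "slice \<beta> \<kappa> (?e k) = entry ?b \<kappa> *\<^sub>R U \<beta> (k \<beta>)"
      using slice_tensor2[OF dis Uk[OF k \<beta>]] \<kappa> by (simp add: M_eq)
    moreover have "span_proj (K \<beta>) (U \<beta>) (U \<beta> (k \<beta>)) = U \<beta> (k \<beta>)"
      using k \<beta> by (intro span_proj_fixes U) auto
    ultimately show "slice \<beta> \<kappa> (?P \<beta> (?e k)) = slice \<beta> \<kappa> (?e k)"
      by (simp add: slice_lift[OF A[OF \<beta>] sub[OF \<beta>] \<kappa>] linear_scale[OF projector_linear[OF A[OF \<beta>]]])
  qed
  have P_w: "?P \<beta> w = w" if \<beta>: "\<beta> \<in> ?B" for \<beta>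
  proof -
    have "((\<lambda>k. ?P \<beta> (inner (?e k) v *\<^sub>R ?e k)) has_sum ?P \<beta> w) ?KK"
      unfolding w_def by (rule has_sum_bounded_linear[OF projector_bounded[OF P[OF \<beta> \<beta>]] has_sum_span_proj[OF e]])
    then have "((\<lambda>k. inner (?e k) v *\<^sub>R ?e k) has_sum ?P \<beta> w) ?KK"
      by (rule has_sum_cong[THEN iffD1, rotated])
        (simp add: linear_scale[OF projector_linear[OF P[OF \<beta> \<beta>]]] P_e[OF _ \<beta>])
    moreover have "((\<lambda>k. inner (?e k) v *\<^sub>R ?e k) has_sum w) ?KK"
      unfolding w_def by (rule has_sum_span_proj[OF e])
    ultimately show ?thesis by (rule has_sum_unique)
  qed
  have P_fold: "?P \<beta> (fold ?P cs v) = fold ?P cs v" if "\<beta> \<in> set cs" "set cs \<subseteq> ?B" for \<beta> cs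
    using that
  proof (induction cs rule: rev_induct)
    case (snoc c cs)
    show ?case
    proof (cases "\<beta> = c")
      case True
      then show ?thesis using snoc.prems projector_idem[OF P[of c]] by simp
    next
      case False
      then have "\<beta> \<inter> c = {}"
        using bs(2) snoc.prems by (auto simp: pairwise_def disjnt_def)
      moreover have "\<beta> \<in> ?B" "c \<in> ?B" using snoc.prems by auto
      ultimately have "?P \<beta> (?P c (fold ?P cs v)) = ?P c (?P \<beta> (fold ?P cs v))"
        by (intro lift_commute A sub)
      with snoc False show ?thesis by simp
    qed
  qed simp
  \<comment> \<open>Self-adjointness moves each projection over to the product, where it acts
    trivially.\<close>
  have inner_fold: "inner (?e k) (fold ?P cs v) = inner (?e k) v" if "k \<in> ?KK" "set cs \<subseteq> ?B" for k cs
    using that(2)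
  proof (induction cs rule: rev_induct)
    case (snoc c cs)
    have c: "c \<in> ?B" using snoc.prems by simp
    have "inner (?e k) (?P c (fold ?P cs v)) = inner (?P c (?e k)) (fold ?P cs v)"
      by (simp add: projector_adjoint[OF P[OF c c]])
    with snoc show ?case by (simp add: P_e[OF that(1) c])
  qed simp
  have w_in: "w \<in> modes M" unfolding w_def by (rule span_proj_in[OF e e_in])
  have w'_in: "w' \<in> modes M" unfolding w'_def by (rule fold_lift_in) (auto simp: A sub v)
  have "w' - w = 0"
  proof (rule fixed_orthogonal_tensor_prods_eq_0[of ?B M K U])
    show "w' - w \<in> modes M" by (rule subspace_diff[OF subspace_ell2_on w'_in w_in])
    show "?P \<beta> (w' - w) = w' - w" if "\<beta> \<in> ?B" for \<beta>
      using that P_fold[of \<beta> bs] by (simp add: projector_diff[OF P[OF that that]] P_w w'_def)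
    fix k assume k: "k \<in> ?KK"
    have L: "projector_on (modes M) (line_proj (?e k))"
      by (rule projector_line_proj[OF e_in[OF k] quasi_orthonormal_cases[OF e k]])
    have "inner (?e k) (w' - w) = 0"
      using inner_fold[OF k, of bs] inner_span_proj[OF e k, of v]
      by (simp add: inner_diff_right w_def w'_def)
    then show "lift M (\<Union>?B) (line_proj (?e k)) (w' - w) = 0"
      unfolding bs(3) using lift_full[OF L subspace_diff[OF subspace_ell2_on w'_in w_in]]
      by (simp add: line_proj_def)
  qed (use bs U in auto)
  then show ?thesis by (simp add: w_def w'_def)
qed

end

section \<open>Dimension trees\<close>

lemma sorted_wrt_distinctI:
  "distinct xs \<Longrightarrow> (\<And>x y. x \<in> set xs \<Longrightarrow> y \<in> set xs \<Longrightarrow> x \<noteq> y \<Longrightarrow> R x y) \<Longrightarrow> sorted_wrt R xs"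
  by (induction xs) auto

context
  fixes m :: nat and D :: "nat set set" and M :: "nat set"
  assumes tree: "dimension_tree m D" and M: "M = {1..m}"
begin

private abbreviation "level \<equiv> tree_level D m"

lemma tree_subset: "\<alpha> \<in> D \<Longrightarrow> \<alpha> \<subseteq> M"
  and tree_nonempty: "\<alpha> \<in> D \<Longrightarrow> \<alpha> \<noteq> {}"
  and tree_root: "M \<in> D"
  and tree_leaf: "i \<in> M \<Longrightarrow> {i} \<in> D"
  and tree_splits: "\<alpha> \<in> D \<Longrightarrow> is_singleton \<alpha> \<or> (\<exists>!(\<beta>, \<beta>'). splits D \<alpha> \<beta> \<beta>')"
  and tree_reachable: "\<alpha> \<in> D \<Longrightarrow> \<exists>l. \<alpha> \<in> level l"
  using tree unfolding dimension_tree_def M[symmetric] by blast+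

lemma tree_node_finite: "\<alpha> \<in> D \<Longrightarrow> finite \<alpha>"
  using tree_subset[of \<alpha>] finite_subset[of \<alpha> M] by (simp add: M)

lemma tree_finite: "finite D"
proof (rule finite_subset)
  show "D \<subseteq> Pow M" using tree_subset by blast
qed (simp add: M)

lemma splits_psubset:
  assumes "splits D \<alpha> \<beta> \<beta>'"
  shows "\<beta> \<subset> \<alpha>" "\<beta>' \<subset> \<alpha>"
  using assms tree_nonempty[of \<beta>] tree_nonempty[of \<beta>'] unfolding splits_def by blast+

text \<open>A singleton cannot split, because both children would be nonempty proper subsets. The
  uniqueness alternative of \<open>dimension_tree\<close> therefore applies.\<close>

lemma splits_unique:
  assumes "\<alpha> \<in> D" "splits D \<alpha> \<beta> \<beta>'" "splits D \<alpha> \<gamma> \<gamma>'"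
  shows "\<gamma> = \<beta>" "\<gamma>' = \<beta>'"
proof -
  have "\<not> is_singleton \<alpha>"
  proof
    assume "is_singleton \<alpha>"
    then obtain a where "\<alpha> = {a}" by (auto simp: is_singleton_def)
    then have "\<beta> = {}" using splits_psubset(1)[OF assms(2)] by blast
    then show False using tree_nonempty[of \<beta>] assms(2) by (simp add: splits_def)
  qed
  then have "\<exists>!p. case p of (\<beta>, \<beta>') \<Rightarrow> splits D \<alpha> \<beta> \<beta>'"
    using tree_splits[OF assms(1)] by blast
  then have "(\<gamma>, \<gamma>') = (\<beta>, \<beta>')" using assms(2,3) by auto
  then show "\<gamma> = \<beta>" "\<gamma>' = \<beta>'" by simp_all
qed

section \<open>Levels of the tree\<close>

lemma level_subset: "level l \<subseteq> D"
  by (induction l) (auto simp: M[symmetric] tree_root splits_def)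

lemma root_level: "M \<in> level 0"
  by (simp add: M)

lemma level_disjoint:
  "\<alpha> \<in> level l \<Longrightarrow> \<beta> \<in> level l \<Longrightarrow> \<alpha> \<noteq> \<beta> \<Longrightarrow> \<alpha> \<inter> \<beta> = {}"
proof (induction l arbitrary: \<alpha> \<beta>)
  case (Suc l)
  then obtain \<alpha>0 \<beta>0 \<alpha>' \<beta>' where \<alpha>0: "\<alpha>0 \<in> level l" "splits D \<alpha>0 \<alpha> \<alpha>' \<or> splits D \<alpha>0 \<alpha>' \<alpha>"
    and \<beta>0: "\<beta>0 \<in> level l" "splits D \<beta>0 \<beta> \<beta>' \<or> splits D \<beta>0 \<beta>' \<beta>"
    by auto
  show ?case
  proof (cases "\<alpha>0 = \<beta>0")
    case True
    have "\<alpha>0 \<in> D" using \<alpha>0(1) level_subset by blast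
    then have "\<beta> = \<alpha>'"
      using \<alpha>0(2) \<beta>0(2) Suc.prems(3) splits_unique unfolding True by metis
    then show ?thesis using \<alpha>0(2) by (auto simp: splits_def)
  next
    case False
    then have "\<alpha>0 \<inter> \<beta>0 = {}" using Suc.IH \<alpha>0(1) \<beta>0(1) by blast
    moreover have "\<alpha> \<subseteq> \<alpha>0" "\<beta> \<subseteq> \<beta>0" using \<alpha>0(2) \<beta>0(2) splits_psubset by blast+
    ultimately show ?thesis by blast
  qed
qed simp

lemma level_Suc_parent:
  assumes "\<beta> \<in> level (Suc l)"
  obtains \<alpha> where "\<alpha> \<in> level l" "\<beta> \<subset> \<alpha>"
  using assms splits_psubset by (auto simp del: psubset_eq)

lemma level_ancestor:
  assumes "l \<le> l'" "\<beta> \<in> level l'"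
  shows "\<exists>\<alpha>\<in>level l. \<beta> \<subseteq> \<alpha> \<and> (l < l' \<longrightarrow> \<beta> \<subset> \<alpha>)"
  using assms
proof (induction arbitrary: \<beta> rule: dec_induct)
  case (step n)
  obtain \<gamma> where \<gamma>: "\<gamma> \<in> level n" "\<beta> \<subset> \<gamma>" using level_Suc_parent[OF step.prems] .
  obtain \<alpha> where \<alpha>: "\<alpha> \<in> level l" "\<gamma> \<subseteq> \<alpha>" using step.IH[OF \<gamma>(1)] by blast
  have "\<beta> \<subset> \<alpha>" by (rule psubset_subset_trans[OF \<gamma>(2) \<alpha>(2)])
  then show ?case using \<alpha>(1) by (intro bexI[of _ \<alpha>] conjI impI) (rule psubset_imp_subset)
next
  case base
  then show ?case by (intro bexI[of _ \<beta>] conjI impI) simp_all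
qed

text \<open>This is the relation under which \<open>rank_at_lift_le\<close> allows an operator to be
  applied later.\<close>

lemma level_laminar:
  assumes "\<alpha> \<in> level l" "\<beta> \<in> level l'" "l \<le> l'"
  shows "\<beta> \<subseteq> \<alpha> \<or> \<alpha> \<inter> \<beta> = {}"
proof -
  obtain \<gamma> where "\<gamma> \<in> level l" "\<beta> \<subseteq> \<gamma>" using level_ancestor[OF assms(3,2)] by blast
  then show ?thesis using level_disjoint[OF assms(1), of \<gamma>] by blast
qed

lemma level_unique:
  assumes "\<alpha> \<in> level l" "\<alpha> \<in> level l'"
  shows "l = l'"
proof -
  have False if i: "\<alpha> \<in> level i" and j: "\<alpha> \<in> level j" and ij: "i < j" for i j
  proof -
    obtain \<gamma> where \<gamma>: "\<gamma> \<in> level i" "\<alpha> \<subset> \<gamma>"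
      using level_ancestor[OF less_imp_le[OF ij] j] ij by blast
    have "\<alpha> \<noteq> {}" using tree_nonempty level_subset i by blast
    then show False using level_disjoint[OF i \<gamma>(1)] \<gamma>(2) by blast
  qed
  then show ?thesis using assms by (cases l l' rule: linorder_cases) auto
qed

text \<open>Every step down loses at least one mode. This makes the set of nonempty levels finite,
  so that \<open>Max\<close> in \<open>tree_depth\<close> is meaningful.\<close>

lemma card_level: "\<beta> \<in> level l \<Longrightarrow> card \<beta> + l \<le> m"
proof (induction l arbitrary: \<beta>)
  case (Suc l)
  obtain \<alpha> where \<alpha>: "\<alpha> \<in> level l" "\<beta> \<subset> \<alpha>" using level_Suc_parent[OF Suc.prems] .
  then have "card \<beta> < card \<alpha>" using level_subset tree_node_finite by (meson psubset_card_mono subsetD)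
  then show ?case using Suc.IH[OF \<alpha>(1)] by simp
qed simp

lemma level_le_depth: "\<beta> \<in> level l \<Longrightarrow> l \<le> tree_depth D m"
proof -
  assume \<beta>: "\<beta> \<in> level l"
  have "{l. level l \<noteq> {}} \<subseteq> {..m}" using card_level by fastforce
  then have "finite {l. level l \<noteq> {}}" by (rule finite_subset) simp
  then show ?thesis unfolding tree_depth_def using \<beta> by (intro Max_ge) auto
qed

text \<open>A binary tree has at most twice as many nodes as leaves, minus one; the leaves below
  \<open>\<alpha>\<close> correspond to its modes.\<close>

lemma card_below: "\<alpha> \<in> D \<Longrightarrow> card {\<beta>\<in>D. \<beta> \<subseteq> \<alpha>} + 1 \<le> 2 * card \<alpha>"
proof (induction "card \<alpha>" arbitrary: \<alpha> rule: less_induct)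
  case less
  have fin: "finite {\<beta>\<in>D. \<beta> \<subseteq> \<gamma>}" for \<gamma> using tree_finite by simp
  show ?case
  proof (cases "is_singleton \<alpha>")
    case True
    then have "{\<beta>\<in>D. \<beta> \<subseteq> \<alpha>} \<subseteq> {\<alpha>}" using tree_nonempty by (auto simp: is_singleton_def)
    then have "card {\<beta>\<in>D. \<beta> \<subseteq> \<alpha>} \<le> 1" using card_mono[of "{\<alpha>}" "{\<beta>\<in>D. \<beta> \<subseteq> \<alpha>}"] by simp
    moreover have "card \<alpha> = 1" using True by (simp add: is_singleton_altdef)
    ultimately show ?thesis by simp
  next
    case False
    then obtain c1 c2 where c: "splits D \<alpha> c1 c2" using tree_splits[OF less.prems] by auto
    note psub = splits_psubset[OF c]
    have fin\<alpha>: "finite \<alpha>" by (rule tree_node_finite[OF less.prems])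
    have cD: "c1 \<in> D" "c2 \<in> D" "\<alpha> = c1 \<union> c2" "c1 \<inter> c2 = {}" using c by (auto simp: splits_def)
    have card_sum: "card \<alpha> = card c1 + card c2"
      using cD tree_node_finite by (simp add: card_Un_disjoint)
    have card_c: "card {\<beta>\<in>D. \<beta> \<subseteq> c1} + 1 \<le> 2 * card c1" "card {\<beta>\<in>D. \<beta> \<subseteq> c2} + 1 \<le> 2 * card c2"
      using psub fin\<alpha> cD by (auto intro!: less.hyps psubset_card_mono)
    have "{\<beta>\<in>D. \<beta> \<subseteq> \<alpha>} \<subseteq> insert \<alpha> ({\<beta>\<in>D. \<beta> \<subseteq> c1} \<union> {\<beta>\<in>D. \<beta> \<subseteq> c2})"
    proof
      fix \<beta> assume \<beta>: "\<beta> \<in> {\<beta>\<in>D. \<beta> \<subseteq> \<alpha>}"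
      obtain l where l: "\<alpha> \<in> level l" using tree_reachable[OF less.prems] by blast
      obtain l' where l': "\<beta> \<in> level l'" using tree_reachable \<beta> by blast
      have ne: "\<beta> \<noteq> {}" using \<beta> tree_nonempty by blast
      \<comment> \<open>By laminarity \<open>\<beta>\<close> lies on a deeper level than
        \<open>\<alpha>\<close>. Its ancestor on the level after \<open>\<alpha>\<close> has a
        parent that meets \<open>\<alpha>\<close>, hence equals it, so this ancestor is a child of
        \<open>\<alpha>\<close>.\<close>
      have "\<beta> \<subseteq> c1 \<or> \<beta> \<subseteq> c2" if "\<beta> \<noteq> \<alpha>"
      proof -
        have "l < l'"
        proof (rule ccontr)
          assume "\<not> l < l'"
          then have "\<alpha> \<subseteq> \<beta> \<or> \<beta> \<inter> \<alpha> = {}" using level_laminar[OF l' l] by simp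
          then show False using \<beta> ne that by blast
        qed
        then have "Suc l \<le> l'" by simp
        then obtain \<gamma> where \<gamma>: "\<gamma> \<in> level (Suc l)" "\<beta> \<subseteq> \<gamma>" using level_ancestor[OF _ l', of "Suc l"] by blast
        then obtain \<delta> \<gamma>' where \<delta>: "\<delta> \<in> level l" "splits D \<delta> \<gamma> \<gamma>' \<or> splits D \<delta> \<gamma>' \<gamma>" by auto
        have "\<beta> \<subseteq> \<delta>" using \<gamma>(2) \<delta>(2) splits_psubset by blast
        then have "\<delta> = \<alpha>" using level_disjoint[OF \<delta>(1) l] \<beta> ne by blast
        then have "\<gamma> = c1 \<or> \<gamma> = c2" using \<delta>(2) splits_unique[OF less.prems c] by metis
        then show ?thesis using \<gamma>(2) by blast
      qed
      then show "\<beta> \<in> insert \<alpha> ({\<beta>\<in>D. \<beta> \<subseteq> c1} \<union> {\<beta>\<in>D. \<beta> \<subseteq> c2})" using \<beta> by blast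
    qed
    then have le: "card {\<beta>\<in>D. \<beta> \<subseteq> \<alpha>} \<le> card (insert \<alpha> ({\<beta>\<in>D. \<beta> \<subseteq> c1} \<union> {\<beta>\<in>D. \<beta> \<subseteq> c2}))"
      by (intro card_mono) (auto simp: fin)
    have "card (insert \<alpha> ({\<beta>\<in>D. \<beta> \<subseteq> c1} \<union> {\<beta>\<in>D. \<beta> \<subseteq> c2})) \<le>
        Suc (card ({\<beta>\<in>D. \<beta> \<subseteq> c1} \<union> {\<beta>\<in>D. \<beta> \<subseteq> c2}))"
      using fin by (simp add: card_insert_if)
    with le card_Un_le[of "{\<beta>\<in>D. \<beta> \<subseteq> c1}" "{\<beta>\<in>D. \<beta> \<subseteq> c2}"]
    have "card {\<beta>\<in>D. \<beta> \<subseteq> \<alpha>} \<le> Suc (card {\<beta>\<in>D. \<beta> \<subseteq> c1} + card {\<beta>\<in>D. \<beta> \<subseteq> c2})" by linarith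
    with card_sum card_c show ?thesis by linarith
  qed
qed

lemma card_tree: "card D + 1 \<le> 2 * m"
proof -
  have "{\<beta>\<in>D. \<beta> \<subseteq> M} = D" using tree_subset by blast
  then show ?thesis using card_below[OF tree_root] by (simp add: M)
qed

section \<open>Children of the root and enumeration from the root to the leaves\<close>

lemma root_children:
  assumes "2 \<le> m"
  shows "splits D M (child1 D M) (child2 D M)"
    and "level 1 = {child1 D M, child2 D M}"
proof -
  have "\<not> is_singleton M" using assms by (simp add: is_singleton_altdef M)
  then obtain c1 c2 where c: "splits D M c1 c2" using tree_splits[OF tree_root] by auto
  note uniq = splits_unique[OF tree_root c]
  have "child1 D M = c1" unfolding child1_def using c uniq by (intro the_equality) blast+
  moreover have "child2 D M = c2" unfolding child2_def using c uniq by (intro the_equality) blast+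
  ultimately show *: "splits D M (child1 D M) (child2 D M)" using c by simp
  show "level 1 = {child1 D M, child2 D M}"
  proof -
    have "level (Suc 0) = {\<beta>. \<exists>\<beta>'. splits D M \<beta> \<beta>' \<or> splits D M \<beta>' \<beta>}"
      by (simp add: M[symmetric])
    also have "\<dots> = {child1 D M, child2 D M}"
      using * splits_unique[OF tree_root *] by (intro equalityI subsetI) blast+
    finally show ?thesis by (simp only: One_nat_def)
  qed
qed

text \<open>The order within a level stays free, so that the child of the root with smaller rank can
  later be put first.\<close>

lemma tree_levels_list:
  assumes lst: "\<And>l. distinct (lst l) \<and> set (lst l) = level l"
  defines "bs \<equiv> concat (map lst [1..<Suc (tree_depth D m)])"
  shows "distinct bs" "set bs = D - {M}" "sorted_wrt (\<lambda>\<alpha> \<beta>. \<beta> \<subseteq> \<alpha> \<or> \<alpha> \<inter> \<beta> = {}) bs"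
proof -
  define Z where "Z n = concat (map lst [1..<Suc n])" for n
  have set_Z: "set (Z n) = (\<Union>l\<in>{1..n}. level l)" for n
  proof -
    have "set (Z n) = (\<Union>l\<in>{1..<Suc n}. level l)" using lst by (simp add: Z_def del: upt_Suc)
    then show ?thesis by (simp only: atLeastLessThanSuc_atLeastAtMost)
  qed
  have Z_Suc: "Z (Suc n) = Z n @ lst (Suc n)" for n by (simp add: Z_def)
  have "distinct (Z n) \<and> sorted_wrt (\<lambda>\<alpha> \<beta>. \<beta> \<subseteq> \<alpha> \<or> \<alpha> \<inter> \<beta> = {}) (Z n)" for n
  proof (induction n)
    case (Suc n)
    have "set (Z n) \<inter> set (lst (Suc n)) = {}"
    proof (intro equals0I, elim IntE)
      fix \<alpha> assume "\<alpha> \<in> set (Z n)" "\<alpha> \<in> set (lst (Suc n))"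
      then obtain l where l: "l \<le> n" "\<alpha> \<in> level l" "\<alpha> \<in> level (Suc n)"
        using lst unfolding set_Z by (auto simp del: tree_level.simps)
      then show False using level_unique[OF l(2,3)] by simp
    qed
    moreover have "\<beta> \<subseteq> \<alpha> \<or> \<alpha> \<inter> \<beta> = {}" if \<alpha>: "\<alpha> \<in> set (Z n)" and \<beta>: "\<beta> \<in> set (lst (Suc n))" for \<alpha> \<beta>
    proof -
      obtain l where l: "l \<le> n" "\<alpha> \<in> level l" using \<alpha> unfolding set_Z by auto
      have "\<beta> \<in> level (Suc n)" using \<beta> lst by blast
      then show ?thesis using level_laminar[OF l(2)] l(1) le_SucI by blast
    qed
    moreover have "sorted_wrt (\<lambda>\<alpha> \<beta>. \<beta> \<subseteq> \<alpha> \<or> \<alpha> \<inter> \<beta> = {}) (lst (Suc n))"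
      using lst level_disjoint by (intro sorted_wrt_distinctI) metis+
    ultimately show ?case using Suc lst unfolding Z_Suc by (simp add: sorted_wrt_append)
  qed (simp add: Z_def)
  then show "distinct bs" "sorted_wrt (\<lambda>\<alpha> \<beta>. \<beta> \<subseteq> \<alpha> \<or> \<alpha> \<inter> \<beta> = {}) bs"
    by (simp_all add: bs_def Z_def)
  show "set bs = D - {M}"
  proof -
    have set_bs: "set bs = (\<Union>l\<in>{1..tree_depth D m}. level l)"
      using set_Z[of "tree_depth D m"] by (simp only: bs_def Z_def)
    have "\<alpha> \<in> (\<Union>l\<in>{1..tree_depth D m}. level l)" if \<alpha>: "\<alpha> \<in> D" "\<alpha> \<noteq> M" for \<alpha>
    proof -
      obtain l where l: "\<alpha> \<in> level l" using tree_reachable[OF \<alpha>(1)] by blast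
      then have "l \<noteq> 0" using \<alpha>(2) by (intro notI) (simp add: M)
      then show ?thesis using l level_le_depth[OF l] by auto
    qed
    then have "D - {M} \<subseteq> set bs" unfolding set_bs by blast
    moreover have "\<alpha> \<in> D - {M}" if \<alpha>: "\<alpha> \<in> set bs" for \<alpha>
    proof -
      obtain l where l: "1 \<le> l" "\<alpha> \<in> level l" using \<alpha> unfolding set_bs by auto
      have "\<alpha> \<noteq> M" using level_unique[OF _ root_level, of l] l by auto
      then show ?thesis using level_subset l(2) by blast
    qed
    ultimately show ?thesis by blast
  qed
qed

lemma fold_levels_eq:
  assumes lst: "\<And>l. distinct (lst l) \<and> set (lst l) = level l"
    and comm: "\<And>\<alpha> \<beta> x. \<alpha> \<in> D - {M} \<Longrightarrow> \<beta> \<in> D - {M} \<Longrightarrow> \<alpha> \<inter> \<beta> = {} \<Longrightarrow> f \<alpha> (f \<beta> x) = f \<beta> (f \<alpha> x)"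
  shows "fold (\<lambda>l x. Finite_Set.fold f x (level l)) [1..<Suc n] x = fold f (concat (map lst [1..<Suc n])) x"
proof (induction n)
  case (Suc n)
  have sub: "\<alpha> \<in> D - {M}" if "\<alpha> \<in> level (Suc n)" for \<alpha>
    using that level_subset level_unique[OF _ root_level, of "Suc n"] by blast
  have "comp_fun_commute_on (level (Suc n)) f"
  proof
    fix \<alpha> \<beta> assume *: "\<alpha> \<in> level (Suc n)" "\<beta> \<in> level (Suc n)"
    show "f \<beta> \<circ> f \<alpha> = f \<alpha> \<circ> f \<beta>"
    proof (cases "\<alpha> = \<beta>")
      case False
      show ?thesis
        using comm[OF sub[OF *(1)] sub[OF *(2)] level_disjoint[OF * False]] by (simp add: fun_eq_iff)
    qed simp
  qed
  then have "Finite_Set.fold f y (level (Suc n)) = fold f (lst (Suc n)) y" for y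
    using comp_fun_commute_on.fold_set_fold_remdups[of "level (Suc n)" f "lst (Suc n)" y] lst[of "Suc n"]
    by (simp add: distinct_remdups_id)
  with Suc show ?case by simp
qed simp

end

section \<open>Truncation in the Tucker and hierarchical formats\<close>

text \<open>The index set inside \<open>trunc_bound\<close>, named because it is counted for
  \<open>kappa_P\<close> and matched with the projections left after absorption.\<close>

definition trunc_nodes :: "nat \<Rightarrow> tensor_format \<Rightarrow> (nat set \<Rightarrow> enat) \<Rightarrow> nat set set"
  where "trunc_nodes m F r = (case F of
        Tucker \<Rightarrow> nodes m F
      | Hierarchical D \<Rightarrow>
          if r (child1 D {1..m}) \<le> r (child2 D {1..m})
          then D - {{1..m}, child2 D {1..m}} else D - {{1..m}, child1 D {1..m}})"

lemma trunc_bound_eq: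
  "trunc_bound m F \<sigma> r = sqrt (\<Sum>\<alpha>\<in>trunc_nodes m F r. \<Sum>\<^sub>\<infinity>k\<in>{k. r \<alpha> < enat k}. \<bar>\<sigma> \<alpha> k\<bar>\<^sup>2)"
  by (simp add: trunc_bound_def trunc_nodes_def)

lemma trunc_nodes_subset: "trunc_nodes m F r \<subseteq> nodes m F"
  by (auto simp: trunc_nodes_def nodes_def split: tensor_format.splits)

lemma tucker_nodes: "nodes m Tucker = (\<lambda>i. {i}) ` {1..m}"
  by (auto simp: nodes_def)

lemma finite_nodes: "valid_format m F \<Longrightarrow> finite (nodes m F)"
  by (cases F) (auto simp: tucker_nodes nodes_def valid_format_def tree_finite[OF _ refl])

lemma nodes_subset: "valid_format m F \<Longrightarrow> \<alpha> \<in> nodes m F \<Longrightarrow> \<alpha> \<subseteq> {1..m}"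
  by (cases F) (auto simp: nodes_def valid_format_def dest: tree_subset[OF _ refl])

lemma nodes_nonempty:
  assumes "valid_format m F" "2 \<le> m"
  shows "nodes m F \<noteq> {}"
proof (cases F)
  case Tucker
  then show ?thesis using assms(2) by (auto simp: tucker_nodes)
next
  case (Hierarchical D)
  then have "{1} \<in> D" using tree_leaf[of m D "{1..m}" 1] assms by (auto simp: valid_format_def)
  moreover have "{1} \<noteq> {1..m}"
  proof
    assume "{1} = {1..m}"
    moreover have "2 \<in> {1..m}" using assms(2) by simp
    ultimately have "(2::nat) \<in> {1}" by simp
    then show False by simp
  qed
  ultimately show ?thesis by (auto simp: Hierarchical nodes_def)
qed

lemma max_rank_le_iff:
  assumes "valid_format m F" "2 \<le> m"
  shows "max_rank m F r \<le> n \<longleftrightarrow> (\<forall>\<alpha>\<in>nodes m F. r \<alpha> \<le> n)"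
  unfolding max_rank_def
  using finite_nodes[OF assms(1)] nodes_nonempty[OF assms] by (subst Max_le_iff) auto

text \<open>Origin of \<open>kappa_P\<close>: the Tucker format has \<open>m\<close> tails; a tree
  has at most \<open>2 * m - 1\<close> nodes, of which the root and one of its children drop
  out.\<close>

lemma card_trunc_nodes_le:
  assumes "valid_format m F" "2 \<le> m"
  shows "sqrt (real (card (trunc_nodes m F r))) \<le> kappa_P m F"
proof (cases F)
  case Tucker
  have "card ((\<lambda>i. {i}) ` {1..m}) = card {1..m}" by (rule card_image) simp
  then show ?thesis by (simp add: Tucker trunc_nodes_def tucker_nodes kappa_P_def)
next
  case (Hierarchical D)
  then have D: "dimension_tree m D" using assms(1) by (simp add: valid_format_def)
  let ?M = "{1..m}"
  have *: "card (D - {?M, c}) + 3 \<le> 2 * m" if "c \<in> D" "c \<noteq> ?M" for c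
  proof -
    have "card {?M, c} = 2" using that(2) by simp
    moreover have "card (D - {?M, c}) = card D - card {?M, c}"
      using that(1) tree_root[OF D refl] by (intro card_Diff_subset) auto
    moreover have "card {?M, c} \<le> card D"
      using that(1) tree_root[OF D refl] by (intro card_mono tree_finite[OF D refl]) auto
    ultimately show ?thesis using card_tree[OF D refl] by linarith
  qed
  have c: "child1 D ?M \<in> D" "child2 D ?M \<in> D" "child1 D ?M \<noteq> ?M" "child2 D ?M \<noteq> ?M"
    using root_children(1)[OF D refl assms(2)] splits_psubset[OF D refl root_children(1)[OF D refl assms(2)]]
    by (simp_all add: splits_def psubset_eq)
  have "card (trunc_nodes m F r) + 3 \<le> 2 * m"
    using *[OF c(1,3)] *[OF c(2,4)] by (auto simp: trunc_nodes_def Hierarchical)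
  then show ?thesis by (simp add: kappa_P_def Hierarchical)
qed

section \<open>The truncated tensor: representation, ranks and error\<close>

context tensor_modes
begin

context
  fixes m :: nat and F :: tensor_format and v :: "'n tensor"
    and \<sigma> :: "nat set \<Rightarrow> nat \<Rightarrow> real" and U :: "nat set \<Rightarrow> nat \<Rightarrow> 'n tensor"
  assumes F: "valid_format m F" and m: "2 \<le> m" and v: "v \<in> modes {1..m}"
    and sys: "singular_system N d m F v \<sigma> U"
begin

lemma node_svd: "\<alpha> \<in> nodes m F \<Longrightarrow> \<exists>V. mode_svd N d m v \<alpha> (\<sigma> \<alpha>) (U \<alpha>) V"
  using sys by (simp add: singular_system_def)

lemma frame_orthonormal: "\<alpha> \<in> nodes m F \<Longrightarrow> quasi_orthonormal {1..} (U \<alpha>)"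
  using node_svd svd_orthonormal_U by blast

lemma frame_in: "\<alpha> \<in> nodes m F \<Longrightarrow> 1 \<le> k \<Longrightarrow> U \<alpha> k \<in> modes \<alpha>"
  using node_svd svd_in_U by blast

lemma frame_upto:
  assumes "\<alpha> \<in> nodes m F"
  shows "quasi_orthonormal (upto_enat r) (U \<alpha>)" "k \<in> upto_enat r \<Longrightarrow> U \<alpha> k \<in> modes \<alpha>"
  using quasi_orthonormal_subset[OF frame_orthonormal[OF assms], of "upto_enat r"] frame_in[OF assms, of k]
  by (auto simp: upto_enat_def)

lemma node_projector: "\<alpha> \<in> nodes m F \<Longrightarrow> projector_on (modes \<alpha>) (frame_proj r (U \<alpha>))"
  by (intro projector_frame_proj frame_orthonormal frame_in)

lemma node_subset: "\<alpha> \<in> nodes m F \<Longrightarrow> \<alpha> \<subseteq> {1..m}"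
  by (rule nodes_subset[OF F])

lemma tucker_proj_fold:
  fixes r :: "nat set \<Rightarrow> enat"
  defines "P \<equiv> \<lambda>\<alpha>. lift {1..m} \<alpha> (frame_proj (r \<alpha>) (U \<alpha>))"
  assumes Tucker: "F = Tucker" and bs: "distinct bs" "set bs = nodes m F"
  shows "format_proj N d m F U r v = fold P bs v"
proof -
  have dis: "pairwise disjnt (set bs)"
    by (auto simp: bs(2) Tucker tucker_nodes pairwise_def disjnt_def)
  have un: "\<Union>(set bs) = {1..m}"
    by (auto simp: bs(2) Tucker tucker_nodes)
  have "format_proj N d m F U r v =
      span_proj (\<Pi>\<^sub>E \<beta>\<in>set bs. upto_enat (r \<beta>)) (\<lambda>k. tensor_prod N d (set bs) (\<lambda>\<beta>. U \<beta> (k \<beta>))) v"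
    by (simp add: format_proj_def Tucker span_proj_def inner_commute bs(2))
  also have "\<dots> = fold (\<lambda>\<beta>. lift {1..m} \<beta> (span_proj (upto_enat (r \<beta>)) (U \<beta>))) bs v"
    by (rule tensor_prods_projection_eq_fold[OF bs(1) dis un _ _ v]) (simp_all add: bs(2) frame_upto)
  finally show ?thesis by (simp add: P_def frame_proj_eq)
qed

text \<open>Here \<open>a\<close> is a child of the root of smaller rank and \<open>b\<close> its
  sibling. With \<open>a\<close> first and \<open>b\<close> second, the projection at
  \<open>b\<close> meets \<open>P a v\<close>, which it leaves unchanged.\<close>

lemma hierarchical_proj_fold:
  fixes r :: "nat set \<Rightarrow> enat"
  defines "P \<equiv> \<lambda>\<alpha>. lift {1..m} \<alpha> (frame_proj (r \<alpha>) (U \<alpha>))"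
  assumes H: "F = Hierarchical D"
  obtains a b ts where "format_proj N d m F U r v = fold P (a # b # ts) v"
    "distinct (a # b # ts)" "set (a # b # ts) = nodes m F" "trunc_nodes m F r = nodes m F - {b}"
    "sorted_wrt (\<lambda>\<alpha> \<beta>. \<beta> \<subseteq> \<alpha> \<or> \<alpha> \<inter> \<beta> = {}) (a # b # ts)"
    "P b (P a v) = P a v"
proof -
  let ?M = "{1..m}" and ?c1 = "child1 D {1..m}" and ?c2 = "child2 D {1..m}"
  have D: "dimension_tree m D" using F H by (simp add: valid_format_def)
  have nodes: "nodes m F = D - {?M}" by (simp add: nodes_def H)
  note splits = root_children(1)[OF D refl m]
  note level1 = root_children(2)[OF D refl m]
  have c: "?c1 \<in> nodes m F" "?c2 \<in> nodes m F" "?c1 \<inter> ?c2 = {}" "?M - ?c1 = ?c2" "?c1 \<noteq> ?c2"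
    using splits splits_psubset[OF D refl splits] tree_nonempty[OF D refl, of ?c1]
    unfolding nodes splits_def by blast+
  have svd1: "mode_svd N d m v ?c1 (\<sigma> ?c1) (U ?c1) (U ?c2)"
    using sys by (simp add: singular_system_def H)
  have comp: "lift ?M ?c1 (line_proj (U ?c1 k)) v = lift ?M ?c2 (line_proj (U ?c2 k)) v" if "1 \<le> k" for k
    using svd_components_eq[OF node_subset[OF c(1)] v svd1 that] by (simp add: c(4))
  define a b where "a = (if r ?c1 \<le> r ?c2 then ?c1 else ?c2)" and "b = (if r ?c1 \<le> r ?c2 then ?c2 else ?c1)"
  have ab: "a \<in> nodes m F" "b \<in> nodes m F" "a \<inter> b = {}" "{a, b} = {?c1, ?c2}" "a \<noteq> b" "r a \<le> r b"
    using c by (auto simp: a_def b_def)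
  have trunc: "trunc_nodes m F r = nodes m F - {b}"
    by (auto simp: trunc_nodes_def H nodes_def b_def)
  have absorb: "P b (P a v) = P a v"
    unfolding P_def frame_proj_eq
  proof (rule truncation_absorb)
    show "upto_enat (r a) \<subseteq> upto_enat (r b)"
      using ab(6) by (auto simp: upto_enat_def intro: order.trans)
    show "lift ?M a (line_proj (U a k)) v = lift ?M b (line_proj (U b k)) v" if "k \<in> upto_enat (r a)" for k
      using that comp[of k] by (auto simp: a_def b_def upto_enat_def)
  qed (use ab node_subset frame_upto in auto)
  define lst where "lst l = (if l = 1 then [a, b] else SOME xs. distinct xs \<and> set xs = tree_level D m l)" for l
  have lst: "distinct (lst l) \<and> set (lst l) = tree_level D m l" for l
  proof (cases "l = 1")
    case True
    then show ?thesis using ab(4,5) level1 by (simp add: lst_def)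
  next
    case False
    have "finite (tree_level D m l)"
      using level_subset[OF D refl] tree_finite[OF D refl] by (rule finite_subset)
    then have "\<exists>xs. distinct xs \<and> set xs = tree_level D m l"
      using finite_distinct_list by blast
    then show ?thesis unfolding lst_def using False by (simp only: if_False) (rule someI_ex)
  qed
  let ?L = "tree_depth D m"
  define bs where "bs = concat (map lst [1..<Suc ?L])"
  note bs_props = tree_levels_list[OF D refl lst, folded bs_def]
  have "?c1 \<in> tree_level D m 1" unfolding level1 by simp
  then have "1 \<le> ?L" by (rule level_le_depth[OF D refl])
  then have "[1..<Suc ?L] = 1 # [Suc 1..<Suc ?L]" by (intro upt_conv_Cons) simp
  then have bs_eq: "bs = a # b # concat (map lst [Suc 1..<Suc ?L])" by (simp add: bs_def lst_def)
  let ?f = "\<lambda>\<alpha>. apply_modes N d m \<alpha> (frame_proj (r \<alpha>) (U \<alpha>))"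
  have f_eq: "?f \<alpha> = P \<alpha>" if "\<alpha> \<in> nodes m F" for \<alpha>
    using apply_modes_eq_lift[OF node_subset[OF that]] by (simp add: P_def fun_eq_iff)
  have "format_proj N d m F U r v = fold (\<lambda>l x. Finite_Set.fold ?f x (tree_level D m l)) [1..<Suc ?L] v"
    by (simp add: format_proj_def H level_proj_def[abs_def] del: upt_Suc)
  also have "\<dots> = fold ?f bs v"
    unfolding bs_def
  proof (rule fold_levels_eq[OF D refl lst])
    fix \<alpha> \<beta> x assume "\<alpha> \<in> D - {?M}" "\<beta> \<in> D - {?M}" "\<alpha> \<inter> \<beta> = {}"
    then have *: "\<alpha> \<in> nodes m F" "\<beta> \<in> nodes m F" "\<alpha> \<inter> \<beta> = {}" by (simp_all add: nodes)
    then have "P \<alpha> (P \<beta> x) = P \<beta> (P \<alpha> x)"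
      unfolding P_def by (intro lift_commute node_projector node_subset)
    then show "?f \<alpha> (?f \<beta> x) = ?f \<beta> (?f \<alpha> x)"
      by (simp only: f_eq[OF *(1)] f_eq[OF *(2)])
  qed
  also have "\<dots> = fold P bs v"
    using bs_props(2) by (intro fold_cong refl f_eq) (simp add: nodes)
  finally have "format_proj N d m F U r v = fold P bs v" .
  then show ?thesis
    using bs_props trunc absorb by (intro that) (simp_all only: bs_eq nodes)
qed

text \<open>One projection in two forms: \<open>bs\<close> contains all nodes and yields the ranks,
  \<open>bs'\<close> omits the absorbed node and yields the error.\<close>

lemma format_proj_fold:
  fixes r :: "nat set \<Rightarrow> enat"
  defines "P \<equiv> \<lambda>\<alpha>. lift {1..m} \<alpha> (frame_proj (r \<alpha>) (U \<alpha>))"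
  obtains bs bs' where "format_proj N d m F U r v = fold P bs v" "set bs = nodes m F"
    "sorted_wrt (\<lambda>\<alpha> \<beta>. \<beta> \<subseteq> \<alpha> \<or> \<alpha> \<inter> \<beta> = {}) bs"
    "format_proj N d m F U r v = fold P bs' v" "distinct bs'" "set bs' = trunc_nodes m F r"
proof (cases F)
  case Tucker
  obtain bs where bs: "set bs = nodes m F" "distinct bs"
    using finite_distinct_list[OF finite_nodes[OF F]] by blast
  have "sorted_wrt (\<lambda>\<alpha> \<beta>. \<beta> \<subseteq> \<alpha> \<or> \<alpha> \<inter> \<beta> = {}) bs"
    by (rule sorted_wrt_distinctI[OF bs(2)]) (auto simp: bs(1) Tucker tucker_nodes)
  then show ?thesis
    using tucker_proj_fold[OF Tucker bs(2,1), of r] bs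
    by (intro that[of bs bs]) (simp_all add: P_def trunc_nodes_def Tucker)
next
  case (Hierarchical D)
  then show ?thesis
  proof (rule hierarchical_proj_fold[of D r])
    fix a b ts
    assume *: "format_proj N d m F U r v = fold (\<lambda>\<alpha>. lift {1..m} \<alpha> (frame_proj (r \<alpha>) (U \<alpha>))) (a # b # ts) v"
      "distinct (a # b # ts)" "set (a # b # ts) = nodes m F" "trunc_nodes m F r = nodes m F - {b}"
      "sorted_wrt (\<lambda>\<alpha> \<beta>. \<beta> \<subseteq> \<alpha> \<or> \<alpha> \<inter> \<beta> = {}) (a # b # ts)"
      "lift {1..m} b (frame_proj (r b) (U b)) (lift {1..m} a (frame_proj (r a) (U a)) v) =
        lift {1..m} a (frame_proj (r a) (U a)) v"
    have "set (a # ts) = trunc_nodes m F r"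
      unfolding *(4) *(3)[symmetric] using *(2) by auto
    moreover have "fold P (a # b # ts) v = fold P (a # ts) v"
      using *(6) by (simp add: P_def)
    ultimately show ?thesis using * by (intro that[of "a # b # ts" "a # ts"]) (simp_all add: P_def)
  qed
qed

lemma format_proj_properties:
  fixes r :: "nat set \<Rightarrow> enat"
  defines "w \<equiv> format_proj N d m F U r v"
  shows format_proj_in: "w \<in> modes {1..m}"
    and format_proj_rank: "\<alpha> \<in> nodes m F \<Longrightarrow> rank_at N d m w \<alpha> \<le> r \<alpha>"
    and format_proj_norm: "norm w \<le> norm v"
    and format_proj_zero: "(\<And>\<alpha>. \<alpha> \<in> nodes m F \<Longrightarrow> r \<alpha> = 0) \<Longrightarrow> w = 0"
    and format_proj_error: "norm (v - w) \<le> trunc_bound m F \<sigma> r"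
proof -
  let ?P = "\<lambda>\<alpha>. lift {1..m} \<alpha> (frame_proj (r \<alpha>) (U \<alpha>))"
  obtain bs bs' where bs: "w = fold ?P bs v" "set bs = nodes m F"
      "sorted_wrt (\<lambda>\<alpha> \<beta>. \<beta> \<subseteq> \<alpha> \<or> \<alpha> \<inter> \<beta> = {}) bs"
    and bs': "w = fold ?P bs' v" "distinct bs'" "set bs' = trunc_nodes m F r"
    unfolding w_def by (rule format_proj_fold)
  have P: "projector_on (modes {1..m}) (?P \<alpha>)" if "\<alpha> \<in> nodes m F" for \<alpha>
    using that by (intro projector_lift node_projector node_subset)
  show "w \<in> modes {1..m}"
    unfolding bs(1) by (rule fold_lift_in[OF _ v]) (simp add: bs(2) node_projector node_subset)
  show "rank_at N d m w \<alpha> \<le> r \<alpha>" if "\<alpha> \<in> nodes m F"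
    unfolding bs(1) using bs(2,3) that
    by (intro rank_at_truncation_le v) (auto simp: frame_orthonormal frame_in dest: node_subset)
  show "norm w \<le> norm v"
    unfolding bs(1) by (rule fold_projector_norm_le[OF P]) (simp add: bs(2))
  show "w = 0" if zero: "\<And>\<alpha>. \<alpha> \<in> nodes m F \<Longrightarrow> r \<alpha> = 0"
  proof -
    \<comment> \<open>The projection applied last is onto an empty frame, hence zero.\<close>
    obtain cs b where cs: "bs = cs @ [b]"
      using nodes_nonempty[OF F m] bs(2) by (metis rev_exhaust set_empty)
    then have b: "b \<in> nodes m F" using bs(2) by auto
    have "upto_enat 0 = {}" by (auto simp: upto_enat_def zero_enat_def)
    then have "frame_proj 0 (U b) = (\<lambda>x. 0)" by (simp add: frame_proj_def fun_eq_iff)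
    then have "?P b x = 0" for x
      using entry_lift[OF node_projector[OF b] node_subset[OF b], of "r b" x]
      by (intro ell2_eqI) (simp add: zero[OF b] entry_zero)
    then show ?thesis by (simp add: bs(1) cs)
  qed
  show "norm (v - w) \<le> trunc_bound m F \<sigma> r"
  proof -
    have "(norm (v - w))\<^sup>2 \<le> (\<Sum>\<alpha>\<in>trunc_nodes m F r. (norm (v - ?P \<alpha> v))\<^sup>2)"
      using fold_projector_error[of bs' "modes {1..m}" ?P v] P bs'(2,3) trunc_nodes_subset[of m F r]
      unfolding bs'(1) by auto
    also have "\<dots> \<le> (\<Sum>\<alpha>\<in>trunc_nodes m F r. \<Sum>\<^sub>\<infinity>k\<in>{k. r \<alpha> < enat k}. \<bar>\<sigma> \<alpha> k\<bar>\<^sup>2)"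
    proof (rule sum_mono)
      fix \<alpha> assume "\<alpha> \<in> trunc_nodes m F r"
      then have \<alpha>: "\<alpha> \<in> nodes m F" using trunc_nodes_subset by blast
      obtain V where "mode_svd N d m v \<alpha> (\<sigma> \<alpha>) (U \<alpha>) V" using node_svd[OF \<alpha>] by blast
      then show "(norm (v - ?P \<alpha> v))\<^sup>2 \<le> (\<Sum>\<^sub>\<infinity>k\<in>{k. r \<alpha> < enat k}. \<bar>\<sigma> \<alpha> k\<bar>\<^sup>2)"
        by (rule truncation_error[OF refl node_subset[OF \<alpha>] v])
    qed
    finally show ?thesis unfolding trunc_bound_eq by (rule real_le_rsqrt)
  qed
qed

lemma trunc_bound_le:
  assumes "x \<in> format_set N d m F r"
  shows "trunc_bound m F \<sigma> r \<le> kappa_P m F * norm (v - x)"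
proof -
  have "(\<Sum>\<alpha>\<in>trunc_nodes m F r. \<Sum>\<^sub>\<infinity>k\<in>{k. r \<alpha> < enat k}. \<bar>\<sigma> \<alpha> k\<bar>\<^sup>2) \<le>
      real (card (trunc_nodes m F r)) * (norm (v - x))\<^sup>2"
  proof (rule sum_bounded_above)
    fix \<alpha> assume "\<alpha> \<in> trunc_nodes m F r"
    then have \<alpha>: "\<alpha> \<in> nodes m F" using trunc_nodes_subset by blast
    obtain V where "mode_svd N d m v \<alpha> (\<sigma> \<alpha>) (U \<alpha>) V" using node_svd[OF \<alpha>] by blast
    then show "(\<Sum>\<^sub>\<infinity>k\<in>{k. r \<alpha> < enat k}. \<bar>\<sigma> \<alpha> k\<bar>\<^sup>2) \<le> (norm (v - x))\<^sup>2"
      using assms \<alpha> by (intro eckart_young[OF refl node_subset[OF \<alpha>] v]) (auto simp: format_set_def)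
  qed
  then have "trunc_bound m F \<sigma> r \<le> sqrt (real (card (trunc_nodes m F r)) * (norm (v - x))\<^sup>2)"
    unfolding trunc_bound_eq by (rule real_sqrt_le_mono)
  also have "\<dots> = sqrt (real (card (trunc_nodes m F r))) * norm (v - x)"
    by (simp add: real_sqrt_mult)
  also have "\<dots> \<le> kappa_P m F * norm (v - x)"
    by (intro mult_right_mono card_trunc_nodes_le F m) simp
  finally show ?thesis .
qed

end

end

section \<open>Growth sequences and best approximation errors\<close>

lemma norm_diff_triangle_via: "norm (a - c) \<le> norm (a - b) + norm (b - c)"
  using dist_triangle[of a c b] by (simp add: dist_norm)

text \<open>If \<open>n\<close> is the last index with \<open>\<gamma> n\<close> at most
  \<open>\<rho>\<close> times \<open>y\<close>, then \<open>\<gamma> (Suc n)\<close> exceeds this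
  value, and it is at most \<open>\<rho>\<close> times \<open>\<gamma> n\<close>. Cancelling
  \<open>\<rho>\<close> leaves the strict inequality.\<close>

lemma growth_sequence_at_inv:
  assumes \<gamma>: "growth_sequence \<gamma>" and bdd: "bdd_above (growth_ratios \<gamma>)" and "0 \<le> y"
  shows "y < \<gamma> (growth_inv \<gamma> (Sup (growth_ratios \<gamma>) * y))"
proof -
  let ?\<rho> = "Sup (growth_ratios \<gamma>)" and ?n = "growth_inv \<gamma> (Sup (growth_ratios \<gamma>) * y)"
  have pos: "0 < \<gamma> n" and mono: "strict_mono \<gamma>" and \<gamma>0: "\<gamma> 0 = 1"
    and lim: "filterlim \<gamma> at_top sequentially" for n
    using \<gamma> by (auto simp: growth_sequence_def)
  have ratio: "\<gamma> (Suc n) / \<gamma> n \<le> ?\<rho>" for n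
    by (rule cSup_upper[OF _ bdd]) (auto simp: growth_ratios_def intro!: exI[of _ "Suc n"])
  have "1 < \<gamma> (Suc 0) / \<gamma> 0" using strict_monoD[OF mono, of 0 "Suc 0"] \<gamma>0 by simp
  then have \<rho>: "1 < ?\<rho>" using ratio[of 0] by linarith
  show ?thesis
  proof (cases "1 \<le> ?\<rho> * y")
    case True
    have "\<forall>\<^sub>F n in sequentially. ?\<rho> * y < \<gamma> n"
      using lim by (simp add: filterlim_at_top_dense)
    then obtain n0 where n0: "\<And>n. n0 \<le> n \<Longrightarrow> ?\<rho> * y < \<gamma> n" by (auto simp: eventually_sequentially)
    have "{n. \<gamma> n \<le> ?\<rho> * y} \<subseteq> {..<n0}"
      using n0 by (force simp: not_le)
    then have fin: "finite {n. \<gamma> n \<le> ?\<rho> * y}" by (rule finite_subset) simp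
    have "Suc ?n \<notin> {n. \<gamma> n \<le> ?\<rho> * y}"
    proof
      assume "Suc ?n \<in> {n. \<gamma> n \<le> ?\<rho> * y}"
      from Max_ge[OF fin this] show False using True by (simp add: growth_inv_def)
    qed
    then have "?\<rho> * y < \<gamma> (Suc ?n)" by simp
    also have "\<dots> \<le> ?\<rho> * \<gamma> ?n" using ratio[of ?n] pos[of ?n] by (simp add: divide_le_eq)
    finally show ?thesis using \<rho> by simp
  next
    case False
    \<comment> \<open>Here \<open>growth_inv\<close> takes its default value 0, and \<open>y\<close>
      is below \<open>\<gamma> 0 = 1\<close> because \<open>\<rho>\<close> is greater than
      1.\<close>
    have "y \<le> ?\<rho> * y" using \<rho> \<open>0 \<le> y\<close> by (simp add: mult_le_cancel_right1)
    with False show ?thesis by (simp add: growth_inv_def \<gamma>0)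
  qed
qed

text \<open>Belongs to the zero tensor and fits every rank limit, so the infimum in
  \<open>best_error\<close> is over a nonempty set. The restriction makes it extensional, as
  admissible rank vectors must be.\<close>

definition zero_ranks :: "nat \<Rightarrow> tensor_format \<Rightarrow> nat set \<Rightarrow> enat"
  where "zero_ranks m F = restrict (\<lambda>_. 0) (nodes m F)"

section \<open>Best approximation errors and the recompression estimates\<close>

context tensor_modes
begin

context
  fixes m :: nat and F :: tensor_format
  assumes F: "valid_format m F" and m: "2 \<le> m"
begin

lemma zero_ranks_admissible: "zero_ranks m F \<in> admissible_ranks N d m F"
proof (cases F)
  case Tucker
  then show ?thesis by (simp add: admissible_ranks_def zero_ranks_def)
next
  case (Hierarchical D)
  let ?V = "\<lambda>_ _. 0 :: 'n tensor"
  have upto: "upto_enat 0 = {}" by (auto simp: upto_enat_def zero_enat_def)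
  have "nested_frames N d m D (zero_ranks m F) ?V"
    unfolding nested_frames_def
  proof (intro ballI impI)
    fix \<alpha> assume "\<alpha> \<in> D" "\<alpha> \<noteq> {1..m} \<and> \<not> is_singleton \<alpha>"
    then have "zero_ranks m F \<alpha> = 0" by (simp add: zero_ranks_def nodes_def Hierarchical)
    then have "closure (span (?V \<alpha> ` upto_enat (zero_ranks m F \<alpha>))) = {0}" by (simp add: upto)
    then show "closure (span (?V \<alpha> ` upto_enat (zero_ranks m F \<alpha>))) \<subseteq>
      closure (span {tensor_prod N d {child1 D \<alpha>, child2 D \<alpha>} x | x.
        \<forall>\<beta>\<in>{child1 D \<alpha>, child2 D \<alpha>}. x \<beta> \<in> closure (span (?V \<beta> ` upto_enat (zero_ranks m F \<beta>)))})"
      using span_zero closure_subset by (metis (no_types, lifting) empty_subsetI insert_subset subsetD)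
  qed
  moreover have "orthonormal_family (zero_ranks m F \<alpha>) (?V \<alpha>) \<and>
      ?V \<alpha> ` upto_enat (zero_ranks m F \<alpha>) \<subseteq> modes \<alpha>" if "\<alpha> \<in> nodes m F" for \<alpha>
    using that by (simp add: zero_ranks_def orthonormal_family_def upto)
  ultimately have "\<exists>V :: nat set \<Rightarrow> nat \<Rightarrow> 'n tensor.
      (\<forall>\<alpha>\<in>nodes m F. orthonormal_family (zero_ranks m F \<alpha>) (V \<alpha>) \<and>
        V \<alpha> ` upto_enat (zero_ranks m F \<alpha>) \<subseteq> modes \<alpha>) \<and> nested_frames N d m D (zero_ranks m F) V"
    by (intro exI[of _ ?V]) blast
  moreover have "zero_ranks m F \<in> nodes m F \<rightarrow>\<^sub>E UNIV" by (simp add: zero_ranks_def)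
  ultimately show ?thesis
    unfolding admissible_ranks_def Hierarchical tensor_format.case by simp
qed

lemma zero_in_format: "0 \<in> format_set N d m F (zero_ranks m F)"
  unfolding format_set_def
proof (intro CollectI conjI ballI)
  show 0: "0 \<in> modes {1..m}" by (rule subspace_0[OF subspace_ell2_on])
  fix \<alpha> assume \<alpha>: "\<alpha> \<in> nodes m F"
  have "rank_at N d m 0 \<alpha> \<le> enat (card ({} :: 'n tensor set))"
    by (rule rank_at_leI[OF refl nodes_subset[OF F \<alpha>] 0]) (simp_all add: span_zero)
  then show "rank_at N d m 0 \<alpha> \<le> zero_ranks m F \<alpha>"
    using \<alpha> by (simp add: zero_ranks_def flip: zero_enat_def)
qed

lemma max_rank_zero_ranks: "max_rank m F (zero_ranks m F) \<le> n"
  unfolding max_rank_le_iff[OF F m] by (simp add: zero_ranks_def)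

lemma best_error_le:
  assumes "w \<in> format_set N d m F r" "r \<in> admissible_ranks N d m F" "max_rank m F r \<le> enat n"
  shows "best_error N d m F v n \<le> norm (v - w)"
  unfolding best_error_def by (rule cInf_lower) (use assms in \<open>auto intro!: bdd_belowI[of _ 0]\<close>)

lemma best_error_candidates:
  "{norm (v - w) | w r. w \<in> format_set N d m F r \<and> r \<in> admissible_ranks N d m F \<and> max_rank m F r \<le> enat n} \<noteq> {}"
  using zero_in_format zero_ranks_admissible max_rank_zero_ranks by blast

lemma best_error_nonneg: "0 \<le> best_error N d m F v n"
  unfolding best_error_def by (rule cInf_greatest[OF best_error_candidates]) auto

lemma best_error_lessD:
  assumes "best_error N d m F v n < e"
  obtains w r where "w \<in> format_set N d m F r" "r \<in> admissible_ranks N d m F"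
    "max_rank m F r \<le> enat n" "norm (v - w) < e"
  using cInf_lessD[OF best_error_candidates assms[unfolded best_error_def]] by auto

lemma best_error_zero_rank_le: "best_error N d m F v n \<le> norm v"
  using best_error_le[OF zero_in_format zero_ranks_admissible max_rank_zero_ranks, of v n] by simp

lemma best_error_triangle: "best_error N d m F w n \<le> norm (u - w) + best_error N d m F u n"
proof -
  have "best_error N d m F w n - norm (u - w) \<le> best_error N d m F u n"
    unfolding best_error_def[of N d m F u]
  proof (rule cInf_greatest[OF best_error_candidates])
    fix e assume "e \<in> {norm (u - x) | x r. x \<in> format_set N d m F r \<and>
      r \<in> admissible_ranks N d m F \<and> max_rank m F r \<le> enat n}"
    then obtain x r where x: "e = norm (u - x)" "x \<in> format_set N d m F r"
      "r \<in> admissible_ranks N d m F" "max_rank m F r \<le> enat n" by blast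
    have "best_error N d m F w n \<le> norm (w - x)" by (rule best_error_le[OF x(2-4)])
    also have "\<dots> \<le> norm (w - u) + norm (u - x)" by (rule norm_diff_triangle_via)
    finally show "best_error N d m F w n - norm (u - w) \<le> e"
      by (simp add: x(1) norm_minus_commute)
  qed
  then show ?thesis by simp
qed

lemma kappa_nonneg: "0 \<le> kappa_P m F"
  using card_trunc_nodes_le[OF F m, of undefined] real_sqrt_ge_zero[of "real (card (trunc_nodes m F undefined))"]
  by linarith

lemma recompression_properties:
  fixes \<alpha> \<eta> :: real
  assumes \<gamma>: "growth_sequence \<gamma>" and \<alpha>: "0 < \<alpha>" and \<eta>: "0 < \<eta>"
    and u: "u \<in> approx_class N d m F \<gamma>" and v: "v \<in> modes {1..m}" and uv: "norm (u - v) \<le> \<eta>"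
    and w: "w \<in> recompressions N d m F (kappa_P m F * (1 + \<alpha>) * \<eta>) v"
  shows "(bdd_above (growth_ratios \<gamma>) \<longrightarrow>
      max_rank m F (rank_at N d m w) \<le>
        enat (growth_inv \<gamma> (Sup (growth_ratios \<gamma>) * approx_norm N d m F \<gamma> u / (\<alpha> * \<eta>)))) \<and>
    norm (u - w) \<le> (1 + kappa_P m F * (1 + \<alpha>)) * \<eta> \<and>
    w \<in> approx_class N d m F \<gamma> \<and>
    approx_norm N d m F \<gamma> w \<le>
      (inverse \<alpha> * (1 + kappa_P m F * (1 + \<alpha>)) + 1) * approx_norm N d m F \<gamma> u"
proof -
  let ?\<kappa> = "kappa_P m F" and ?E = "best_error N d m F"
  let ?C = "inverse \<alpha> * (1 + ?\<kappa> * (1 + \<alpha>)) + 1"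
  obtain \<sigma> U r where w_eq: "w = format_proj N d m F U r v" and sys: "singular_system N d m F v \<sigma> U"
    and opt: "r \<in> optimal_ranks N d m F \<sigma> (?\<kappa> * (1 + \<alpha>) * \<eta>)"
    using w by (auto simp: recompressions_def)
  have r: "r \<in> admissible_ranks N d m F" "trunc_bound m F \<sigma> r \<le> ?\<kappa> * (1 + \<alpha>) * \<eta>"
    and minimal: "\<And>r'. r' \<in> admissible_ranks N d m F \<Longrightarrow> trunc_bound m F \<sigma> r' \<le> ?\<kappa> * (1 + \<alpha>) * \<eta> \<Longrightarrow>
      max_rank m F r \<le> max_rank m F r'"
    using opt by (auto simp: optimal_ranks_def is_arg_min_def not_less)
  note proj = format_proj_properties[OF F m v sys, where r = r, folded w_eq]
  have w_in: "w \<in> format_set N d m F r"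
    using proj(1,2) by (simp add: format_set_def)
  have rank_w: "max_rank m F (rank_at N d m w) \<le> max_rank m F r"
    unfolding max_rank_le_iff[OF F m]
    using proj(2) max_rank_le_iff[OF F m, of r "max_rank m F r"] order.trans by blast
  have rank_le: "max_rank m F r \<le> enat n" if "?E u n < \<alpha> * \<eta>" for n
  proof -
    from that obtain x s where x: "x \<in> format_set N d m F s" "s \<in> admissible_ranks N d m F"
      "max_rank m F s \<le> enat n" "norm (u - x) < \<alpha> * \<eta>"
      by (rule best_error_lessD)
    \<comment> \<open>Origin of the tolerance: \<open>\<eta>\<close> for passing from
      \<open>v\<close> to \<open>u\<close>, \<open>\<alpha> * \<eta>\<close> for the approximant of
      \<open>u\<close>, and \<open>?\<kappa>\<close> for comparing the tails with the error.\<close>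
    have "norm (v - x) \<le> norm (v - u) + norm (u - x)" by (rule norm_diff_triangle_via)
    also have "\<dots> \<le> (1 + \<alpha>) * \<eta>" using uv x(4) by (simp add: norm_minus_commute distrib_right)
    finally have "?\<kappa> * norm (v - x) \<le> ?\<kappa> * ((1 + \<alpha>) * \<eta>)"
      by (rule mult_left_mono[OF _ kappa_nonneg])
    then have "trunc_bound m F \<sigma> s \<le> ?\<kappa> * (1 + \<alpha>) * \<eta>"
      using trunc_bound_le[OF F m v sys x(1)] by (simp add: mult.assoc)
    from minimal[OF x(2) this] x(3) show ?thesis by (rule order.trans)
  qed
  have uw: "norm (u - w) \<le> (1 + ?\<kappa> * (1 + \<alpha>)) * \<eta>"
  proof -
    have "norm (u - w) \<le> norm (u - v) + norm (v - w)" by (rule norm_diff_triangle_via)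
    also have "\<dots> \<le> \<eta> + ?\<kappa> * (1 + \<alpha>) * \<eta>" using uv proj(5) r(2) by linarith
    finally show ?thesis by (simp add: algebra_simps)
  qed
  have pos: "0 < \<gamma> n" for n using \<gamma> by (simp add: growth_sequence_def)
  define A where "A = (SUP n. \<gamma> n * ?E u n)"
  have bdd: "bdd_above (range (\<lambda>n. \<gamma> n * ?E u n))" using u by (simp add: approx_class_def)
  have A_upper: "\<gamma> n * ?E u n \<le> A" for n unfolding A_def by (rule cSUP_upper[OF UNIV_I bdd])
  have A0: "0 \<le> A" using A_upper[of 0] pos[of 0] best_error_nonneg[of u 0]
    by (meson less_imp_le mult_nonneg_nonneg order.trans)
  have norm_u: "approx_norm N d m F \<gamma> u = norm u + A" by (simp add: approx_norm_def A_def)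
  have C1: "1 \<le> ?C" using \<alpha> kappa_nonneg by simp
  \<comment> \<open>Origin of \<open>?C\<close>: once \<open>\<eta>\<close> is at most
    \<open>y\<close> divided by \<open>\<alpha>\<close>, the total error is at most
    \<open>?C - 1\<close> times \<open>y\<close>.\<close>
  have C_scale: "(1 + ?\<kappa> * (1 + \<alpha>)) * \<eta> + y \<le> ?C * y" if "\<alpha> * \<eta> \<le> y" for y
  proof -
    have "\<eta> \<le> inverse \<alpha> * y" using that \<alpha> by (simp add: field_simps)
    then have "(1 + ?\<kappa> * (1 + \<alpha>)) * \<eta> \<le> (1 + ?\<kappa> * (1 + \<alpha>)) * (inverse \<alpha> * y)"
      using \<alpha> kappa_nonneg by (intro mult_left_mono) auto
    then show ?thesis by (simp add: algebra_simps)
  qed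
  have large: "\<alpha> * \<eta> \<le> ?E u n" if "\<not> max_rank m F r \<le> enat n" for n
    using rank_le[of n] that by (meson not_less)
  have term_le: "\<gamma> n * ?E w n \<le> ?C * A" for n
  proof (cases "max_rank m F r \<le> enat n")
    case True
    have "?E w n \<le> norm (w - w)" by (rule best_error_le[OF w_in r(1) True])
    then have "?E w n = 0" using best_error_nonneg[of w n] by simp
    then show ?thesis using C1 A0 by simp
  next
    case False
    have "?E w n \<le> (1 + ?\<kappa> * (1 + \<alpha>)) * \<eta> + ?E u n" using best_error_triangle[of w n u] uw by linarith
    also have "\<dots> \<le> ?C * ?E u n" by (rule C_scale[OF large[OF False]])
    finally have "\<gamma> n * ?E w n \<le> \<gamma> n * (?C * ?E u n)" using pos[of n] by (intro mult_left_mono) auto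
    also have "\<dots> = ?C * (\<gamma> n * ?E u n)" by simp
    also have "\<dots> \<le> ?C * A" using A_upper[of n] C1 by (intro mult_left_mono) auto
    finally show ?thesis .
  qed
  \<comment> \<open>Either all ranks are 0 and \<open>w\<close> vanishes, or rank 0 was not
    feasible. Then \<open>\<alpha> * \<eta>\<close> is at most the error of \<open>u\<close> at rank
    0, which the zero tensor bounds by \<open>norm u\<close>.\<close>
  have norm_w: "norm w \<le> ?C * norm u"
  proof (cases "max_rank m F r \<le> enat 0")
    case True
    then have "r \<beta> = 0" if "\<beta> \<in> nodes m F" for \<beta>
      using that unfolding max_rank_le_iff[OF F m] by (simp flip: zero_enat_def)
    then have "w = 0" by (rule proj(4))
    then show ?thesis using C1 by simp
  next
    case False
    have "\<alpha> * \<eta> \<le> norm u" using large[OF False] best_error_zero_rank_le[of u 0] by linarith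
    note C_scale[OF this]
    moreover have "norm w \<le> norm (u - w) + norm u"
      using norm_triangle_sub[of w u] by (simp add: norm_minus_commute)
    ultimately show ?thesis using uw by linarith
  qed
  have "w \<in> approx_class N d m F \<gamma>"
    using proj(1) term_le by (auto simp: approx_class_def intro!: bdd_aboveI[of _ "?C * A"])
  moreover have "approx_norm N d m F \<gamma> w \<le> ?C * approx_norm N d m F \<gamma> u"
  proof -
    have "(SUP n. \<gamma> n * ?E w n) \<le> ?C * A" by (rule cSUP_least) (simp_all add: term_le)
    then show ?thesis using norm_w unfolding norm_u approx_norm_def[of _ _ _ _ _ w] by (simp only: distrib_left)
  qed
  moreover have "max_rank m F (rank_at N d m w) \<le>
      enat (growth_inv \<gamma> (Sup (growth_ratios \<gamma>) * approx_norm N d m F \<gamma> u / (\<alpha> * \<eta>)))"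
    if bdd_ratio: "bdd_above (growth_ratios \<gamma>)"
  proof -
    let ?y = "approx_norm N d m F \<gamma> u / (\<alpha> * \<eta>)"
    let ?n = "growth_inv \<gamma> (Sup (growth_ratios \<gamma>) * ?y)"
    have "0 \<le> ?y" using \<alpha> \<eta> A0 by (simp add: norm_u)
    then have "?y < \<gamma> ?n" by (rule growth_sequence_at_inv[OF \<gamma> bdd_ratio])
    then have "approx_norm N d m F \<gamma> u < \<gamma> ?n * (\<alpha> * \<eta>)"
      using \<alpha> \<eta> by (simp add: pos_divide_less_eq)
    moreover have "\<gamma> ?n * ?E u ?n \<le> approx_norm N d m F \<gamma> u"
      using A_upper[of ?n] by (simp add: norm_u add_increasing)
    ultimately have "\<gamma> ?n * ?E u ?n < \<gamma> ?n * (\<alpha> * \<eta>)" by linarith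
    then have "?E u ?n < \<alpha> * \<eta>" using pos[of ?n] by simp
    then have "max_rank m F r \<le> enat ?n" by (rule rank_le)
    from order.trans[OF rank_w this] show ?thesis by (simp only: times_divide_eq_right)
  qed
  ultimately show ?thesis using uw by blast
qed

end

end

theorem theorem6:
  fixes N :: "'n set" and d :: "nat \<Rightarrow> nat" and m :: nat and F :: tensor_format
    and \<gamma> :: "nat \<Rightarrow> real" and \<alpha> \<eta> :: real and u v w :: "'n tensor"
  assumes "countable N" and "2 \<le> m" and "\<forall>i\<in>{1..m}. 1 \<le> d i"
    and "valid_format m F" and "growth_sequence \<gamma>" and "0 < \<alpha>" and "0 < \<eta>"
    and "u \<in> approx_class N d m F \<gamma>"
    and "v \<in> modes_space N d {1..m}" and "norm (u - v) \<le> \<eta>"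
    and "w \<in> recompressions N d m F (kappa_P m F * (1 + \<alpha>) * \<eta>) v"
  shows "(bdd_above (growth_ratios \<gamma>) \<longrightarrow>
      max_rank m F (rank_at N d m w) \<le>
        enat (growth_inv \<gamma> (Sup (growth_ratios \<gamma>) * approx_norm N d m F \<gamma> u / (\<alpha> * \<eta>)))) \<and>
    norm (u - w) \<le> (1 + kappa_P m F * (1 + \<alpha>)) * \<eta> \<and>
    w \<in> approx_class N d m F \<gamma> \<and>
    approx_norm N d m F \<gamma> w \<le>
      (inverse \<alpha> * (1 + kappa_P m F * (1 + \<alpha>)) + 1) * approx_norm N d m F \<gamma> u"
  by (rule tensor_modes.recompression_properties[OF assms(4,2,5-11)])

end
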